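(* Let $n\ge2$, let $\mathfrak z$ be a field, and let $p(u)=-u^{n+1}+A_0u^n+\ldots+A_n\in\mathfrak z[u]$ with $p(0)=A_n\ne0$. Then, up to a factor from $\mathfrak z(x)$, the principal solutions $K(x)\in\mathcal K_p(x)$ of the equation $R(\frac xy)K(x)R(xy)K(y)=K(y)R(xy)K(x)R(\frac xy)$ in $\mathcal H_p(x,y)$ are exactly the elements $$K_p(\xi,x)=\sum_{i=0}^{n-1}\phi_i(\xi,x)K^{n-i}+\frac{\xi^{-1}p(0)-x^{-1}\phi_n(\xi,x)}{x-x^{-1}},$$ where $\xi$ is an arbitrary non-zero element of $\mathfrak z$, and $\phi_0(\xi,x):=1$, $\phi_{i+1}(\xi,x):=\xi x\,\phi_i(\xi,x)-A_i$.
   Context: $k$ is a field of characteristic zero, $\mathfrak z$ is a commutative unital $k$-algebra, $q\in k$ is invertible with $q\ne\pm1$, and $\omega:=q-q^{-1}$. The affine Hecke algebra $\mathcal H$ is the unital associative $\mathfrak z$-algebra generated by $R,K$ with relations $R^2=\omega R+1$ and $RKRK=KRKR$; thus $R^{-1}=R-\omega$. For $p\in\mathfrak z[u]$, $\mathcal H_p$ is the quotient of $\mathcal H$ by the two-sided ideal generated by $p(K)$, and $\mathcal K_p\subset\mathcal H_p$ is the $\mathfrak z$-subalgebra generated by $K$; one has $\mathcal K_p\simeq\mathfrak z[u]/(p)$. For a $k$-module $B$ put $B(x):=B\otimes_k k(x)$ and $B(x,y):=B\otimes_k k(x,y)$. Put $R(x):=R-x^{-1}R^{-1}$. For $n>1$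 put $\tilde K:=K^n-A_0K^{n-1}-\ldots-A_{n-1}$; then $\{K^i\}_{i=0}^{n-1}\cup\{\tilde K\}$ is a $\mathfrak z$-basis of $\mathcal K_p$. For $n>1$ a solution $K(x)\in\mathcal K_p(x)$ is called principal if the coefficient of $K^{n-1}$ in its expansion over this basis is non-zero. *)

theory Defs
  imports
    "HOL-Library.Poly_Mapping"
    "HOL-Computational_Algebra.Fraction_Field"
    "HOL-Computational_Algebra.Polynomial"
    "HOL-Algebra.Algebra"
    "HOL-Algebra.Algebraic_Closure_Type"
begin

section \<open>Monoid rings\<close>

definition monoid_ring :: "('a, 'm) monoid_scheme \<Rightarrow> ('a \<Rightarrow>\<^sub>0 'c::comm_ring_1) ring" where
  "monoid_ring G = \<lparr>carrier = {f. Poly_Mapping.keys f \<subseteq> carrier G},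
     monoid.mult = (\<lambda>f g. \<Sum>a\<in>Poly_Mapping.keys f. \<Sum>b\<in>Poly_Mapping.keys g.
        Poly_Mapping.single (a \<otimes>\<^bsub>G\<^esub> b) (Poly_Mapping.lookup f a * Poly_Mapping.lookup g b)),
     one = Poly_Mapping.single \<one>\<^bsub>G\<^esub> 1, ring.zero = 0, add = (+)\<rparr>"

lemma monoid_ring_mult_superset:
  assumes "finite S" "finite T" "Poly_Mapping.keys f \<subseteq> S" "Poly_Mapping.keys g \<subseteq> T"
  shows "f \<otimes>\<^bsub>monoid_ring G\<^esub> g = (\<Sum>a\<in>S. \<Sum>b\<in>T.
    Poly_Mapping.single (a \<otimes>\<^bsub>G\<^esub> b) (Poly_Mapping.lookup f a * Poly_Mapping.lookup g b))"
proof -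
  have "f \<otimes>\<^bsub>monoid_ring G\<^esub> g = (\<Sum>a\<in>Poly_Mapping.keys f. \<Sum>b\<in>T.
    Poly_Mapping.single (a \<otimes>\<^bsub>G\<^esub> b) (Poly_Mapping.lookup f a * Poly_Mapping.lookup g b))"
    using assms unfolding monoid_ring_def
    by (simp, intro sum.cong refl sum.mono_neutral_left) (auto simp: not_in_keys_iff_lookup_eq_zero)
  also have "\<dots> = (\<Sum>a\<in>S. \<Sum>b\<in>T.
    Poly_Mapping.single (a \<otimes>\<^bsub>G\<^esub> b) (Poly_Mapping.lookup f a * Poly_Mapping.lookup g b))"
    using assms by (intro sum.mono_neutral_left) (auto simp: in_keys_iff)
  finally show ?thesis .
qed

lemma monoid_ring_mult_add_left:
  "(f + g) \<otimes>\<^bsub>monoid_ring G\<^esub> h = f \<otimes>\<^bsub>monoid_ring G\<^esub> h + g \<otimes>\<^bsub>monoid_ring G\<^esub> h"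
proof -
  let ?S = "Poly_Mapping.keys f \<union> Poly_Mapping.keys g"
  have "Poly_Mapping.keys (f + g) \<subseteq> ?S" by (rule Poly_Mapping.keys_add)
  then show ?thesis
    by (simp add: monoid_ring_mult_superset[where S="?S" and T="Poly_Mapping.keys h"]
        lookup_add distrib_right single_add sum.distrib)
qed

lemma monoid_ring_mult_add_right:
  "h \<otimes>\<^bsub>monoid_ring G\<^esub> (f + g) = h \<otimes>\<^bsub>monoid_ring G\<^esub> f + h \<otimes>\<^bsub>monoid_ring G\<^esub> g"
proof -
  let ?S = "Poly_Mapping.keys f \<union> Poly_Mapping.keys g"
  have "Poly_Mapping.keys (f + g) \<subseteq> ?S" by (rule Poly_Mapping.keys_add)
  then show ?thesis
    by (simp add: monoid_ring_mult_superset[where T="?S" and S="Poly_Mapping.keys h"]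
        lookup_add distrib_left single_add sum.distrib)
qed

lemma monoid_ring_mult_zero [simp]:
  "0 \<otimes>\<^bsub>monoid_ring G\<^esub> h = 0" "h \<otimes>\<^bsub>monoid_ring G\<^esub> 0 = 0"
  by (simp_all add: monoid_ring_def)

lemma monoid_ring_mult_single:
  "Poly_Mapping.single a c \<otimes>\<^bsub>monoid_ring G\<^esub> Poly_Mapping.single b d
    = Poly_Mapping.single (a \<otimes>\<^bsub>G\<^esub> b) (c * d)"
  using monoid_ring_mult_superset[of "{a}" "{b}" "Poly_Mapping.single a c" "Poly_Mapping.single b d" G]
  by simp

lemma monoid_ring_induct [consumes 1, case_names zero single add]:
  fixes P :: "('a \<Rightarrow>\<^sub>0 'c::comm_ring_1) \<Rightarrow> bool"
  assumes "f \<in> carrier (monoid_ring G)" "P 0"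
    and "\<And>a c. a \<in> carrier G \<Longrightarrow> P (Poly_Mapping.single a c)"
    and "\<And>f g. P f \<Longrightarrow> P g \<Longrightarrow> P (f + g)"
  shows "P f"
proof -
  have "P (\<Sum>a\<in>A. Poly_Mapping.single a (Poly_Mapping.lookup f a))"
    if "finite A" "A \<subseteq> Poly_Mapping.keys f" for A
    using that
  proof (induction A rule: finite_induct)
    case (insert x F)
    have "x \<in> carrier G"
      using insert.prems assms(1) by (auto simp: monoid_ring_def)
    with insert assms show ?case by simp
  qed (use assms in simp)
  moreover have "(\<Sum>a\<in>Poly_Mapping.keys f. Poly_Mapping.single a (Poly_Mapping.lookup f a)) = f"
    by (rule poly_mapping_eqI)
      (simp add: lookup_sum lookup_single when_def sum.delta not_in_keys_iff_lookup_eq_zero)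
  ultimately show ?thesis
    by (metis finite_keys order_refl)
qed

text \<open>If this were not a ring, ideals generated in it would degenerate to the whole type.\<close>

lemma ring_monoid_ring:
  assumes "monoid G"
  shows "ring (monoid_ring G :: ('a \<Rightarrow>\<^sub>0 'c::comm_ring_1) ring)"
proof -
  interpret G: monoid G by fact
  let ?R = "monoid_ring G :: ('a \<Rightarrow>\<^sub>0 'c) ring"
  have add [simp]: "f \<oplus>\<^bsub>?R\<^esub> g = f + g" and zero [simp]: "\<zero>\<^bsub>?R\<^esub> = 0"
    and one [simp]: "\<one>\<^bsub>?R\<^esub> = Poly_Mapping.single \<one>\<^bsub>G\<^esub> 1"
    and carr: "f \<in> carrier ?R \<longleftrightarrow> Poly_Mapping.keys f \<subseteq> carrier G" for f g
    by (simp_all add: monoid_ring_def)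
  have add_closed: "f + g \<in> carrier ?R" if "f \<in> carrier ?R" "g \<in> carrier ?R" for f g
    using that Poly_Mapping.keys_add[of f g] by (auto simp: carr)
  have mult_closed: "f \<otimes>\<^bsub>?R\<^esub> g \<in> carrier ?R" if f: "f \<in> carrier ?R" and g: "g \<in> carrier ?R" for f g
    using f
  proof (induction f rule: monoid_ring_induct)
    case (single a c)
    from g show ?case
      by (induction g rule: monoid_ring_induct)
        (use single in \<open>auto simp: carr monoid_ring_mult_single monoid_ring_mult_add_right
          intro: add_closed[unfolded carr, THEN subsetD]\<close>)
  qed (auto simp: monoid_ring_mult_add_left add_closed, auto simp: carr)
  have assoc: "f \<otimes>\<^bsub>?R\<^esub> g \<otimes>\<^bsub>?R\<^esub> h = f \<otimes>\<^bsub>?R\<^esub> (g \<otimes>\<^bsub>?R\<^esub> h)"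
    if f: "f \<in> carrier ?R" and g: "g \<in> carrier ?R" and h: "h \<in> carrier ?R" for f g h
    using f
  proof (induction f rule: monoid_ring_induct)
    case (single a c)
    from g show ?case
    proof (induction g rule: monoid_ring_induct)
      case (single b d)
      from h show ?case
        by (induction h rule: monoid_ring_induct)
          (use single \<open>a \<in> carrier G\<close> in \<open>simp_all add: monoid_ring_mult_single monoid_ring_mult_add_right
             G.m_assoc mult.assoc\<close>)
    qed (simp_all add: monoid_ring_mult_add_left monoid_ring_mult_add_right)
  qed (simp_all add: monoid_ring_mult_add_left)
  have l_one: "\<one>\<^bsub>?R\<^esub> \<otimes>\<^bsub>?R\<^esub> f = f" if "f \<in> carrier ?R" for f
    using that by (induction f rule: monoid_ring_induct)
      (simp_all add: monoid_ring_mult_single monoid_ring_mult_add_right)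
  have r_one: "f \<otimes>\<^bsub>?R\<^esub> \<one>\<^bsub>?R\<^esub> = f" if "f \<in> carrier ?R" for f
    using that by (induction f rule: monoid_ring_induct)
      (simp_all add: monoid_ring_mult_single monoid_ring_mult_add_left)
  show ?thesis
  proof (rule ringI)
    show "abelian_group ?R"
    proof (rule abelian_groupI)
      fix f assume "f \<in> carrier ?R"
      then show "\<exists>g\<in>carrier ?R. g \<oplus>\<^bsub>?R\<^esub> f = \<zero>\<^bsub>?R\<^esub>"
        by (intro bexI[of _ "- f"]) (auto simp: carr)
    qed (auto simp: add_closed add.assoc add.commute, auto simp: carr)
    show "Group.monoid ?R"
      by (rule monoidI) (auto simp: mult_closed assoc l_one[simplified] r_one[simplified],
          auto simp: carr)
  qed (simp_all add: monoid_ring_mult_add_left monoid_ring_mult_add_right)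
qed

section \<open>Algebras and their tensor products\<close>

text \<open>The algebra structure on a ring \<open>A\<close> given by a map \<open>h\<close> into its centre.\<close>

definition algebra_via :: "('c \<Rightarrow> 'a) \<Rightarrow> ('a, 'm) ring_scheme \<Rightarrow> ('c, 'a) module" where
  "algebra_via h A = \<lparr>carrier = carrier A, monoid.mult = monoid.mult A, one = \<one>\<^bsub>A\<^esub>,
     ring.zero = \<zero>\<^bsub>A\<^esub>, add = add A, module.smult = (\<lambda>c a. h c \<otimes>\<^bsub>A\<^esub> a)\<rparr>"

text \<open>For algebras \<open>A\<close> and \<open>B\<close> over a common field, the free abelian group on
  \<open>A \<times> B\<close> with the product \<open>(a, b) (a', b') = (a a', b b')\<close> is the integral monoid ring of
  the multiplicative monoid \<open>A \<times> B\<close>. Since scalars are central, the subgroup generated by the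
  usual bilinearity relations is already a two-sided ideal, so dividing by the ideal they generate
  gives the tensor product of the underlying vector spaces with its standard algebra structure.\<close>

definition tensor_pre ::
  "('k, 'a) module \<Rightarrow> ('k, 'b) module \<Rightarrow> (('a \<times> 'b) \<Rightarrow>\<^sub>0 int) ring" where
  "tensor_pre A B = monoid_ring (A \<times>\<times> B)"

definition tensor_rels ::
  "('k, 'a) module \<Rightarrow> ('k, 'b) module \<Rightarrow> (('a \<times> 'b) \<Rightarrow>\<^sub>0 int) set" where
  "tensor_rels A B =
     {Poly_Mapping.single (a \<oplus>\<^bsub>A\<^esub> a', b) 1 - Poly_Mapping.single (a, b) 1 - Poly_Mapping.single (a', b) 1
       | a a' b. a \<in> carrier A \<and> a' \<in> carrier A \<and> b \<in> carrier B}
   \<union> {Poly_Mapping.single (a, b \<oplus>\<^bsub>B\<^esub> b') 1 - Poly_Mapping.single (a, b) 1 - Poly_Mapping.single (a, b') 1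
       | a b b'. a \<in> carrier A \<and> b \<in> carrier B \<and> b' \<in> carrier B}
   \<union> {Poly_Mapping.single (c \<odot>\<^bsub>A\<^esub> a, b) 1 - Poly_Mapping.single (a, c \<odot>\<^bsub>B\<^esub> b) 1
       | c a b. a \<in> carrier A \<and> b \<in> carrier B}"

definition tensor_ideal ::
  "('k, 'a) module \<Rightarrow> ('k, 'b) module \<Rightarrow> (('a \<times> 'b) \<Rightarrow>\<^sub>0 int) set" where
  "tensor_ideal A B = Idl\<^bsub>tensor_pre A B\<^esub> (tensor_rels A B)"

definition tensor ::
  "('k, 'a) module \<Rightarrow> ('k, 'b) module \<Rightarrow> (('a \<times> 'b) \<Rightarrow>\<^sub>0 int) set ring" where
  "tensor A B = tensor_pre A B Quot tensor_ideal A B"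

definition pure_tensor ::
  "('k, 'a) module \<Rightarrow> ('k, 'b) module \<Rightarrow> 'a \<Rightarrow> 'b \<Rightarrow> (('a \<times> 'b) \<Rightarrow>\<^sub>0 int) set" where
  "pure_tensor A B a b = tensor_ideal A B +>\<^bsub>tensor_pre A B\<^esub> Poly_Mapping.single (a, b) 1"

text \<open>The map induced by \<open>f \<otimes> g\<close>, where \<open>f\<close> and \<open>g\<close> are linear maps into \<open>A'\<close>
  and \<open>B'\<close>. Its argument is a coset, all of whose members have the same image.\<close>

definition tensor_map ::
  "('k, 'a2) module \<Rightarrow> ('k, 'b2) module \<Rightarrow> ('a1 \<Rightarrow> 'a2) \<Rightarrow> ('b1 \<Rightarrow> 'b2)
    \<Rightarrow> (('a1 \<times> 'b1) \<Rightarrow>\<^sub>0 int) set \<Rightarrow> (('a2 \<times> 'b2) \<Rightarrow>\<^sub>0 int) set" where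
  "tensor_map A' B' f g U = the_elem ((\<lambda>s. tensor_ideal A' B' +>\<^bsub>tensor_pre A' B'\<^esub>
      (\<Sum>(a, b)\<in>Poly_Mapping.keys s.
         Poly_Mapping.single (f a, g b) (Poly_Mapping.lookup s (a, b)))) ` U)"

section \<open>Rational functions\<close>

definition k_x :: "('k::field, 'k poly fract) module" where
  "k_x = algebra_via (\<lambda>c. Fract [:c:] 1) ring_of_type_algebra"

definition var_x :: "'k::field poly fract" where
  "var_x = Fract [:0, 1:] 1"

text \<open>\<open>k(x, y)\<close> is the fraction field of \<open>k[x][y]\<close>.\<close>

definition k_xy :: "('k::field, 'k poly poly fract) module" where
  "k_xy = algebra_via (\<lambda>c. Fract [:[:c:]:] 1) ring_of_type_algebra"

definition var2_x :: "'k::field poly poly fract" where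
  "var2_x = Fract [:[:0, 1:]:] 1"

definition var2_y :: "'k::field poly poly fract" where
  "var2_y = Fract [:0, 1:] 1"

text \<open>The extension of an injective ring homomorphism to the fraction fields.\<close>

definition fract_map :: "('a::idom \<Rightarrow> 'b::idom) \<Rightarrow> 'a fract \<Rightarrow> 'b fract" where
  "fract_map h r = (THE s. \<exists>a b. b \<noteq> 0 \<and> r = Fract a b \<and> s = Fract (h a) (h b))"

lemma fract_map_Fract:
  assumes "\<And>a b. h (a * b) = h a * h b" and "\<And>a. h a = 0 \<longleftrightarrow> a = 0" and "b \<noteq> 0"
  shows "fract_map h (Fract a b) = Fract (h a) (h b)"
  unfolding fract_map_def
proof (rule the_equality)
  fix s assume "\<exists>a' b'. b' \<noteq> 0 \<and> Fract a b = Fract a' b' \<and> s = Fract (h a') (h b')"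
  then obtain a' b' where *: "b' \<noteq> 0" "Fract a b = Fract a' b'" "s = Fract (h a') (h b')"
    by blast
  then have "a * b' = a' * b" using assms(3) by (simp add: eq_fract)
  then have "h a * h b' = h a' * h b" by (metis assms(1))
  with * assms(2,3) show "s = Fract (h a) (h b)" by (simp add: eq_fract)
qed (use assms in blast)

text \<open>The embeddings \<open>f(x) \<mapsto> f(x)\<close> and \<open>f(x) \<mapsto> f(y)\<close> of \<open>k(x)\<close> into \<open>k(x, y)\<close>.\<close>

definition at_x :: "'k::field poly fract \<Rightarrow> 'k poly poly fract" where
  "at_x = fract_map (\<lambda>a. [:a:])"

definition at_y :: "'k::field poly fract \<Rightarrow> 'k poly poly fract" where
  "at_y = fract_map (map_poly (\<lambda>c. [:c:]))"

section \<open>The affine Hecke algebra and its cyclotomic quotients\<close>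

datatype gen = GenR | GenK

text \<open>Throughout, \<open>\<iota> :: 'k \<Rightarrow> 'z\<close> is the structure map of the \<open>k\<close>-algebra \<open>\<zz>\<close>.
  The free algebra on \<open>R\<close>, \<open>K\<close> is the monoid ring of the free monoid.\<close>

definition free_alg :: "(gen list \<Rightarrow>\<^sub>0 'z::comm_ring_1) ring" where
  "free_alg = monoid_ring \<lparr>carrier = UNIV, monoid.mult = (@), one = []\<rparr>"

definition hecke_ideal :: "('k::field \<Rightarrow> 'z::field) \<Rightarrow> 'k \<Rightarrow> (gen list \<Rightarrow>\<^sub>0 'z) set" where
  "hecke_ideal \<iota> q = Idl\<^bsub>free_alg\<^esub>
     {Poly_Mapping.single [GenR, GenR] 1
        - (Poly_Mapping.single [GenR] (\<iota> (q - inverse q)) + Poly_Mapping.single [] 1),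
      Poly_Mapping.single [GenR, GenK, GenR, GenK] 1 - Poly_Mapping.single [GenK, GenR, GenK, GenR] 1}"

definition hecke :: "('k::field \<Rightarrow> 'z::field) \<Rightarrow> 'k \<Rightarrow> (gen list \<Rightarrow>\<^sub>0 'z) set ring" where
  "hecke \<iota> q = free_alg Quot hecke_ideal \<iota> q"

definition hecke_class ::
  "('k::field \<Rightarrow> 'z::field) \<Rightarrow> 'k \<Rightarrow> (gen list \<Rightarrow>\<^sub>0 'z) \<Rightarrow> (gen list \<Rightarrow>\<^sub>0 'z) set" where
  "hecke_class \<iota> q w = hecke_ideal \<iota> q +>\<^bsub>free_alg\<^esub> w"

text \<open>\<open>p(K)\<close> in the affine Hecke algebra.\<close>

definition hecke_poly_K ::
  "('k::field \<Rightarrow> 'z::field) \<Rightarrow> 'k \<Rightarrow> 'z poly \<Rightarrow> (gen list \<Rightarrow>\<^sub>0 'z) set" where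
  "hecke_poly_K \<iota> q p = (\<Oplus>\<^bsub>hecke \<iota> q\<^esub>i\<in>{..Polynomial.degree p}.
     hecke_class \<iota> q (Poly_Mapping.single [] (Polynomial.coeff p i)) \<otimes>\<^bsub>hecke \<iota> q\<^esub>
     hecke_class \<iota> q (Poly_Mapping.single [GenK] 1) [^]\<^bsub>hecke \<iota> q\<^esub> i)"

definition cyc_ideal ::
  "('k::field \<Rightarrow> 'z::field) \<Rightarrow> 'k \<Rightarrow> 'z poly \<Rightarrow> (gen list \<Rightarrow>\<^sub>0 'z) set set" where
  "cyc_ideal \<iota> q p = Idl\<^bsub>hecke \<iota> q\<^esub> {hecke_poly_K \<iota> q p}"

definition cyc_class ::
  "('k::field \<Rightarrow> 'z::field) \<Rightarrow> 'k \<Rightarrow> 'z poly \<Rightarrow> (gen list \<Rightarrow>\<^sub>0 'z) \<Rightarrow> (gen list \<Rightarrow>\<^sub>0 'z) set set" where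
  "cyc_class \<iota> q p w = cyc_ideal \<iota> q p +>\<^bsub>hecke \<iota> q\<^esub> hecke_class \<iota> q w"

definition cyc_R :: "('k::field \<Rightarrow> 'z::field) \<Rightarrow> 'k \<Rightarrow> 'z poly \<Rightarrow> (gen list \<Rightarrow>\<^sub>0 'z) set set" where
  "cyc_R \<iota> q p = cyc_class \<iota> q p (Poly_Mapping.single [GenR] 1)"

definition cyc_K :: "('k::field \<Rightarrow> 'z::field) \<Rightarrow> 'k \<Rightarrow> 'z poly \<Rightarrow> (gen list \<Rightarrow>\<^sub>0 'z) set set" where
  "cyc_K \<iota> q p = cyc_class \<iota> q p (Poly_Mapping.single [GenK] 1)"

definition cyc_scalar ::
  "('k::field \<Rightarrow> 'z::field) \<Rightarrow> 'k \<Rightarrow> 'z poly \<Rightarrow> 'z \<Rightarrow> (gen list \<Rightarrow>\<^sub>0 'z) set set" where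
  "cyc_scalar \<iota> q p c = cyc_class \<iota> q p (Poly_Mapping.single [] c)"

text \<open>\<open>\<K>\<^sub>p\<close> is generated over \<open>\<zz>\<close>, so the image of \<open>\<zz>\<close> is among its ring generators.
  Only the \<open>k\<close>-structure is recorded, since that is what the tensor products use:
  the \<open>k\<close>-algebras \<open>\<H>\<^sub>p\<close>, \<open>\<K>\<^sub>p\<close> and \<open>\<zz>\<close>.\<close>

definition H_p ::
  "('k::field \<Rightarrow> 'z::field) \<Rightarrow> 'k \<Rightarrow> 'z poly \<Rightarrow> ('k, (gen list \<Rightarrow>\<^sub>0 'z) set set) module" where
  "H_p \<iota> q p = algebra_via (cyc_scalar \<iota> q p \<circ> \<iota>) (hecke \<iota> q Quot cyc_ideal \<iota> q p)"

definition K_p ::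
  "('k::field \<Rightarrow> 'z::field) \<Rightarrow> 'k \<Rightarrow> 'z poly \<Rightarrow> ('k, (gen list \<Rightarrow>\<^sub>0 'z) set set) module" where
  "K_p \<iota> q p = (H_p \<iota> q p)\<lparr>carrier :=
     generate_ring (H_p \<iota> q p) (insert (cyc_K \<iota> q p) (range (cyc_scalar \<iota> q p)))\<rparr>"

definition z_alg :: "('k::field \<Rightarrow> 'z::field) \<Rightarrow> ('k, 'z) module" where
  "z_alg \<iota> = algebra_via \<iota> ring_of_type_algebra"

section \<open>Extension of scalars to rational functions\<close>

definition z_of_x :: "('k::field \<Rightarrow> 'z::field) \<Rightarrow> (('z \<times> 'k poly fract) \<Rightarrow>\<^sub>0 int) set ring" where
  "z_of_x \<iota> = tensor (z_alg \<iota>) k_x"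

definition K_p_of_x :: "('k::field \<Rightarrow> 'z::field) \<Rightarrow> 'k \<Rightarrow> 'z poly
    \<Rightarrow> (((gen list \<Rightarrow>\<^sub>0 'z) set set \<times> 'k poly fract) \<Rightarrow>\<^sub>0 int) set ring" where
  "K_p_of_x \<iota> q p = tensor (K_p \<iota> q p) k_x"

definition H_p_of_xy :: "('k::field \<Rightarrow> 'z::field) \<Rightarrow> 'k \<Rightarrow> 'z poly
    \<Rightarrow> (((gen list \<Rightarrow>\<^sub>0 'z) set set \<times> 'k poly poly fract) \<Rightarrow>\<^sub>0 int) set ring" where
  "H_p_of_xy \<iota> q p = tensor (H_p \<iota> q p) k_xy"

text \<open>The structure map of the \<open>\<zz>(x)\<close>-algebra \<open>\<K>\<^sub>p(x)\<close>.\<close>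

definition scalar_x :: "('k::field \<Rightarrow> 'z::field) \<Rightarrow> 'k \<Rightarrow> 'z poly
    \<Rightarrow> (('z \<times> 'k poly fract) \<Rightarrow>\<^sub>0 int) set
    \<Rightarrow> (((gen list \<Rightarrow>\<^sub>0 'z) set set \<times> 'k poly fract) \<Rightarrow>\<^sub>0 int) set" where
  "scalar_x \<iota> q p = tensor_map (K_p \<iota> q p) k_x (cyc_scalar \<iota> q p) id"

text \<open>\<open>a \<mapsto> a \<otimes> 1\<close> from \<open>\<K>\<^sub>p\<close> to \<open>\<K>\<^sub>p(x)\<close>.\<close>

definition const_x :: "('k::field \<Rightarrow> 'z::field) \<Rightarrow> 'k \<Rightarrow> 'z poly
    \<Rightarrow> (gen list \<Rightarrow>\<^sub>0 'z) set set
    \<Rightarrow> (((gen list \<Rightarrow>\<^sub>0 'z) set set \<times> 'k poly fract) \<Rightarrow>\<^sub>0 int) set" where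
  "const_x \<iota> q p a = pure_tensor (K_p \<iota> q p) k_x a 1"

section \<open>The reflection equation\<close>

text \<open>\<open>R(t) = R - t\<^sup>-\<^sup>1 R\<^sup>-\<^sup>1\<close> for \<open>t \<in> k(x, y)\<close>.\<close>

definition R_at :: "('k::field \<Rightarrow> 'z::field) \<Rightarrow> 'k \<Rightarrow> 'z poly \<Rightarrow> 'k poly poly fract
    \<Rightarrow> (((gen list \<Rightarrow>\<^sub>0 'z) set set \<times> 'k poly poly fract) \<Rightarrow>\<^sub>0 int) set" where
  "R_at \<iota> q p t =
     pure_tensor (H_p \<iota> q p) k_xy (cyc_R \<iota> q p) 1
     \<ominus>\<^bsub>H_p_of_xy \<iota> q p\<^esub>
     pure_tensor (H_p \<iota> q p) k_xy (inv\<^bsub>H_p \<iota> q p\<^esub> (cyc_R \<iota> q p)) (inverse t)"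

text \<open>\<open>U\<close> plays the role of \<open>K(x)\<close>; the maps induced by \<open>x \<mapsto> x\<close> and \<open>x \<mapsto> y\<close>
  send it to the elements \<open>K(x)\<close> and \<open>K(y)\<close> of \<open>\<H>\<^sub>p(x, y)\<close>.\<close>

definition reflection_eq :: "('k::field \<Rightarrow> 'z::field) \<Rightarrow> 'k \<Rightarrow> 'z poly
    \<Rightarrow> (((gen list \<Rightarrow>\<^sub>0 'z) set set \<times> 'k poly fract) \<Rightarrow>\<^sub>0 int) set \<Rightarrow> bool" where
  "reflection_eq \<iota> q p U \<longleftrightarrow>
    (let S = H_p_of_xy \<iota> q p;
         Kx = tensor_map (H_p \<iota> q p) k_xy id at_x U;
         Ky = tensor_map (H_p \<iota> q p) k_xy id at_y U;
         Rquot = R_at \<iota> q p (var2_x / var2_y);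
         Rprod = R_at \<iota> q p (var2_x * var2_y)
     in Rquot \<otimes>\<^bsub>S\<^esub> Kx \<otimes>\<^bsub>S\<^esub> Rprod \<otimes>\<^bsub>S\<^esub> Ky = Ky \<otimes>\<^bsub>S\<^esub> Rprod \<otimes>\<^bsub>S\<^esub> Kx \<otimes>\<^bsub>S\<^esub> Rquot)"

section \<open>Principal elements and the candidate solutions\<close>

definition K_tilde :: "('k::field \<Rightarrow> 'z::field) \<Rightarrow> 'k \<Rightarrow> 'z poly \<Rightarrow> nat \<Rightarrow> (nat \<Rightarrow> 'z)
    \<Rightarrow> (gen list \<Rightarrow>\<^sub>0 'z) set set" where
  "K_tilde \<iota> q p n A = cyc_K \<iota> q p [^]\<^bsub>K_p \<iota> q p\<^esub> n
     \<ominus>\<^bsub>K_p \<iota> q p\<^esub>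
     (\<Oplus>\<^bsub>K_p \<iota> q p\<^esub>i\<in>{..<n}. cyc_scalar \<iota> q p (A i) \<otimes>\<^bsub>K_p \<iota> q p\<^esub>
        cyc_K \<iota> q p [^]\<^bsub>K_p \<iota> q p\<^esub> (n - 1 - i))"

text \<open>\<open>c i\<close> is the coefficient of \<open>K\<^sup>i\<close> for \<open>i < n\<close>, and \<open>c n\<close> that of \<open>K_tilde\<close>. The
  expansion is unique because these elements form a basis.\<close>

definition is_principal :: "('k::field \<Rightarrow> 'z::field) \<Rightarrow> 'k \<Rightarrow> 'z poly \<Rightarrow> nat \<Rightarrow> (nat \<Rightarrow> 'z)
    \<Rightarrow> (((gen list \<Rightarrow>\<^sub>0 'z) set set \<times> 'k poly fract) \<Rightarrow>\<^sub>0 int) set \<Rightarrow> bool" where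
  "is_principal \<iota> q p n A U \<longleftrightarrow>
    (let M = K_p_of_x \<iota> q p in
     \<exists>c. (\<forall>i\<le>n. c i \<in> carrier (z_of_x \<iota>)) \<and>
       U = (\<Oplus>\<^bsub>M\<^esub>i\<in>{..<n}. scalar_x \<iota> q p (c i) \<otimes>\<^bsub>M\<^esub>
              const_x \<iota> q p (cyc_K \<iota> q p [^]\<^bsub>K_p \<iota> q p\<^esub> i))
           \<oplus>\<^bsub>M\<^esub> scalar_x \<iota> q p (c n) \<otimes>\<^bsub>M\<^esub> const_x \<iota> q p (K_tilde \<iota> q p n A) \<and>
       c (n - 1) \<noteq> \<zero>\<^bsub>z_of_x \<iota>\<^esub>)"

primrec phi :: "('k::field \<Rightarrow> 'z::field) \<Rightarrow> (nat \<Rightarrow> 'z) \<Rightarrow> 'z \<Rightarrow> nat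
    \<Rightarrow> (('z \<times> 'k poly fract) \<Rightarrow>\<^sub>0 int) set" where
  "phi \<iota> A \<xi> 0 = \<one>\<^bsub>z_of_x \<iota>\<^esub>"
| "phi \<iota> A \<xi> (Suc i) = pure_tensor (z_alg \<iota>) k_x \<xi> var_x \<otimes>\<^bsub>z_of_x \<iota>\<^esub> phi \<iota> A \<xi> i
     \<ominus>\<^bsub>z_of_x \<iota>\<^esub> pure_tensor (z_alg \<iota>) k_x (A i) 1"

definition K_sol :: "('k::field \<Rightarrow> 'z::field) \<Rightarrow> 'k \<Rightarrow> 'z poly \<Rightarrow> nat \<Rightarrow> (nat \<Rightarrow> 'z) \<Rightarrow> 'z
    \<Rightarrow> (((gen list \<Rightarrow>\<^sub>0 'z) set set \<times> 'k poly fract) \<Rightarrow>\<^sub>0 int) set" where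
  "K_sol \<iota> q p n A \<xi> =
    (let M = K_p_of_x \<iota> q p; Z = z_of_x \<iota>; pt = pure_tensor (z_alg \<iota>) k_x in
     (\<Oplus>\<^bsub>M\<^esub>i\<in>{..<n}. scalar_x \<iota> q p (phi \<iota> A \<xi> i) \<otimes>\<^bsub>M\<^esub>
        const_x \<iota> q p (cyc_K \<iota> q p [^]\<^bsub>K_p \<iota> q p\<^esub> (n - i)))
     \<oplus>\<^bsub>M\<^esub> scalar_x \<iota> q p
        ((pt (inverse \<xi> * poly p 0) 1 \<ominus>\<^bsub>Z\<^esub> pt 1 (inverse var_x) \<otimes>\<^bsub>Z\<^esub> phi \<iota> A \<xi> n)
         \<otimes>\<^bsub>Z\<^esub> pt 1 (inverse (var_x - inverse var_x))))"

end

theory Submission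
  imports Defs "HOL-Library.Function_Algebras" "HOL-Library.Product_Plus"
begin

text \<open>By the braid relation \<open>R f(K) R\<close> commutes with \<open>K\<close> up to terms containing a single \<open>R\<close>. Hence, for
  \<open>K(x) = f(x, K)\<close>, the difference of both sides of the reflection equation is a multiple of
  \<open>\<Sum> m\<^sub>i\<^sub>j K\<^sup>i R K\<^sup>j\<close> for an explicit polynomial \<open>m(u, v)\<close>. The elements \<open>K\<^sup>i R K\<^sup>j\<close> with \<open>i, j \<le> n\<close>
  are independent, so the equation says that \<open>m\<close> vanishes modulo \<open>p(u)\<close> and \<open>p(v)\<close>. Let \<open>a\<^sub>j(x)\<close> be the
  coefficient of \<open>u\<^sup>n\<close> in \<open>u\<^sup>j f(x, u)\<close> reduced modulo \<open>p\<close>; principal means \<open>a\<^sub>1 \<noteq> 0\<close>. The lowest part of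
  the condition reads \<open>x a\<^sub>0(x) a\<^sub>1(y) = y a\<^sub>0(y) a\<^sub>1(x)\<close> and separates the variables: \<open>a\<^sub>1 = \<xi> x a\<^sub>0\<close> for
  a constant \<open>\<xi>\<close>. Its next parts give \<open>a\<^sub>j = (\<xi> x)\<^sup>j a\<^sub>0\<close> for \<open>j < n\<close>, so that \<open>f\<close> differs from
  \<open>a\<^sub>0 (p(\<xi> x) - p(u)) / (u - \<xi> x) = a\<^sub>0 \<Sum> \<phi>\<^sub>i u\<^sup>n\<^sup>-\<^sup>i\<close> only by a constant, which the last part
  determines.\<close>

section \<open>Homomorphisms out of quotients, monoid rings and tensor products\<close>

text \<open>\<open>H_p\<close> is given only by generators and relations, so at the start nothing in
  it is known to be non-zero. That the family consists of solutions is a computation in any ring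
  with the Hecke relations. The converse needs functionals on \<open>H_p\<close>. They come from an
  explicit module of sequences instead of a basis theorem: the vanishing of
  \<open>\<Sum> m_ij K^i R K^j\<close> is used only through the values of products of two
  functionals on \<open>m\<close>.

  The ring z(x) is \<open>z\<close> tensored with k(x) over \<open>k\<close>. It is the localisation
  of z[x] at the non-zero elements of k[x] and in general not a field, so only denominators from
  k[x] can be cleared or cancelled. The argument therefore runs over the domains z[x] and z[x,y],
  and a solution enters as its multiple by \<open>x^2 - 1\<close>, which has no denominators. Once
  they are cleared, the difference of the two sides has the factor \<omega>. This lies in
  \<open>k\<close> and is non-zero because \<open>q\<close> is neither 1 nor -1, so it can be
  cancelled inside k(x,y).\<close>

lemma genideal_quot_lift:
  assumes R: "ring R" and T: "ring T" and h: "h \<in> ring_hom R T" and G: "G \<subseteq> carrier R"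
    and ker: "\<And>g. g \<in> G \<Longrightarrow> h g = \<zero>\<^bsub>T\<^esub>"
  shows "(\<lambda>U. the_elem (h ` U)) \<in> ring_hom (R Quot genideal R G) T"
    and "r \<in> carrier R \<Longrightarrow> the_elem (h ` (genideal R G +>\<^bsub>R\<^esub> r)) = h r"
proof -
  interpret R: ring R by fact
  interpret hom: ring_hom_ring R T h by (rule ring_hom_ringI2[OF R T h])
  let ?I = "genideal R G"
  interpret I: ideal ?I R by (rule R.genideal_ideal[OF G])
  have "G \<subseteq> a_kernel R T h" using G ker unfolding a_kernel_def' by blast
  then have sub: "?I \<subseteq> a_kernel R T h"
    by (rule R.genideal_minimal[OF hom.kernel_is_ideal])
  have ev: "the_elem (h ` (?I +>\<^bsub>R\<^esub> r)) = h r" if r: "r \<in> carrier R" for r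
  proof -
    have "h x = h r" if "x \<in> ?I +>\<^bsub>R\<^esub> r" for x
    proof -
      from that obtain i where i: "i \<in> ?I" "x = i \<oplus>\<^bsub>R\<^esub> r" by (auto simp: a_r_coset_def')
      then have "i \<in> carrier R" "h i = \<zero>\<^bsub>T\<^esub>" using sub unfolding a_kernel_def' by blast+
      then show ?thesis using i(2) r by simp
    qed
    moreover have "r \<in> ?I +>\<^bsub>R\<^esub> r" using r by (rule I.a_rcos_self)
    ultimately have "h ` (?I +>\<^bsub>R\<^esub> r) = {h r}" by blast
    then show ?thesis by simp
  qed
  show "r \<in> carrier R \<Longrightarrow> the_elem (h ` (?I +>\<^bsub>R\<^esub> r)) = h r" by (rule ev)
  have rep: "\<exists>x\<in>carrier R. U = ?I +>\<^bsub>R\<^esub> x" if "U \<in> carrier (R Quot ?I)" for U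
    using that by (auto simp: FactRing_def A_RCOSETS_def')
  show "(\<lambda>U. the_elem (h ` U)) \<in> ring_hom (R Quot ?I) T"
  proof (rule ring_hom_memI)
    fix U assume "U \<in> carrier (R Quot ?I)"
    then obtain x where x: "x \<in> carrier R" "U = ?I +>\<^bsub>R\<^esub> x" using rep by blast
    then show "the_elem (h ` U) \<in> carrier T" by (simp add: ev)
    fix V assume "V \<in> carrier (R Quot ?I)"
    then obtain y where y: "y \<in> carrier R" "V = ?I +>\<^bsub>R\<^esub> y" using rep by blast
    show "the_elem (h ` (U \<otimes>\<^bsub>R Quot ?I\<^esub> V)) = the_elem (h ` U) \<otimes>\<^bsub>T\<^esub> the_elem (h ` V)"
      unfolding x(2) y(2) ring_hom_mult[OF I.rcos_ring_hom x(1) y(1), symmetric]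
      by (simp add: ev x(1) y(1))
    show "the_elem (h ` (U \<oplus>\<^bsub>R Quot ?I\<^esub> V)) = the_elem (h ` U) \<oplus>\<^bsub>T\<^esub> the_elem (h ` V)"
      unfolding x(2) y(2) ring_hom_add[OF I.rcos_ring_hom x(1) y(1), symmetric]
      by (simp add: ev x(1) y(1))
  next
    show "the_elem (h ` \<one>\<^bsub>R Quot ?I\<^esub>) = \<one>\<^bsub>T\<^esub>"
      unfolding ring_hom_one[OF I.rcos_ring_hom, symmetric] by (simp add: ev)
  qed
qed

section \<open>Universal property of monoid rings\<close>

definition monoid_ring_lift where
  "monoid_ring_lift T c h f =
     (\<Oplus>\<^bsub>T\<^esub>a\<in>Poly_Mapping.keys f. c (Poly_Mapping.lookup f a) \<otimes>\<^bsub>T\<^esub> h a)"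

locale monoid_ring_hom = T: ring T + G: monoid G
  for T :: "('t, 'r) ring_scheme" (structure) and G :: "('g, 's) monoid_scheme" +
  fixes c :: "'c::comm_ring_1 \<Rightarrow> 't" and h :: "'g \<Rightarrow> 't"
  assumes c_closed [simp, intro]: "c x \<in> carrier T"
    and c_add: "c (x + y) = c x \<oplus> c y"
    and c_mult: "c (x * y) = c x \<otimes> c y"
    and c_one: "c 1 = \<one>"
    and h_closed [simp, intro]: "a \<in> carrier G \<Longrightarrow> h a \<in> carrier T"
    and h_mult: "a \<in> carrier G \<Longrightarrow> b \<in> carrier G \<Longrightarrow> h (a \<otimes>\<^bsub>G\<^esub> b) = h a \<otimes> h b"
    and h_one: "h \<one>\<^bsub>G\<^esub> = \<one>"
    and comm: "a \<in> carrier G \<Longrightarrow> c x \<otimes> h a = h a \<otimes> c x"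
begin

lemma c_zero: "c 0 = \<zero>"
  using c_add[of 0 0] T.add.l_cancel_one c_closed by auto

lemma lift_superset:
  assumes "finite S" "Poly_Mapping.keys f \<subseteq> S" "S \<subseteq> carrier G"
  shows "monoid_ring_lift T c h f = (\<Oplus>a\<in>S. c (Poly_Mapping.lookup f a) \<otimes> h a)"
  unfolding monoid_ring_lift_def
  by (rule T.add.finprod_mono_neutral_cong_left)
    (use assms in \<open>auto simp: c_zero in_keys_iff subset_iff\<close>)

lemma lift_closed: "f \<in> carrier (monoid_ring G) \<Longrightarrow> monoid_ring_lift T c h f \<in> carrier T"
  unfolding monoid_ring_lift_def by (rule T.finsum_closed) (auto simp: monoid_ring_def)

lemma lift_add:
  assumes "f \<in> carrier (monoid_ring G)" "g \<in> carrier (monoid_ring G)"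
  shows "monoid_ring_lift T c h (f + g) = monoid_ring_lift T c h f \<oplus> monoid_ring_lift T c h g"
proof -
  let ?S = "Poly_Mapping.keys f \<union> Poly_Mapping.keys g"
  have S: "?S \<subseteq> carrier G" using assms by (auto simp: monoid_ring_def)
  then have h: "a \<in> ?S \<Longrightarrow> h a \<in> carrier T" for a by blast
  have "monoid_ring_lift T c h (f + g)
      = (\<Oplus>a\<in>?S. c (Poly_Mapping.lookup (f + g) a) \<otimes> h a)"
    using Poly_Mapping.keys_add[of f g] S by (intro lift_superset) auto
  also have "\<dots> = (\<Oplus>a\<in>?S. c (Poly_Mapping.lookup f a) \<otimes> h a
      \<oplus> c (Poly_Mapping.lookup g a) \<otimes> h a)"
    using h by (intro T.finsum_cong') (auto simp: lookup_add c_add T.l_distr)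
  also have "\<dots> = (\<Oplus>a\<in>?S. c (Poly_Mapping.lookup f a) \<otimes> h a)
      \<oplus> (\<Oplus>a\<in>?S. c (Poly_Mapping.lookup g a) \<otimes> h a)"
    using h by (intro T.finsum_addf) auto
  finally show ?thesis
    using S by (simp only: lift_superset[of ?S, symmetric] finite_UnI finite_keys Un_upper1 Un_upper2)
qed

lemma lift_single: "a \<in> carrier G \<Longrightarrow> monoid_ring_lift T c h (Poly_Mapping.single a x) = c x \<otimes> h a"
  using lift_superset[of "{a}" "Poly_Mapping.single a x"] by simp

lemma lift_zero: "monoid_ring_lift T c h 0 = \<zero>"
  by (simp add: monoid_ring_lift_def)

lemma lift_hom: "monoid_ring_lift T c h \<in> ring_hom (monoid_ring G) T"
proof -
  interpret MR: ring "monoid_ring G :: ('g \<Rightarrow>\<^sub>0 'c) ring" by (rule ring_monoid_ring) unfold_locales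
  let ?L = "monoid_ring_lift T c h"
  have add [simp]: "f \<oplus>\<^bsub>monoid_ring G\<^esub> g = f + g" for f g :: "'g \<Rightarrow>\<^sub>0 'c"
    by (simp add: monoid_ring_def)
  have cl: "f \<in> carrier (monoid_ring G) \<Longrightarrow> g \<in> carrier (monoid_ring G) \<Longrightarrow>
    f + g \<in> carrier (monoid_ring G)" for f g :: "'g \<Rightarrow>\<^sub>0 'c"
    using MR.add.m_closed[of f g] by simp
  have zero: "0 \<in> carrier (monoid_ring G)" by (simp add: monoid_ring_def)
  have sing: "a \<in> carrier G \<Longrightarrow> Poly_Mapping.single a x \<in> carrier (monoid_ring G)" for a and x :: 'c
    by (auto simp: monoid_ring_def)
  show ?thesis
  proof (rule ring_hom_memI)
    fix f g :: "'g \<Rightarrow>\<^sub>0 'c"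
    assume f: "f \<in> carrier (monoid_ring G)" and g: "g \<in> carrier (monoid_ring G)"
    \<comment> \<open>\<open>monoid_ring_induct\<close> gives no membership of the two summands in
      its last case, so membership is carried along in the induction.\<close>
    have "f \<in> carrier (monoid_ring G) \<and> ?L (f \<otimes>\<^bsub>monoid_ring G\<^esub> g) = ?L f \<otimes> ?L g"
      using f
    proof (induction f rule: monoid_ring_induct)
      case zero
      then show ?case using g \<open>0 \<in> _\<close> by (simp add: lift_zero lift_closed)
    next
      case (single a x)
      from g have "g \<in> carrier (monoid_ring G) \<and>
        ?L (Poly_Mapping.single a x \<otimes>\<^bsub>monoid_ring G\<^esub> g) = ?L (Poly_Mapping.single a x) \<otimes> ?L g"
      proof (induction g rule: monoid_ring_induct)
        case zero
        then show ?case using \<open>0 \<in> _\<close> single by (simp add: lift_zero lift_single)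
      next
        case (single b y)
        have "c x \<otimes> c y \<otimes> (h a \<otimes> h b) = c x \<otimes> (c y \<otimes> h a) \<otimes> h b"
          using single \<open>a \<in> carrier G\<close> by (simp add: T.m_assoc)
        also have "\<dots> = c x \<otimes> h a \<otimes> (c y \<otimes> h b)"
          using single \<open>a \<in> carrier G\<close> by (simp only: comm[of a y]) (simp add: T.m_assoc)
        finally show ?case
          using single \<open>a \<in> carrier G\<close>
          by (simp add: monoid_ring_mult_single lift_single c_mult h_mult sing)
      next
        case (add f g)
        then show ?case
          using single sing[OF single, of x] MR.m_closed[OF sing[OF single, of x]] cl
          by (simp add: monoid_ring_mult_add_right lift_add T.r_distr lift_closed)
      qed
      then show ?case using sing[OF single] by simp
    next
      case (add f1 f2)
      then show ?case using g MR.m_closed[of f1 g] MR.m_closed[of f2 g] cl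
        by (simp add: monoid_ring_mult_add_left lift_add T.l_distr lift_closed)
    qed
    then show "?L (f \<otimes>\<^bsub>monoid_ring G\<^esub> g) = ?L f \<otimes> ?L g" by blast
    show "?L (f \<oplus>\<^bsub>monoid_ring G\<^esub> g) = ?L f \<oplus> ?L g" using f g by (simp add: lift_add)
  next
    show "?L \<one>\<^bsub>monoid_ring G\<^esub> = \<one>" by (simp add: monoid_ring_def lift_single c_one h_one)
  qed (rule lift_closed)
qed

end

section \<open>Tensor products of two algebras\<close>

locale algebra_pair =
  fixes A :: "('k, 'a) module" and B :: "('k, 'b) module"
  assumes ring_A: "ring A" and ring_B: "ring B"
    and smult_A: "a \<in> carrier A \<Longrightarrow> x \<odot>\<^bsub>A\<^esub> a \<in> carrier A"
    and smult_B: "b \<in> carrier B \<Longrightarrow> x \<odot>\<^bsub>B\<^esub> b \<in> carrier B"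
begin

sublocale A: ring A by (rule ring_A)
sublocale B: ring B by (rule ring_B)

abbreviation pt where "pt \<equiv> pure_tensor A B"

lemma monoid_prod: "monoid (A \<times>\<times> B)"
  by (simp add: DirProd_monoid A.monoid_axioms B.monoid_axioms)

sublocale pre: ring "tensor_pre A B"
  unfolding tensor_pre_def by (rule ring_monoid_ring[OF monoid_prod])

lemma pre_carrier: "f \<in> carrier (tensor_pre A B) \<longleftrightarrow> Poly_Mapping.keys f \<subseteq> carrier A \<times> carrier B"
  by (auto simp: tensor_pre_def monoid_ring_def DirProd_def)

lemma pre_add [simp]: "f \<oplus>\<^bsub>tensor_pre A B\<^esub> g = f + g"
  by (simp add: tensor_pre_def monoid_ring_def)

lemma pre_zero [simp]: "\<zero>\<^bsub>tensor_pre A B\<^esub> = 0"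
  by (simp add: tensor_pre_def monoid_ring_def)

lemma pre_minus [simp]:
  assumes "f \<in> carrier (tensor_pre A B)" "g \<in> carrier (tensor_pre A B)"
  shows "f \<ominus>\<^bsub>tensor_pre A B\<^esub> g = f - g"
proof -
  have "- g \<in> carrier (tensor_pre A B)" using assms by (simp add: pre_carrier)
  then have "\<ominus>\<^bsub>tensor_pre A B\<^esub> g = - g"
    using assms by (intro pre.minus_equality) auto
  then show ?thesis by (simp add: a_minus_def)
qed

lemma pre_single: "a \<in> carrier A \<Longrightarrow> b \<in> carrier B \<Longrightarrow> Poly_Mapping.single (a, b) n \<in> carrier (tensor_pre A B)"
  by (auto simp: pre_carrier)

lemma pre_diff: "f \<in> carrier (tensor_pre A B) \<Longrightarrow> g \<in> carrier (tensor_pre A B) \<Longrightarrow>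
  f - g \<in> carrier (tensor_pre A B)"
  using pre.minus_closed[of f g] by simp

lemma rels_carrier: "tensor_rels A B \<subseteq> carrier (tensor_pre A B)"
  unfolding tensor_rels_def by (auto intro!: pre_diff pre_single smult_A smult_B)

sublocale I: ideal "tensor_ideal A B" "tensor_pre A B"
  unfolding tensor_ideal_def by (rule pre.genideal_ideal[OF rels_carrier])

sublocale tensor: ring "tensor A B"
  unfolding tensor_def by (rule I.quotient_is_ring)

lemma proj_hom: "(+>\<^bsub>tensor_pre A B\<^esub>) (tensor_ideal A B) \<in> ring_hom (tensor_pre A B) (tensor A B)"
  unfolding tensor_def by (rule I.rcos_ring_hom)

sublocale proj: ring_hom_ring "tensor_pre A B" "tensor A B"
    "(+>\<^bsub>tensor_pre A B\<^esub>) (tensor_ideal A B)"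
  by (simp add: ring_hom_ringI2 proj_hom pre.ring_axioms tensor.ring_axioms)

lemma tensor_carrierE:
  assumes "U \<in> carrier (tensor A B)"
  obtains s where "s \<in> carrier (tensor_pre A B)" "U = tensor_ideal A B +>\<^bsub>tensor_pre A B\<^esub> s"
  using assms that unfolding tensor_def FactRing_def A_RCOSETS_def' ring_record_simps by blast

lemma pt_closed [simp, intro]: "a \<in> carrier A \<Longrightarrow> b \<in> carrier B \<Longrightarrow> pt a b \<in> carrier (tensor A B)"
  unfolding pure_tensor_def by (rule proj.hom_closed) (rule pre_single)

lemma proj_eqI:
  assumes "f \<in> carrier (tensor_pre A B)" "g \<in> carrier (tensor_pre A B)" "f - g \<in> tensor_ideal A B"
  shows "tensor_ideal A B +>\<^bsub>tensor_pre A B\<^esub> f = tensor_ideal A B +>\<^bsub>tensor_pre A B\<^esub> g"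
proof -
  have "f = (f - g) \<oplus>\<^bsub>tensor_pre A B\<^esub> g" by simp
  then have "f \<in> tensor_ideal A B +>\<^bsub>tensor_pre A B\<^esub> g"
    unfolding a_r_coset_def' using assms(3) by blast
  then show ?thesis using I.a_repr_independence' assms(2) by blast
qed

lemma rel_ideal: "r \<in> tensor_rels A B \<Longrightarrow> r \<in> tensor_ideal A B"
  unfolding tensor_ideal_def using pre.genideal_self[OF rels_carrier] by blast

lemma proj_add: "f \<in> carrier (tensor_pre A B) \<Longrightarrow> g \<in> carrier (tensor_pre A B) \<Longrightarrow>
   tensor_ideal A B +>\<^bsub>tensor_pre A B\<^esub> (f + g) =
   (tensor_ideal A B +>\<^bsub>tensor_pre A B\<^esub> f) \<oplus>\<^bsub>tensor A B\<^esub> (tensor_ideal A B +>\<^bsub>tensor_pre A B\<^esub> g)"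
  using proj.hom_add[of f g] by simp

lemma pt_add_left:
  assumes "a \<in> carrier A" "a' \<in> carrier A" "b \<in> carrier B"
  shows "pt (a \<oplus>\<^bsub>A\<^esub> a') b = pt a b \<oplus>\<^bsub>tensor A B\<^esub> pt a' b"
proof -
  have "Poly_Mapping.single (a \<oplus>\<^bsub>A\<^esub> a', b) 1
      - (Poly_Mapping.single (a, b) 1 + Poly_Mapping.single (a', b) 1) \<in> tensor_rels A B"
    unfolding tensor_rels_def diff_diff_eq[symmetric] using assms by blast
  then have "pt (a \<oplus>\<^bsub>A\<^esub> a') b = tensor_ideal A B +>\<^bsub>tensor_pre A B\<^esub>
      (Poly_Mapping.single (a, b) 1 + Poly_Mapping.single (a', b) 1)"
    unfolding pure_tensor_def using assms pre.add.m_closed[OF pre_single pre_single, of a b a' b 1 1]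
    by (intro proj_eqI rel_ideal) (auto simp: pre_single)
  with assms show ?thesis by (simp add: pure_tensor_def proj_add pre_single)
qed

lemma pt_add_right:
  assumes "a \<in> carrier A" "b \<in> carrier B" "b' \<in> carrier B"
  shows "pt a (b \<oplus>\<^bsub>B\<^esub> b') = pt a b \<oplus>\<^bsub>tensor A B\<^esub> pt a b'"
proof -
  have "Poly_Mapping.single (a, b \<oplus>\<^bsub>B\<^esub> b') 1
      - (Poly_Mapping.single (a, b) 1 + Poly_Mapping.single (a, b') 1) \<in> tensor_rels A B"
    unfolding tensor_rels_def diff_diff_eq[symmetric] using assms by blast
  then have "pt a (b \<oplus>\<^bsub>B\<^esub> b') = tensor_ideal A B +>\<^bsub>tensor_pre A B\<^esub>
      (Poly_Mapping.single (a, b) 1 + Poly_Mapping.single (a, b') 1)"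
    unfolding pure_tensor_def using assms pre.add.m_closed[OF pre_single pre_single, of a b a b' 1 1]
    by (intro proj_eqI rel_ideal) (auto simp: pre_single)
  with assms show ?thesis by (simp add: pure_tensor_def proj_add pre_single)
qed

lemma pt_smult:
  assumes "a \<in> carrier A" "b \<in> carrier B"
  shows "pt (x \<odot>\<^bsub>A\<^esub> a) b = pt a (x \<odot>\<^bsub>B\<^esub> b)"
  unfolding pure_tensor_def
  by (intro proj_eqI rel_ideal)
    (use assms in \<open>auto simp: tensor_rels_def intro!: pre_single smult_A smult_B\<close>)

lemma pt_mult:
  assumes "a \<in> carrier A" "a' \<in> carrier A" "b \<in> carrier B" "b' \<in> carrier B"
  shows "pt a b \<otimes>\<^bsub>tensor A B\<^esub> pt a' b' = pt (a \<otimes>\<^bsub>A\<^esub> a') (b \<otimes>\<^bsub>B\<^esub> b')"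
proof -
  have "Poly_Mapping.single (a, b) 1 \<otimes>\<^bsub>tensor_pre A B\<^esub> Poly_Mapping.single (a', b') 1
    = Poly_Mapping.single (a \<otimes>\<^bsub>A\<^esub> a', b \<otimes>\<^bsub>B\<^esub> b') (1 :: int)"
    by (simp add: tensor_pre_def monoid_ring_mult_single DirProd_def)
  then show ?thesis
    using proj.hom_mult[of "Poly_Mapping.single (a, b) 1" "Poly_Mapping.single (a', b') 1"] assms
    by (simp add: pure_tensor_def pre_single)
qed

lemma pt_one: "pt \<one>\<^bsub>A\<^esub> \<one>\<^bsub>B\<^esub> = \<one>\<^bsub>tensor A B\<^esub>"
  using proj.hom_one by (simp add: pure_tensor_def tensor_pre_def monoid_ring_def DirProd_def)

lemma pt_zero_left: "b \<in> carrier B \<Longrightarrow> pt \<zero>\<^bsub>A\<^esub> b = \<zero>\<^bsub>tensor A B\<^esub>"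
  using pt_add_left[of "\<zero>\<^bsub>A\<^esub>" "\<zero>\<^bsub>A\<^esub>" b] tensor.add.l_cancel_one by simp

lemma pt_zero_right: "a \<in> carrier A \<Longrightarrow> pt a \<zero>\<^bsub>B\<^esub> = \<zero>\<^bsub>tensor A B\<^esub>"
  using pt_add_right[of a "\<zero>\<^bsub>B\<^esub>" "\<zero>\<^bsub>B\<^esub>"] tensor.add.l_cancel_one by simp

lemma pt_minus_left:
  "a \<in> carrier A \<Longrightarrow> b \<in> carrier B \<Longrightarrow> pt (\<ominus>\<^bsub>A\<^esub> a) b = \<ominus>\<^bsub>tensor A B\<^esub> pt a b"
  using pt_add_left[of "\<ominus>\<^bsub>A\<^esub> a" a b]
  by (intro tensor.minus_equality[symmetric]) (auto simp: A.l_neg pt_zero_left)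

text \<open>Closure under addition suffices, without negation: a negative multiple of a pure tensor
  is a positive multiple of \<open>pt (- a) b\<close>.\<close>

lemma tensor_induct [consumes 1, case_names pure add]:
  assumes U: "U \<in> carrier (tensor A B)"
    and pure: "\<And>a b. a \<in> carrier A \<Longrightarrow> b \<in> carrier B \<Longrightarrow> P (pt a b)"
    and add: "\<And>V W. V \<in> carrier (tensor A B) \<Longrightarrow> W \<in> carrier (tensor A B) \<Longrightarrow> P V \<Longrightarrow> P W \<Longrightarrow>
      P (V \<oplus>\<^bsub>tensor A B\<^esub> W)"
  shows "P U"
proof -
  let ?q = "(+>\<^bsub>tensor_pre A B\<^esub>) (tensor_ideal A B)"
  have z: "?q 0 = pt \<zero>\<^bsub>A\<^esub> \<zero>\<^bsub>B\<^esub>"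
    using proj.hom_zero by (simp add: pt_zero_left)
  obtain s where s: "s \<in> carrier (tensor_pre A B)" "U = ?q s"
    using tensor_carrierE[OF U] .
  have "s \<in> carrier (tensor_pre A B) \<and> P (?q s)"
    using s(1)[unfolded tensor_pre_def]
  proof (induction s rule: monoid_ring_induct)
    case zero
    show ?case using pure[of "\<zero>\<^bsub>A\<^esub>" "\<zero>\<^bsub>B\<^esub>"] z by (simp add: pre_carrier)
  next
    case (single ab n)
    then obtain a b where ab: "ab = (a, b)" "a \<in> carrier A" "b \<in> carrier B" by auto
    have "P (?q (Poly_Mapping.single (a, b) n))"
    proof (induction n rule: int_induct[where k = 0])
      case base
      show ?case using pure[of "\<zero>\<^bsub>A\<^esub>" "\<zero>\<^bsub>B\<^esub>"] z by simp
    next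
      case (step1 i)
      have "?q (Poly_Mapping.single (a, b) (i + 1)) = ?q (Poly_Mapping.single (a, b) i) \<oplus>\<^bsub>tensor A B\<^esub> pt a b"
        using ab by (simp add: pure_tensor_def single_add proj_add pre_single)
      with step1 show ?case using ab pure add by (simp add: pre_single)
    next
      case (step2 i)
      have "?q (Poly_Mapping.single (a, b) i) = ?q (Poly_Mapping.single (a, b) (i - 1)) \<oplus>\<^bsub>tensor A B\<^esub> pt a b"
        using ab proj_add[OF pre_single pre_single, of a b a b "i - 1" 1]
        by (simp add: pure_tensor_def single_add[symmetric])
      then have "?q (Poly_Mapping.single (a, b) (i - 1))
          = ?q (Poly_Mapping.single (a, b) i) \<oplus>\<^bsub>tensor A B\<^esub> pt (\<ominus>\<^bsub>A\<^esub> a) b"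
        using ab by (simp add: pt_minus_left pre_single tensor.add.m_assoc tensor.r_neg)
      with step2 show ?case using ab pure add by (simp add: pre_single)
    qed
    with ab show ?case by (simp add: pre_single)
  next
    case (add f g)
    then show ?case using assms(3) pre.add.m_closed[of f g] by (simp add: proj_add)
  qed
  with s show ?thesis by simp
qed

lemma pt_one_central:
  assumes B: "\<And>b b'. b \<in> carrier B \<Longrightarrow> b' \<in> carrier B \<Longrightarrow> b \<otimes>\<^bsub>B\<^esub> b' = b' \<otimes>\<^bsub>B\<^esub> b"
    and b: "b \<in> carrier B" and U: "U \<in> carrier (tensor A B)"
  shows "pt \<one>\<^bsub>A\<^esub> b \<otimes>\<^bsub>tensor A B\<^esub> U = U \<otimes>\<^bsub>tensor A B\<^esub> pt \<one>\<^bsub>A\<^esub> b"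
  using U by (induction U rule: tensor_induct)
    (simp_all add: pt_mult b B[OF b] tensor.l_distr tensor.r_distr)

lemma pt_one_cancel:
  assumes b: "b \<in> carrier B" "b' \<in> carrier B" "b' \<otimes>\<^bsub>B\<^esub> b = \<one>\<^bsub>B\<^esub>"
    and UV: "U \<in> carrier (tensor A B)" "V \<in> carrier (tensor A B)"
    and eq: "pt \<one>\<^bsub>A\<^esub> b \<otimes>\<^bsub>tensor A B\<^esub> U = pt \<one>\<^bsub>A\<^esub> b \<otimes>\<^bsub>tensor A B\<^esub> V"
  shows "U = V"
proof -
  have "pt \<one>\<^bsub>A\<^esub> b' \<otimes>\<^bsub>tensor A B\<^esub> (pt \<one>\<^bsub>A\<^esub> b \<otimes>\<^bsub>tensor A B\<^esub> W) = W" if "W \<in> carrier (tensor A B)" for W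
    using that b by (simp add: tensor.m_assoc[symmetric] pt_mult pt_one)
  with UV eq show ?thesis by metis
qed

end

text \<open>The factor \<open>c\<close> is the structure map of the integers; it is a parameter because every target
  has its own direct description of it.\<close>

locale tensor_lift = algebra_pair A B + T: ring T
  for A :: "('k, 'a) module" and B :: "('k, 'b) module" and T :: "('t, 'r) ring_scheme" (structure) +
  fixes c :: "int \<Rightarrow> 't" and \<phi> :: "'a \<Rightarrow> 't" and \<psi> :: "'b \<Rightarrow> 't"
  assumes c_closed: "c x \<in> carrier T"
    and c_add: "c (x + y) = c x \<oplus> c y"
    and c_mult: "c (x * y) = c x \<otimes> c y"
    and c_one: "c 1 = \<one>"
    and c_comm: "t \<in> carrier T \<Longrightarrow> c x \<otimes> t = t \<otimes> c x"
    and \<phi>: "\<phi> \<in> ring_hom A T" and \<psi>: "\<psi> \<in> ring_hom B T"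
    and comm: "a \<in> carrier A \<Longrightarrow> b \<in> carrier B \<Longrightarrow> \<phi> a \<otimes> \<psi> b = \<psi> b \<otimes> \<phi> a"
    and bal: "a \<in> carrier A \<Longrightarrow> b \<in> carrier B \<Longrightarrow>
      \<phi> (r \<odot>\<^bsub>A\<^esub> a) \<otimes> \<psi> b = \<phi> a \<otimes> \<psi> (r \<odot>\<^bsub>B\<^esub> b)"
begin

sublocale phi: ring_hom_ring A T \<phi>
  by (simp add: ring_hom_ringI2 \<phi> ring_A T.ring_axioms)
sublocale psi: ring_hom_ring B T \<psi>
  by (simp add: ring_hom_ringI2 \<psi> ring_B T.ring_axioms)

sublocale mr: monoid_ring_hom T "A \<times>\<times> B" c "\<lambda>(a, b). \<phi> a \<otimes> \<psi> b"
proof (rule monoid_ring_hom.intro[OF T.ring_axioms monoid_prod], rule monoid_ring_hom_axioms.intro)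
  fix ab ab' assume "ab \<in> carrier (A \<times>\<times> B)" "ab' \<in> carrier (A \<times>\<times> B)"
  then obtain a b a' b' where *: "ab = (a, b)" "ab' = (a', b')" "a \<in> carrier A" "a' \<in> carrier A"
    "b \<in> carrier B" "b' \<in> carrier B" by auto
  have "\<phi> a \<otimes> \<phi> a' \<otimes> (\<psi> b \<otimes> \<psi> b') = \<phi> a \<otimes> (\<phi> a' \<otimes> \<psi> b) \<otimes> \<psi> b'"
    using * by (simp add: T.m_assoc)
  also have "\<dots> = \<phi> a \<otimes> \<psi> b \<otimes> (\<phi> a' \<otimes> \<psi> b')"
    using * by (simp only: comm[of a' b]) (simp add: T.m_assoc)
  finally show "(\<lambda>(a, b). \<phi> a \<otimes> \<psi> b) (ab \<otimes>\<^bsub>A \<times>\<times> B\<^esub> ab')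
      = (\<lambda>(a, b). \<phi> a \<otimes> \<psi> b) ab \<otimes> (\<lambda>(a, b). \<phi> a \<otimes> \<psi> b) ab'"
    using * by simp
qed (auto simp: c_closed c_add c_mult c_one intro!: c_comm)

abbreviation pre_map where
  "pre_map \<equiv> monoid_ring_lift T c (\<lambda>(a, b). \<phi> a \<otimes> \<psi> b)"

lemma pre_map_hom: "pre_map \<in> ring_hom (tensor_pre A B) T"
  unfolding tensor_pre_def by (rule mr.lift_hom)

sublocale pm: ring_hom_ring "tensor_pre A B" T pre_map
  by (simp add: ring_hom_ringI2 pre_map_hom pre.ring_axioms T.ring_axioms)

lemma pre_map_single:
  "a \<in> carrier A \<Longrightarrow> b \<in> carrier B \<Longrightarrow> pre_map (Poly_Mapping.single (a, b) 1) = \<phi> a \<otimes> \<psi> b"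
  by (simp add: mr.lift_single c_one)

lemma pre_map_diff:
  assumes "f \<in> carrier (tensor_pre A B)" "g \<in> carrier (tensor_pre A B)"
  shows "pre_map (f - g) = pre_map f \<ominus> pre_map g"
  using assms pm.hom_add[of "f - g" g] pre_diff[OF assms]
  by (simp add: T.minus_eq T.add.m_assoc T.r_neg)

lemma pre_map_rels: assumes "r \<in> tensor_rels A B" shows "pre_map r = \<zero>"
proof -
  have *: "(t \<oplus> u) \<ominus> t \<ominus> u = \<zero>" if "t \<in> carrier T" "u \<in> carrier T" for t u
    using that by (simp only: T.a_comm[of t u]) (simp add: T.minus_eq T.a_assoc T.r_neg)
  from assms consider
    a a' b where "r = Poly_Mapping.single (a \<oplus>\<^bsub>A\<^esub> a', b) 1 - Poly_Mapping.single (a, b) 1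
      - Poly_Mapping.single (a', b) 1" "a \<in> carrier A" "a' \<in> carrier A" "b \<in> carrier B"
    | a b b' where "r = Poly_Mapping.single (a, b \<oplus>\<^bsub>B\<^esub> b') 1 - Poly_Mapping.single (a, b) 1
      - Poly_Mapping.single (a, b') 1" "a \<in> carrier A" "b \<in> carrier B" "b' \<in> carrier B"
    | x a b where "r = Poly_Mapping.single (x \<odot>\<^bsub>A\<^esub> a, b) 1 - Poly_Mapping.single (a, x \<odot>\<^bsub>B\<^esub> b) 1"
      "a \<in> carrier A" "b \<in> carrier B"
    unfolding tensor_rels_def by blast
  then show ?thesis
  proof cases
    case 1
    then show ?thesis by (simp add: pre_map_diff pre_diff pre_single pre_map_single T.l_distr *)
  next
    case 2
    then show ?thesis by (simp add: pre_map_diff pre_diff pre_single pre_map_single T.r_distr *)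
  next
    case 3
    then show ?thesis
      by (simp add: pre_map_diff pre_single pre_map_single smult_A smult_B bal T.minus_eq T.r_neg)
  qed
qed

definition lift where "lift U = the_elem (pre_map ` U)"

lemma lift_hom: "lift \<in> ring_hom (tensor A B) T"
  unfolding tensor_def tensor_ideal_def lift_def
  by (rule genideal_quot_lift(1)[OF pre.ring_axioms T.ring_axioms pre_map_hom rels_carrier pre_map_rels])

lemma lift_pt: "a \<in> carrier A \<Longrightarrow> b \<in> carrier B \<Longrightarrow> lift (pt a b) = \<phi> a \<otimes> \<psi> b"
  unfolding pure_tensor_def tensor_ideal_def lift_def
  by (simp add: genideal_quot_lift(2)[OF pre.ring_axioms T.ring_axioms pre_map_hom rels_carrier pre_map_rels]
    pre_single pre_map_single)

end

section \<open>Functoriality of the tensor product\<close>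

locale tensor_map_pair = dom: algebra_pair A B + cod: algebra_pair A' B'
  for A :: "('k, 'a) module" and B :: "('k, 'b) module"
    and A' :: "('k, 'c) module" and B' :: "('k, 'd) module" +
  fixes f :: "'a \<Rightarrow> 'c" and g :: "'b \<Rightarrow> 'd"
  assumes f: "f \<in> ring_hom A A'" and g: "g \<in> ring_hom B B'"
    and f_smult: "a \<in> carrier A \<Longrightarrow> f (x \<odot>\<^bsub>A\<^esub> a) = x \<odot>\<^bsub>A'\<^esub> f a"
    and g_smult: "b \<in> carrier B \<Longrightarrow> g (x \<odot>\<^bsub>B\<^esub> b) = x \<odot>\<^bsub>B'\<^esub> g b"
begin

sublocale f: ring_hom_ring A A' f
  by (rule ring_hom_ringI2[OF dom.ring_A cod.ring_A f])
sublocale g: ring_hom_ring B B' g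
  by (rule ring_hom_ringI2[OF dom.ring_B cod.ring_B g])

abbreviation (input) q where "q \<equiv> (+>\<^bsub>tensor_pre A' B'\<^esub>) (tensor_ideal A' B')"

text \<open>The structure map of the integers into the target; it is the parameter \<open>c\<close>
  of \<open>tensor_lift\<close> for this target.\<close>

definition int_emb where
  "int_emb x = q (Poly_Mapping.single (\<one>\<^bsub>A'\<^esub>, \<one>\<^bsub>B'\<^esub>) (x :: int))"

lemma q_mult_single:
  assumes "a \<in> carrier A'" "a' \<in> carrier A'" "b \<in> carrier B'" "b' \<in> carrier B'"
  shows "q (Poly_Mapping.single (a, b) x) \<otimes>\<^bsub>tensor A' B'\<^esub> q (Poly_Mapping.single (a', b') y)
    = q (Poly_Mapping.single (a \<otimes>\<^bsub>A'\<^esub> a', b \<otimes>\<^bsub>B'\<^esub> b') (x * y))"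
proof -
  have "Poly_Mapping.single (a, b) x \<otimes>\<^bsub>tensor_pre A' B'\<^esub> Poly_Mapping.single (a', b') y
    = Poly_Mapping.single (a \<otimes>\<^bsub>A'\<^esub> a', b \<otimes>\<^bsub>B'\<^esub> b') (x * y)"
    by (simp add: tensor_pre_def monoid_ring_mult_single)
  with assms show ?thesis
    using cod.proj.hom_mult[of "Poly_Mapping.single (a, b) x" "Poly_Mapping.single (a', b') y"]
    by (simp add: cod.pre_single)
qed

lemma int_emb_pt: "a \<in> carrier A' \<Longrightarrow> b \<in> carrier B' \<Longrightarrow>
  int_emb x \<otimes>\<^bsub>tensor A' B'\<^esub> cod.pt a b = q (Poly_Mapping.single (a, b) x)"
  "a \<in> carrier A' \<Longrightarrow> b \<in> carrier B' \<Longrightarrow>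
  cod.pt a b \<otimes>\<^bsub>tensor A' B'\<^esub> int_emb x = q (Poly_Mapping.single (a, b) x)"
  unfolding int_emb_def pure_tensor_def
  by (simp_all add: q_mult_single)

lemma int_emb_closed: "int_emb x \<in> carrier (tensor A' B')"
  unfolding int_emb_def by (simp add: cod.pre_single)

lemma int_emb_comm:
  assumes "t \<in> carrier (tensor A' B')"
  shows "int_emb x \<otimes>\<^bsub>tensor A' B'\<^esub> t = t \<otimes>\<^bsub>tensor A' B'\<^esub> int_emb x"
  using assms
  by (induction t rule: cod.tensor_induct)
    (simp_all add: int_emb_pt int_emb_closed cod.tensor.l_distr cod.tensor.r_distr)

sublocale lift: tensor_lift A B "tensor A' B'" int_emb
  "\<lambda>a. cod.pt (f a) \<one>\<^bsub>B'\<^esub>" "\<lambda>b. cod.pt \<one>\<^bsub>A'\<^esub> (g b)"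
proof (rule tensor_lift.intro[OF dom.algebra_pair_axioms cod.tensor.ring_axioms],
    rule tensor_lift_axioms.intro)
  show "int_emb (x + y) = int_emb x \<oplus>\<^bsub>tensor A' B'\<^esub> int_emb y" for x y
    unfolding int_emb_def by (simp add: single_add cod.proj_add cod.pre_single)
  show "int_emb (x * y) = int_emb x \<otimes>\<^bsub>tensor A' B'\<^esub> int_emb y" for x y
    unfolding int_emb_def by (simp add: q_mult_single)
  show "int_emb 1 = \<one>\<^bsub>tensor A' B'\<^esub>"
    using cod.pt_one by (simp add: int_emb_def pure_tensor_def)
  show "(\<lambda>a. cod.pt (f a) \<one>\<^bsub>B'\<^esub>) \<in> ring_hom A (tensor A' B')"
    by (rule ring_hom_memI) (simp_all add: cod.pt_mult cod.pt_add_left cod.pt_one)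
  show "(\<lambda>b. cod.pt \<one>\<^bsub>A'\<^esub> (g b)) \<in> ring_hom B (tensor A' B')"
    by (rule ring_hom_memI) (simp_all add: cod.pt_mult cod.pt_add_right cod.pt_one)
  show "cod.pt (f (r \<odot>\<^bsub>A\<^esub> a)) \<one>\<^bsub>B'\<^esub> \<otimes>\<^bsub>tensor A' B'\<^esub> cod.pt \<one>\<^bsub>A'\<^esub> (g b) =
      cod.pt (f a) \<one>\<^bsub>B'\<^esub> \<otimes>\<^bsub>tensor A' B'\<^esub> cod.pt \<one>\<^bsub>A'\<^esub> (g (r \<odot>\<^bsub>B\<^esub> b))"
    if "a \<in> carrier A" "b \<in> carrier B" for a b r
  proof -
    have "cod.pt (f (r \<odot>\<^bsub>A\<^esub> a)) (g b) = cod.pt (f a) (g (r \<odot>\<^bsub>B\<^esub> b))"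
      using that by (simp add: f_smult g_smult cod.pt_smult)
    then show ?thesis
      using that dom.smult_A[of a r] dom.smult_B[of b r] by (simp add: cod.pt_mult)
  qed
qed (simp_all add: int_emb_closed int_emb_comm cod.pt_mult)

text \<open>The formula inside \<open>tensor_map\<close> is a sum over the support of a single
  representative. Here it is identified with the universal map, which is constant on cosets, so that
  \<open>the_elem\<close> has a value to pick.\<close>

lemma pre_map_eq:
  assumes "s \<in> carrier (tensor_pre A B)"
  shows "lift.pre_map s = q (\<Sum>(a, b)\<in>Poly_Mapping.keys s.
    Poly_Mapping.single (f a, g b) (Poly_Mapping.lookup s (a, b)))"
proof -
  have "(\<Sum>(a, b)\<in>S. Poly_Mapping.single (f a, g b) (n (a, b))) \<in> carrier (tensor_pre A' B') \<and>
    (\<Oplus>\<^bsub>tensor A' B'\<^esub>ab\<in>S. int_emb (n ab) \<otimes>\<^bsub>tensor A' B'\<^esub>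
      (case ab of (a, b) \<Rightarrow> cod.pt (f a) \<one>\<^bsub>B'\<^esub> \<otimes>\<^bsub>tensor A' B'\<^esub> cod.pt \<one>\<^bsub>A'\<^esub> (g b)))
    = q (\<Sum>(a, b)\<in>S. Poly_Mapping.single (f a, g b) (n (a, b)))"
    if "finite S" "S \<subseteq> carrier A \<times> carrier B" for S and n :: "_ \<Rightarrow> int"
    using that
  proof (induction S rule: finite_induct)
    case empty
    show ?case using cod.proj.hom_zero by (simp add: cod.pre_carrier)
  next
    case (insert ab S)
    obtain a b where ab: "ab = (a, b)" "a \<in> carrier A" "b \<in> carrier B"
      using insert.prems by (cases ab) auto
    let ?h = "\<lambda>ab. int_emb (n ab) \<otimes>\<^bsub>tensor A' B'\<^esub>
      (case ab of (a, b) \<Rightarrow> cod.pt (f a) \<one>\<^bsub>B'\<^esub> \<otimes>\<^bsub>tensor A' B'\<^esub> cod.pt \<one>\<^bsub>A'\<^esub> (g b))"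
    have hc: "?h x \<in> carrier (tensor A' B')" if "x \<in> insert ab S" for x
      using that insert.prems int_emb_closed by (cases x) (auto simp: subset_iff)
    have "?h (a, b) = q (Poly_Mapping.single (f a, g b) (n (a, b)))"
      using ab by (simp add: cod.pt_mult int_emb_pt)
    moreover have "(\<Oplus>\<^bsub>tensor A' B'\<^esub>x\<in>insert ab S. ?h x) = ?h ab \<oplus>\<^bsub>tensor A' B'\<^esub> (\<Oplus>\<^bsub>tensor A' B'\<^esub>x\<in>S. ?h x)"
      using insert.hyps hc by (intro cod.tensor.finsum_insert) auto
    moreover have pm: "(\<Sum>(a, b)\<in>S. Poly_Mapping.single (f a, g b) (n (a, b))) \<in> carrier (tensor_pre A' B')"
      using insert by blast
    ultimately show ?case
      using insert ab cod.pre.add.m_closed[OF cod.pre_single[of "f a" "g b" "n (a, b)"] pm]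
      by (simp add: cod.proj_add cod.pre_single)
  qed
  from this[of "Poly_Mapping.keys s" "Poly_Mapping.lookup s"] assms show ?thesis
    by (simp add: monoid_ring_lift_def dom.pre_carrier)
qed

lemma tensor_map_eq_lift: "U \<in> carrier (tensor A B) \<Longrightarrow> tensor_map A' B' f g U = lift.lift U"
proof -
  assume "U \<in> carrier (tensor A B)"
  then obtain s where "s \<in> carrier (tensor_pre A B)" "U = tensor_ideal A B +>\<^bsub>tensor_pre A B\<^esub> s"
    by (rule dom.tensor_carrierE)
  then have "U \<subseteq> carrier (tensor_pre A B)"
    using dom.I.a_Hcarr unfolding a_r_coset_def' by blast
  then have "(\<lambda>s. q (\<Sum>(a, b)\<in>Poly_Mapping.keys s.
    Poly_Mapping.single (f a, g b) (Poly_Mapping.lookup s (a, b)))) ` U = lift.pre_map ` U"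
    by (intro image_cong refl) (simp add: pre_map_eq subset_iff)
  then show ?thesis by (simp add: tensor_map_def lift.lift_def)
qed

lemma tensor_map_hom: "tensor_map A' B' f g \<in> ring_hom (tensor A B) (tensor A' B')"
  using lift.lift_hom
  by (auto simp: ring_hom_def Pi_def tensor_map_eq_lift)

lemma tensor_map_pt:
  "a \<in> carrier A \<Longrightarrow> b \<in> carrier B \<Longrightarrow> tensor_map A' B' f g (dom.pt a b) = cod.pt (f a) (g b)"
  by (simp add: tensor_map_eq_lift lift.lift_pt cod.pt_mult)

sublocale tm: ring_hom_ring "tensor A B" "tensor A' B'" "tensor_map A' B' f g"
  by (rule ring_hom_ringI2[OF dom.tensor.ring_axioms cod.tensor.ring_axioms tensor_map_hom])

end

section \<open>Evaluation of polynomials in rings\<close>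

locale type_hom = T: ring T for T :: "('t, 'r) ring_scheme" (structure) +
  fixes s :: "'a::comm_ring_1 \<Rightarrow> 't"
  assumes closed [simp, intro]: "s a \<in> carrier T"
    and hom_add: "s (a + b) = s a \<oplus> s b"
    and hom_mult: "s (a * b) = s a \<otimes> s b"
    and hom_one: "s 1 = \<one>"
begin

lemma hom_zero: "s 0 = \<zero>"
  using hom_add[of 0 0] T.add.l_cancel_one closed by auto

lemma hom_minus: "s (- a) = \<ominus> s a"
  using hom_add[of "- a" a] by (intro T.minus_equality[symmetric]) (auto simp: hom_zero)

lemma hom_diff: "s (a - b) = s a \<ominus> s b"
  using hom_add[of a "- b"] by (simp add: hom_minus a_minus_def)

lemma hom_sum: "finite S \<Longrightarrow> s (\<Sum>i\<in>S. h i) = (\<Oplus>i\<in>S. s (h i))"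
  by (induction S rule: finite_induct) (simp_all add: hom_zero hom_add)

lemma hom_power: "s (a ^ i) = s a [^] i"
  by (induction i) (simp_all add: hom_one hom_mult power_Suc2 del: power_Suc)

lemma hom_comm: "s a \<otimes> s b = s b \<otimes> s a"
  by (simp add: hom_mult[symmetric] mult.commute)

end

text \<open>Horner's scheme. The coefficients need not be central in the ring; the next locale only
  asks that they commute with the point \<open>u\<close>.\<close>

definition poly_ev :: "('t, 'r) ring_scheme \<Rightarrow> ('a::zero \<Rightarrow> 't) \<Rightarrow> 't \<Rightarrow> 'a poly \<Rightarrow> 't" where
  "poly_ev T s u f = fold_coeffs (\<lambda>a r. s a \<oplus>\<^bsub>T\<^esub> u \<otimes>\<^bsub>T\<^esub> r) f \<zero>\<^bsub>T\<^esub>"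

locale poly_eval = type_hom T s for T :: "('t, 'r) ring_scheme" (structure) and s :: "'a::comm_ring_1 \<Rightarrow> 't" +
  fixes u :: 't
  assumes u_closed [simp, intro]: "u \<in> carrier T"
    and u_comm: "u \<otimes> s a = s a \<otimes> u"
begin

abbreviation ev where "ev \<equiv> poly_ev T s u"

lemma ev_0 [simp]: "ev 0 = \<zero>"
  by (simp add: poly_ev_def)

lemma ev_pCons: "ev (pCons a f) = s a \<oplus> u \<otimes> ev f"
proof (cases "f = 0")
  case True
  then show ?thesis
    by (cases "a = 0") (simp_all add: hom_zero poly_ev_def fold_coeffs_pCons_coeff_not_0_eq)
next
  case False
  then show ?thesis by (simp add: poly_ev_def fold_coeffs_pCons_not_0_0_eq)
qed

lemma ev_closed [simp, intro]: "ev f \<in> carrier T"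
  by (induction f) (simp_all add: ev_pCons)

lemma ev_const: "ev [:a:] = s a"
  by (simp add: ev_pCons)

lemma ev_comm:
  assumes t: "t \<in> carrier T" "t \<otimes> u = u \<otimes> t" "\<And>a. t \<otimes> s a = s a \<otimes> t"
  shows "t \<otimes> ev f = ev f \<otimes> t"
proof (induction f)
  case (pCons a f)
  have "t \<otimes> (u \<otimes> ev f) = u \<otimes> (t \<otimes> ev f)"
    using t(1,2) by (simp add: T.m_assoc[symmetric])
  then show ?case using t(1) pCons
    by (simp add: ev_pCons T.r_distr T.l_distr t(3) T.m_assoc)
qed (use t in simp)

lemma u_ev: "u \<otimes> ev f = ev f \<otimes> u"
  by (rule ev_comm) (simp_all add: u_comm)

lemma s_ev: "s a \<otimes> ev f = ev f \<otimes> s a"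
  by (rule ev_comm) (simp_all add: u_comm hom_comm)

lemma ev_add: "ev (f + g) = ev f \<oplus> ev g"
proof (induction f g rule: poly_induct2)
  case (pCons a f b g)
  then show ?case by (simp add: ev_pCons hom_add T.r_distr T.a_ac)
qed simp

lemma ev_smult: "ev (smult a f) = s a \<otimes> ev f"
proof (induction f)
  case (pCons b f)
  have "u \<otimes> (s a \<otimes> ev f) = s a \<otimes> (u \<otimes> ev f)"
    by (simp add: T.m_assoc[symmetric] u_comm)
  with pCons show ?case by (simp add: ev_pCons hom_mult T.r_distr)
qed simp

lemma ev_mult: "ev (f * g) = ev f \<otimes> ev g"
proof (induction f)
  case (pCons a f)
  then show ?case
    by (simp add: mult_pCons_left ev_add ev_smult ev_pCons hom_zero T.l_distr T.m_assoc)
qed simp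

sublocale ev: type_hom T ev
  by unfold_locales (simp_all add: ev_add ev_mult one_pCons ev_const hom_one del: pCons_one)

lemma ev_var: "ev [:0, 1:] = u"
  by (simp add: ev_pCons hom_zero hom_one)

lemma ev_monom: "ev (Polynomial.monom a i) = s a \<otimes> u [^] i"
proof -
  have "Polynomial.monom a i = [:a:] * [:0, 1:] ^ i"
    by (simp add: monom_altdef)
  then show ?thesis by (simp add: ev.hom_mult ev.hom_power ev_var ev_const del: mult_pCons_left)
qed

lemma ev_finsum:
  "Polynomial.degree f \<le> m \<Longrightarrow> ev f = (\<Oplus>i\<in>{..m}. s (Polynomial.coeff f i) \<otimes> u [^] i)"
  using ev.hom_sum[of "{..m}" "\<lambda>i. Polynomial.monom (Polynomial.coeff f i) i"]
  by (simp add: poly_as_sum_of_monoms' ev_monom)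

end

lemma (in poly_eval) ev_map_poly:
  assumes "h 0 = 0" "poly_eval T r u" "\<And>a. r a = s (h a)"
  shows "ev (map_poly h f) = poly_ev T r u f"
proof -
  interpret r: poly_eval T r u by fact
  show ?thesis
    by (induction f) (simp_all add: ev_pCons r.ev_pCons map_poly_pCons assms(1) assms(3)[symmetric])
qed

text \<open>Naturality of evaluation. It moves polynomials in \<open>K\<close> or in the parameter
  through quotients, structure maps and the substitutions of x and y.\<close>

lemma (in poly_eval) ev_natural:
  assumes "\<psi> \<in> ring_hom T T'" "poly_eval T' r v" "\<And>a. \<psi> (s a) = r a" "\<psi> u = v"
  shows "\<psi> (ev f) = poly_ev T' r v f"
proof -
  interpret r: poly_eval T' r v by fact
  interpret psi: ring_hom_ring T T' \<psi>
    by (rule ring_hom_ringI2[OF T.ring_axioms r.T.ring_axioms assms(1)])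
  show ?thesis
    by (induction f) (simp_all add: ev_pCons r.ev_pCons assms(3,4))
qed

section \<open>Bivariate polynomials\<close>

text \<open>In \<open>'a poly poly\<close> the inner variable is called \<open>u\<close> and the outer one \<open>v\<close>. A polynomial
  \<open>f(u)\<close> is \<open>[:f:]\<close>, and \<open>f(v)\<close> is \<open>lift_v f\<close>.\<close>

definition lift_v :: "'a::comm_ring_1 poly \<Rightarrow> 'a poly poly" where
  "lift_v = map_poly (\<lambda>c. [:c:])"

text \<open>The divided difference (f(v) - f(u)) / (v - u). Synthetic division of f(v) by v - u
  produces it as a polynomial over any commutative ring.\<close>

definition div_diff :: "'a::comm_ring_1 poly \<Rightarrow> 'a poly poly" where
  "div_diff f = synthetic_div (lift_v f) [:0, 1:]"

abbreviation var_u :: "'a::comm_ring_1 poly poly" where "var_u \<equiv> [:[:0, 1:]:]"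
abbreviation var_v :: "'a::comm_ring_1 poly poly" where "var_v \<equiv> [:0, 1:]"

lemma lift_v_0 [simp]: "lift_v 0 = 0"
  by (simp add: lift_v_def)

lemma lift_v_pCons: "lift_v (pCons a f) = pCons [:a:] (lift_v f)"
  by (simp add: lift_v_def map_poly_pCons)

lemma lift_v_add: "lift_v (f + g) = lift_v f + lift_v g"
  by (rule poly_eqI) (simp add: lift_v_def coeff_map_poly)

lemma lift_v_minus: "lift_v (- f) = - lift_v f"
  by (rule poly_eqI) (simp add: lift_v_def coeff_map_poly)

lemma lift_v_diff: "lift_v (f - g) = lift_v f - lift_v g"
  by (rule poly_eqI) (simp add: lift_v_def coeff_map_poly)

lemma lift_v_smult: "lift_v (smult a f) = smult [:a:] (lift_v f)"
  by (rule poly_eqI) (simp add: lift_v_def coeff_map_poly)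

lemma lift_v_mult: "lift_v (f * g) = lift_v f * lift_v g"
  by (induction f) (simp_all add: lift_v_pCons lift_v_add lift_v_smult mult_pCons_left)

lemma lift_v_const: "lift_v [:a:] = [:[:a:]:]"
  by (simp add: lift_v_pCons)

lemma lift_v_1 [simp]: "lift_v 1 = 1"
  by (simp add: lift_v_const one_pCons del: pCons_one)

lemma poly_lift_v_var: "poly (lift_v f) [:0, 1:] = f"
  by (induction f) (simp_all add: lift_v_pCons)

lemma div_diff_eq: "(var_v - var_u) * div_diff f = lift_v f - [:f:]"
  using synthetic_div_correct'[of "[:0, 1:]" "lift_v f"]
  by (simp add: div_diff_def poly_lift_v_var algebra_simps)

lemma div_diff_pCons: "div_diff (pCons a f) = [:f:] + var_v * div_diff f"
  by (simp add: div_diff_def lift_v_pCons poly_lift_v_var)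

text \<open>The product rule for \<open>a + u f\<close> with the roles of u and v exchanged; the two
  forms differ by (v - u) times the divided difference, which is f(v) - f(u).\<close>

lemma div_diff_pCons': "div_diff (pCons a f) = lift_v f + var_u * div_diff f"
proof -
  have *: "d + a = c + b" if "a - b = c - d" for a b c d :: "'a poly poly"
    using that by (simp add: algebra_simps)
  show ?thesis unfolding div_diff_pCons
    by (rule *) (simp only: div_diff_eq left_diff_distrib[symmetric])
qed

lemma div_diff_0 [simp]: "div_diff 0 = 0"
  by (simp add: div_diff_def)

section \<open>The reflection equation as a polynomial condition\<close>

text \<open>The polynomial m(u, v) of the overview for arbitrary \<open>f\<close>, \<open>g\<close>.
  Its three terms stem from the products with two factors \<open>R\<close>, with \<open>R\<close>
  from the outer factor R(x/y) only, and with \<open>R\<close> from the middle factor R(xy)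
  only.\<close>

definition refl_poly :: "'a::comm_ring_1 \<Rightarrow> 'a \<Rightarrow> 'a poly \<Rightarrow> 'a poly \<Rightarrow> 'a poly poly" where
  "refl_poly x y f g =
     [:[:(x - y) * (x * y - 1):]:] * ((var_v * [:f:] - var_u * lift_v f) * div_diff g)
     + [:[:x - y:]:] * (lift_v (f * g) - [:f * g:])
     + [:[:y * (x * y - 1):]:] * ([:f:] * lift_v g - [:g:] * lift_v f)"

locale hecke_ring = type_hom S s for S :: "('t, 'r) ring_scheme" (structure) and s :: "'a::comm_ring_1 \<Rightarrow> 't" +
  fixes R K :: 't and w :: 'a
  assumes R_closed [simp, intro]: "R \<in> carrier S" and K_closed [simp, intro]: "K \<in> carrier S"
    and R_comm: "R \<otimes> s a = s a \<otimes> R" and K_comm: "K \<otimes> s a = s a \<otimes> K"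
    and quadratic: "R \<otimes> R = s w \<otimes> R \<oplus> \<one>"
    and braid: "R \<otimes> K \<otimes> R \<otimes> K = K \<otimes> R \<otimes> K \<otimes> R"
begin

sublocale K: poly_eval S s K
  by unfold_locales (auto simp: K_comm)

abbreviation ev where "ev \<equiv> poly_ev S s K"

lemma R_left: "t \<in> carrier S \<Longrightarrow> R \<otimes> (s a \<otimes> t) = s a \<otimes> (R \<otimes> t)"
  by (simp add: T.m_assoc[symmetric] R_comm)

lemma K_left: "t \<in> carrier S \<Longrightarrow> K \<otimes> (s a \<otimes> t) = s a \<otimes> (K \<otimes> t)"
  by (simp add: T.m_assoc[symmetric] K_comm)

lemma ev_left: "t \<in> carrier S \<Longrightarrow> ev f \<otimes> (s a \<otimes> t) = s a \<otimes> (ev f \<otimes> t)"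
  by (simp add: T.m_assoc[symmetric] K.s_ev)

text \<open>The linear map sending \<open>u^i v^j\<close> to \<open>K^i R K^j\<close>: the inner
  variable counts powers of \<open>K\<close> to the left of \<open>R\<close>, the outer one those to
  the right.\<close>

definition sandwich :: "'a poly poly \<Rightarrow> 't" where
  "sandwich m = fold_coeffs (\<lambda>f r. ev f \<otimes> R \<oplus> r \<otimes> K) m \<zero>"

lemma sandwich_0 [simp]: "sandwich 0 = \<zero>"
  by (simp add: sandwich_def)

lemma sandwich_pCons: "sandwich (pCons f m) = ev f \<otimes> R \<oplus> sandwich m \<otimes> K"
proof (cases "m = 0")
  case True
  then show ?thesis
    by (cases "f = 0") (simp_all add: sandwich_def)
next
  case False
  then show ?thesis by (simp add: sandwich_def)
qed

lemma sandwich_closed [simp, intro]: "sandwich m \<in> carrier S"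
  by (induction m) (simp_all add: sandwich_pCons)

lemma sandwich_add: "sandwich (m + n) = sandwich m \<oplus> sandwich n"
proof (induction m n rule: poly_induct2)
  case (pCons f m g n)
  then show ?case by (simp add: sandwich_pCons K.ev_add T.l_distr T.a_ac)
qed simp

lemma sandwich_minus: "sandwich (- m) = \<ominus> sandwich m"
  using sandwich_add[of "- m" m] by (intro T.minus_equality[symmetric]) auto

lemma sandwich_diff: "sandwich (m - n) = sandwich m \<ominus> sandwich n"
  using sandwich_add[of m "- n"] by (simp add: sandwich_minus a_minus_def)

lemma sandwich_smult: "sandwich (smult f m) = ev f \<otimes> sandwich m"
  by (induction m) (simp_all add: sandwich_pCons K.ev_mult T.r_distr T.m_assoc)

lemma sandwich_u: "sandwich ([:f:] * m) = ev f \<otimes> sandwich m"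
  by (simp add: sandwich_smult)

lemma sandwich_scalar: "sandwich ([:[:a:]:] * m) = s a \<otimes> sandwich m"
  by (simp add: sandwich_smult K.ev_const)

lemma sandwich_var_u: "sandwich (var_u * m) = K \<otimes> sandwich m"
  by (simp add: sandwich_smult K.ev_var)

lemma sandwich_scalar_right: "sandwich m \<otimes> s a = s a \<otimes> sandwich m"
proof (induction m)
  case (pCons f m)
  have "sandwich m \<otimes> K \<otimes> s a = s a \<otimes> (sandwich m \<otimes> K)"
    using pCons by (simp add: T.m_assoc K_comm) (simp add: T.m_assoc[symmetric])
  moreover have "ev f \<otimes> R \<otimes> s a = s a \<otimes> (ev f \<otimes> R)"
    by (simp add: T.m_assoc R_comm ev_left)
  ultimately show ?case by (simp add: sandwich_pCons T.l_distr T.r_distr)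
qed simp

lemma sandwich_v: "sandwich (lift_v g * m) = sandwich m \<otimes> ev g"
proof (induction g arbitrary: m)
  case (pCons a g)
  have "lift_v (pCons a g) * m = [:[:a:]:] * m + pCons 0 (lift_v g * m)"
    by (simp add: lift_v_pCons mult_pCons_left)
  then have "sandwich (lift_v (pCons a g) * m)
      = s a \<otimes> sandwich m \<oplus> sandwich m \<otimes> ev g \<otimes> K"
    using pCons by (simp add: sandwich_add sandwich_pCons sandwich_scalar del: mult_pCons_left)
  then show ?case
    by (simp add: K.ev_pCons T.r_distr T.m_assoc sandwich_scalar_right K.u_ev)
qed simp

lemma sandwich_1: "sandwich 1 = R"
  using sandwich_pCons[of 1 0] by (simp add: K.ev.hom_one pCons_one)

lemma sandwich_uv: "sandwich ([:f:] * lift_v g) = ev f \<otimes> R \<otimes> ev g"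
  using sandwich_u[of f "lift_v g * 1"] sandwich_v[of g 1] by (simp add: sandwich_1 T.m_assoc)

text \<open>An element of Jucys-Murphy type: that it commutes with \<open>K\<close> is the braid
  relation itself.\<close>

definition J where "J = R \<otimes> K \<otimes> R"

lemma J_closed [simp, intro]: "J \<in> carrier S"
  by (simp add: J_def)

lemma J_K: "J \<otimes> K = K \<otimes> J"
  using braid by (simp add: J_def T.m_assoc)

lemma J_scalar: "J \<otimes> s a = s a \<otimes> J"
  by (simp add: J_def T.m_assoc R_comm K_comm R_left K_left)

lemma J_ev: "J \<otimes> ev f = ev f \<otimes> J"
  by (rule K.ev_comm) (simp_all add: J_K J_scalar)

lemma J_R: "J \<otimes> R = s w \<otimes> J \<oplus> R \<otimes> K"
  by (simp add: J_def T.m_assoc quadratic T.r_distr R_left K_left K_comm R_comm)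

text \<open>The inductive step multiplies the identity for \<open>f\<close> by \<open>J\<close>, which commutes with \<open>K\<close>, and
  rewrites \<open>J R f(K) R\<close> as \<open>R K f(K) R + w J f(K) R\<close>.\<close>

lemma R_ev_R_K:
  "R \<otimes> ev f \<otimes> R \<otimes> K \<oplus> s w \<otimes> (K \<otimes> R \<otimes> ev f)
    = K \<otimes> R \<otimes> ev f \<otimes> R \<oplus> s w \<otimes> (ev f \<otimes> R \<otimes> K)"
proof (induction f)
  case 0
  show ?case by simp
next
  case (pCons a f)
  define F where "F = ev f"
  have F [simp]: "F \<in> carrier S" by (simp add: F_def)
  let ?W = "s w"
  define K2 where "K2 = K \<otimes> F"
  have K2 [simp]: "K2 \<in> carrier S" by (simp add: K2_def)
  have JF: "J \<otimes> F = F \<otimes> J" by (simp add: F_def J_ev)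
  have KF: "K \<otimes> F = F \<otimes> K" by (simp add: F_def K.u_ev)
  have FW: "F \<otimes> (?W \<otimes> t) = ?W \<otimes> (F \<otimes> t)" if "t \<in> carrier S" for t
    using that by (simp add: F_def ev_left)
  have JW: "J \<otimes> (?W \<otimes> t) = ?W \<otimes> (J \<otimes> t)" if "t \<in> carrier S" for t
    using that by (simp add: T.m_assoc[symmetric] J_scalar)
  have star: "J \<otimes> (R \<otimes> t) = ?W \<otimes> (J \<otimes> t) \<oplus> R \<otimes> (K \<otimes> t)" if "t \<in> carrier S" for t
    using that J_R by (simp add: T.m_assoc[symmetric] T.l_distr)
  have JK: "J \<otimes> (K \<otimes> t) = K \<otimes> (J \<otimes> t)" if "t \<in> carrier S" for t
    using that J_K by (simp add: T.m_assoc[symmetric])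
  define A where "A = R \<otimes> (K \<otimes> (F \<otimes> (R \<otimes> K)))"
  define B where "B = K \<otimes> (R \<otimes> (K \<otimes> (F \<otimes> R)))"
  define C where "C = ?W \<otimes> (K \<otimes> (R \<otimes> (K \<otimes> F)))"
  define D where "D = ?W \<otimes> (K \<otimes> (F \<otimes> (R \<otimes> K)))"
  define Q where "Q = ?W \<otimes> (J \<otimes> (F \<otimes> (R \<otimes> K)))"
  define V where "V = ?W \<otimes> (?W \<otimes> (K \<otimes> (J \<otimes> F)))"
  have c [simp]: "A \<in> carrier S" "B \<in> carrier S" "C \<in> carrier S" "D \<in> carrier S"
    "Q \<in> carrier S" "V \<in> carrier S"
    by (simp_all add: A_def B_def C_def D_def Q_def V_def)
  have e1: "J \<otimes> (R \<otimes> F \<otimes> R \<otimes> K) = Q \<oplus> A"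
    by (simp add: T.m_assoc star A_def Q_def)
  have e2: "J \<otimes> (?W \<otimes> (K \<otimes> R \<otimes> F)) = V \<oplus> C"
    by (simp add: T.m_assoc JW JK star T.r_distr K_left V_def C_def)
  have FJR: "J \<otimes> (F \<otimes> R) = ?W \<otimes> (J \<otimes> F) \<oplus> F \<otimes> (R \<otimes> K)"
  proof -
    have "J \<otimes> (F \<otimes> R) = F \<otimes> (J \<otimes> R)"
      by (simp add: T.m_assoc[symmetric] JF)
    then show ?thesis by (simp add: J_R T.r_distr FW JF)
  qed
  have e3: "J \<otimes> (K \<otimes> R \<otimes> F \<otimes> R) = V \<oplus> D \<oplus> B"
    by (simp add: T.m_assoc JK star T.r_distr K_left FJR V_def D_def B_def)
  have e4: "J \<otimes> (?W \<otimes> (F \<otimes> R \<otimes> K)) = Q"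
    by (simp add: T.m_assoc JW Q_def)
  have "Q \<oplus> A \<oplus> (V \<oplus> C) = V \<oplus> D \<oplus> B \<oplus> Q"
    using arg_cong[OF pCons.IH[folded F_def], of "\<lambda>t. J \<otimes> t"]
    by (simp only: T.r_distr e1 e2 e3 e4 F J_closed T.m_closed R_closed K_closed closed)
  then have "(Q \<oplus> V) \<oplus> (A \<oplus> C) = (Q \<oplus> V) \<oplus> (B \<oplus> D)"
    by (simp add: T.a_ac)
  \<comment> \<open>This is the claim for \<open>u f\<close>. The claim is linear in the polynomial,
    so only the constant \<open>a\<close> remains, and for it both sides agree by the quadratic
    relation.\<close>
  then have KF_case: "A \<oplus> C = B \<oplus> D"
    by (rule T.add.l_cancel) simp_all
  have RRK: "R \<otimes> (R \<otimes> K) = ?W \<otimes> (R \<otimes> K) \<oplus> K"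
    using quadratic by (simp add: T.m_assoc[symmetric] T.l_distr)
  have W: "?W \<otimes> (s a \<otimes> t) = s a \<otimes> (?W \<otimes> t)" if "t \<in> carrier S" for t
    using that by (simp add: T.m_assoc[symmetric] hom_comm)
  have "R \<otimes> ev (pCons a f) \<otimes> R \<otimes> K \<oplus> ?W \<otimes> (K \<otimes> R \<otimes> ev (pCons a f))
    = (s a \<otimes> (?W \<otimes> (R \<otimes> K)) \<oplus> s a \<otimes> K \<oplus> s a \<otimes> (?W \<otimes> (K \<otimes> R))) \<oplus> (A \<oplus> C)"
    by (simp add: K.ev_pCons F_def[symmetric] T.l_distr T.r_distr T.m_assoc RRK W
        R_comm R_left K_left A_def C_def T.a_ac)
  also have "\<dots> = K \<otimes> R \<otimes> ev (pCons a f) \<otimes> R \<oplus> ?W \<otimes> (ev (pCons a f) \<otimes> R \<otimes> K)"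
    unfolding KF_case
    by (simp add: K.ev_pCons F_def[symmetric] T.l_distr T.r_distr T.m_assoc W
        R_left K_left K_comm quadratic B_def D_def T.a_ac)
  finally show ?case .
qed

lemma R_ev_R_K_diff:
  "R \<otimes> ev f \<otimes> R \<otimes> K \<ominus> K \<otimes> R \<otimes> ev f \<otimes> R
    = s w \<otimes> sandwich (var_v * [:f:] - var_u * lift_v f)"
proof -
  have cancel: "a \<ominus> c = d \<ominus> b"
    if "a \<oplus> b = c \<oplus> d" and [simp]: "a \<in> carrier S" "b \<in> carrier S" "c \<in> carrier S" "d \<in> carrier S"
    for a b c d
  proof -
    have "a = c \<oplus> d \<ominus> b"
      using that(1) by (metis T.add.inv_solve_right T.minus_eq that(2-5) T.a_closed)
    then have "a \<ominus> c = (c \<oplus> (d \<ominus> b)) \<ominus> c" by (simp add: T.minus_eq T.a_assoc)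
    then show ?thesis
      by (simp only: T.a_comm[of c] T.minus_closed that(2-5)) (simp add: T.minus_eq T.a_assoc T.r_neg)
  qed
  have v: "sandwich (var_v * [:f:]) = ev f \<otimes> R \<otimes> K"
    using sandwich_uv[of f "[:0, 1:]"]
    by (simp add: lift_v_pCons K.ev_var mult.commute)
  have u: "sandwich (var_u * lift_v f) = K \<otimes> R \<otimes> ev f"
    using sandwich_uv[of "[:0, 1:]" f] by (simp add: K.ev_var)
  have "R \<otimes> ev f \<otimes> R \<otimes> K \<ominus> K \<otimes> R \<otimes> ev f \<otimes> R
    = s w \<otimes> (ev f \<otimes> R \<otimes> K) \<ominus> s w \<otimes> (K \<otimes> R \<otimes> ev f)"
    by (rule cancel[OF R_ev_R_K]) simp_all
  then show ?thesis
    unfolding sandwich_diff v u by (simp add: T.minus_eq T.r_distr T.r_minus)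
qed

text \<open>The commutator with \<open>M = R f(K) R\<close> is a derivation. Hence the commutator
  with g(K) is a sum of terms \<open>K^i [M, K] K^j\<close>, and inside \<open>sandwich\<close> this
  sum is multiplication by the divided difference of \<open>g\<close>.\<close>

lemma R_ev_R_ev:
  "R \<otimes> ev f \<otimes> R \<otimes> ev g \<ominus> ev g \<otimes> R \<otimes> ev f \<otimes> R
    = s w \<otimes> sandwich ((var_v * [:f:] - var_u * lift_v f) * div_diff g)"
proof (induction g)
  case 0
  show ?case by (simp add: T.minus_eq)
next
  case (pCons a g)
  define M where "M = R \<otimes> ev f \<otimes> R"
  have M [simp]: "M \<in> carrier S" by (simp add: M_def)
  let ?Z = "var_v * [:f:] - var_u * lift_v f"
  have Ms: "M \<otimes> s a = s a \<otimes> M"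
    by (simp add: M_def T.m_assoc R_comm R_left ev_left K.s_ev[symmetric])
  have 1: "M \<otimes> K \<ominus> K \<otimes> M = s w \<otimes> sandwich ?Z"
    using R_ev_R_K_diff[of f] by (simp add: M_def T.m_assoc)
  have 2: "M \<otimes> ev g \<ominus> ev g \<otimes> M = s w \<otimes> sandwich (?Z * div_diff g)"
    using pCons by (simp add: M_def T.m_assoc)
  have tele: "a1 \<oplus> b \<ominus> (a1 \<oplus> d) = (b \<ominus> c) \<oplus> (c \<ominus> d)"
    if "a1 \<in> carrier S" "b \<in> carrier S" "c \<in> carrier S" "d \<in> carrier S" for a1 b c d
  proof -
    have "a1 \<oplus> b \<ominus> (a1 \<oplus> d) = b \<ominus> d"
      using that by (simp add: T.minus_eq T.minus_add T.a_assoc)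
        (simp add: T.a_lcomm[of b "\<ominus> a1"] T.r_neg2)
    also have "\<dots> = (b \<ominus> c) \<oplus> (c \<ominus> d)"
      using that by (simp add: T.minus_eq T.a_assoc T.r_neg1)
    finally show ?thesis .
  qed
  have "M \<otimes> ev (pCons a g) \<ominus> ev (pCons a g) \<otimes> M
    = (M \<otimes> K \<otimes> ev g \<ominus> K \<otimes> M \<otimes> ev g) \<oplus> (K \<otimes> M \<otimes> ev g \<ominus> K \<otimes> (ev g \<otimes> M))"
    using tele[of "s a \<otimes> M" "M \<otimes> K \<otimes> ev g" "K \<otimes> M \<otimes> ev g" "K \<otimes> (ev g \<otimes> M)"]
    by (simp add: K.ev_pCons T.l_distr T.r_distr Ms T.m_assoc)
  also have "\<dots> = (M \<otimes> K \<ominus> K \<otimes> M) \<otimes> ev g \<oplus> K \<otimes> (M \<otimes> ev g \<ominus> ev g \<otimes> M)"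
    by (simp add: T.minus_eq T.l_distr T.r_distr T.l_minus T.r_minus T.m_assoc)
  also have "\<dots> = s w \<otimes> (sandwich ?Z \<otimes> ev g \<oplus> K \<otimes> sandwich (?Z * div_diff g))"
    unfolding 1 2 by (simp add: T.r_distr T.m_assoc K_left)
  also have "sandwich ?Z \<otimes> ev g \<oplus> K \<otimes> sandwich (?Z * div_diff g)
    = sandwich (lift_v g * ?Z + var_u * (?Z * div_diff g))"
    unfolding sandwich_add sandwich_v sandwich_var_u ..
  also have "lift_v g * ?Z + var_u * (?Z * div_diff g) = ?Z * div_diff (pCons a g)"
    unfolding div_diff_pCons' by (simp only: algebra_simps)
  finally show ?case by (simp add: M_def T.m_assoc)
qed

text \<open>\<open>L\<close> and \<open>N\<close> are x R(x/y) and xy R(xy) rewritten with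
  \<open>R^-1 = R - w\<close>. The product without \<open>R\<close> cancels because f(K) and g(K)
  commute; in each of the others one \<open>w\<close> comes from \<open>L\<close>, from
  \<open>N\<close> or from \<open>R_ev_R_ev\<close>.\<close>

lemma reflection_diff:
  fixes x y :: 'a
  defines "L \<equiv> s (x - y) \<otimes> R \<oplus> s (y * w)" and "N \<equiv> s (x * y - 1) \<otimes> R \<oplus> s w"
  shows "L \<otimes> ev f \<otimes> N \<otimes> ev g \<ominus> ev g \<otimes> N \<otimes> ev f \<otimes> L
    = s w \<otimes> sandwich (refl_poly x y f g)"
proof -
  let ?F = "ev f" and ?G = "ev g"
  define a b c d where "a = x - y" and "b = y * w" and "c = x * y - 1" and "d = w"
  have ss: "s i \<otimes> (s j \<otimes> t) = s (i * j) \<otimes> t" if "t \<in> carrier S" for i j t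
    using that by (simp add: hom_mult T.m_assoc)
  define z where "z = s (b * d) \<otimes> (?F \<otimes> ?G)"
  define p q r where "p = s (a * c) \<otimes> (R \<otimes> (?F \<otimes> (R \<otimes> ?G)))"
    and "q = s (a * d) \<otimes> (R \<otimes> (?F \<otimes> ?G))"
    and "r = s (b * c) \<otimes> (?F \<otimes> (R \<otimes> ?G))"
  define p' q' r' where "p' = s (a * c) \<otimes> (?G \<otimes> (R \<otimes> (?F \<otimes> R)))"
    and "q' = s (a * d) \<otimes> (?G \<otimes> (?F \<otimes> R))"
    and "r' = s (b * c) \<otimes> (?G \<otimes> (R \<otimes> ?F))"
  note defs = z_def p_def q_def r_def p'_def q'_def r'_def
  have cl [simp]: "z \<in> carrier S" "p \<in> carrier S" "q \<in> carrier S" "r \<in> carrier S"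
    "p' \<in> carrier S" "q' \<in> carrier S" "r' \<in> carrier S"
    by (simp_all add: defs)
  have GF: "?G \<otimes> ?F = ?F \<otimes> ?G" by (rule K.ev.hom_comm)
  have l: "L \<otimes> ?F \<otimes> N \<otimes> ?G = p \<oplus> (q \<oplus> (r \<oplus> z))"
    unfolding L_def N_def a_def[symmetric] b_def[symmetric] c_def[symmetric]
    unfolding d_def[symmetric]
    by (simp add: T.l_distr T.r_distr T.m_assoc R_left ev_left ss defs T.a_ac)
  have comm: "?F \<otimes> s i = s i \<otimes> ?F" "?G \<otimes> s i = s i \<otimes> ?G" for i
    by (simp_all add: K.s_ev)
  have "?G \<otimes> N \<otimes> ?F \<otimes> L = p' \<oplus> (q' \<oplus> (r' \<oplus> s (b * d) \<otimes> (?G \<otimes> ?F)))"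
    unfolding L_def N_def a_def[symmetric] b_def[symmetric] c_def[symmetric]
    unfolding d_def[symmetric]
    by (simp add: T.l_distr T.r_distr T.m_assoc R_left ev_left comm R_comm ss defs T.a_ac
        mult.commute[of c] mult.commute[of d])
  then have r: "?G \<otimes> N \<otimes> ?F \<otimes> L = p' \<oplus> (q' \<oplus> (r' \<oplus> z))"
    by (simp add: GF z_def)
  have d2: "(t1 \<oplus> u1) \<ominus> (t2 \<oplus> u2) = (t1 \<ominus> t2) \<oplus> (u1 \<ominus> u2)"
    if "t1 \<in> carrier S" "u1 \<in> carrier S" "t2 \<in> carrier S" "u2 \<in> carrier S" for t1 u1 t2 u2
    using that by (simp add: T.minus_eq T.minus_add T.a_ac)
  have sd: "s i \<otimes> t \<ominus> s i \<otimes> u = s i \<otimes> (t \<ominus> u)"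
    if "t \<in> carrier S" "u \<in> carrier S" for i t u
    using that by (simp add: T.minus_eq T.r_distr T.r_minus)
  have pp: "p \<ominus> p' = s w \<otimes>
      sandwich ([:[:(x - y) * (x * y - 1):]:] * ((var_v * [:f:] - var_u * lift_v f) * div_diff g))"
    using R_ev_R_ev[of f g] unfolding sandwich_scalar
    by (simp add: p_def p'_def sd T.m_assoc ss a_def c_def mult.commute)
  have qq: "q \<ominus> q' = s w \<otimes> sandwich ([:[:x - y:]:] * (lift_v (f * g) - [:f * g:]))"
    using sandwich_uv[of 1 "f * g"] sandwich_uv[of "f * g" 1] unfolding sandwich_scalar
    by (simp add: q_def q'_def sd T.m_assoc ss a_def d_def mult.commute sandwich_diff
        K.ev.hom_one K.ev.hom_mult)
      (simp add: T.m_assoc[symmetric] GF)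
  have rr: "r \<ominus> r' = s w \<otimes>
      sandwich ([:[:y * (x * y - 1):]:] * ([:f:] * lift_v g - [:g:] * lift_v f))"
    using sandwich_uv[of f g] sandwich_uv[of g f] unfolding sandwich_scalar
    by (simp add: r_def r'_def sd T.m_assoc ss b_def c_def sandwich_diff
        mult.commute mult.left_commute mult.assoc del: mult_pCons_left)
  have "p \<oplus> (q \<oplus> (r \<oplus> z)) \<ominus> (p' \<oplus> (q' \<oplus> (r' \<oplus> z)))
    = (p \<ominus> p') \<oplus> ((q \<ominus> q') \<oplus> (r \<ominus> r'))"
  proof -
    have "z \<ominus> z = \<zero>" by (simp add: T.minus_eq T.r_neg)
    then show ?thesis by (simp add: d2)
  qed
  then show ?thesis
    unfolding l r pp qq rr refl_poly_def
    by (simp only: sandwich_add T.r_distr closed sandwich_closed T.a_closed T.a_assoc T.m_closed)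
qed

lemma sandwich_ideal:
  assumes "ev p = \<zero>"
  shows "sandwich ([:p:] * m + lift_v p * n) = \<zero>"
  unfolding sandwich_add sandwich_u sandwich_v assms by simp

end

section \<open>The reflection polynomial through divided differences\<close>

lemma div_diff_unique:
  fixes f :: "'a::idom poly"
  assumes "(var_v - var_u) * d = lift_v f - [:f:]"
  shows "d = div_diff f"
proof -
  have "(var_v - var_u) * d = (var_v - var_u) * div_diff f"
    by (simp only: assms div_diff_eq)
  moreover have "var_v - var_u \<noteq> (0 :: 'a poly poly)" by simp
  ultimately show ?thesis by (metis mult_left_cancel)
qed

text \<open>\<open>refl_poly\<close> vanishes on the diagonal u = v. This is its quotient by v - u
  after eliminating f(v) and g(v), so that only f(u), g(u) and the divided differences are
  left.\<close>

definition refl_quot :: "'a::comm_ring_1 \<Rightarrow> 'a \<Rightarrow> 'a poly \<Rightarrow> 'a poly \<Rightarrow> 'a poly poly" where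
  "refl_quot x y f g = [:[:y * (x\<^sup>2 - 1):]:] * [:f:] * div_diff g - [:[:x * (y\<^sup>2 - 1):]:] * [:g:] * div_diff f
     + [:[:x - y:]:] * (var_v - [:[:x * y:]:] * var_u) * div_diff f * div_diff g"

lemma const2_simps:
  "[:[:a + b:]:] = [:[:a:]:] + [:[:b:]:]" "[:[:a - b:]:] = [:[:a:]:] - [:[:b:]:]"
  "[:[:a * b:]:] = [:[:a:]:] * [:[:b:]:]" "[:[:1:]:] = (1 :: 'a::comm_ring_1 poly poly)"
  "[:[:a ^ k:]:] = [:[:a:]:] ^ k"
  by (simp_all add: pCons_one poly_const_pow)

lemma refl_poly_eq:
  "refl_poly x y f g = (var_v - var_u) * refl_quot x y f g"
proof -
  have id: "(x - y) * (x * y - 1) * ((v * f - u * fv) * g') + (x - y) * (fv * gv - f * g)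
      + y * (x * y - 1) * (f * gv - g * fv)
    = (v - u) * (y * (x\<^sup>2 - 1) * f * g' - x * (y\<^sup>2 - 1) * g * f' + (x - y) * (v - x * y * u) * f' * g')"
    if fv: "fv = f + (v - u) * f'" and gv: "gv = g + (v - u) * g'"
    for x y u v f g f' g' fv gv :: "'a poly poly"
    unfolding fv gv by (simp add: algebra_simps power2_eq_square)
  have l: "lift_v h = [:h:] + (var_v - var_u) * div_diff h" for h :: "'a poly"
    by (simp only: div_diff_eq) simp
  have c: "[:a * b:] = [:a:] * [:b:]" for a b :: "'a poly" by simp
  show ?thesis
    unfolding refl_poly_def refl_quot_def lift_v_mult const2_simps c[of f g]
    by (rule id[OF l l])
qed

section \<open>The family satisfies the polynomial condition\<close>

context
  fixes p :: "'a::idom poly"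
begin

definition quot_at :: "'a \<Rightarrow> 'a poly" where "quot_at r = - synthetic_div p r"

text \<open>For \<open>r = \<xi> x\<close> the coefficients of \<open>quot_at r\<close> are the \<open>\<phi>\<^sub>i(\<xi>, x)\<close>, and \<open>sol_poly\<close> with
  \<open>\<zeta> = \<xi>\<^sup>-\<^sup>1\<close> is \<open>(x\<^sup>2 - 1) K\<^sub>p(\<xi>, x)\<close>.\<close>

definition sol_poly :: "'a \<Rightarrow> 'a \<Rightarrow> 'a \<Rightarrow> 'a poly" where
  "sol_poly \<zeta> x r = smult (x\<^sup>2 - 1) (quot_at r) + [:\<zeta> * x * poly p r:]"

lemma quot_at_eq: "[:- r, 1:] * quot_at r = [:poly p r:] - p"
proof -
  have "[:- r, 1:] * synthetic_div p r = p - [:poly p r:]"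
    using synthetic_div_correct'[of r p] by (simp only: eq_diff_eq)
  then show ?thesis by (simp only: quot_at_def mult_minus_right minus_diff_eq)
qed

lemma quot_at_v: "(var_v - [:[:r:]:]) * lift_v (quot_at r) = [:[:poly p r:]:] - lift_v p"
  using arg_cong[OF quot_at_eq[of r], of lift_v]
  unfolding lift_v_mult lift_v_diff by (simp add: lift_v_pCons pCons_one)

lemma quot_at_u: "(var_u - [:[:r:]:]) * [:quot_at r:] = [:[:poly p r:]:] - [:p:]"
  using arg_cong[OF quot_at_eq[of r], of "\<lambda>f. [:f:]"] by simp

text \<open>The divided difference of the identity (u - r) Q = p(r) - p(u), by the product rule. The
  proof checks it after multiplication by the non-zero divisor v - u.\<close>

lemma div_diff_quot_at:
  "(var_v - [:[:r:]:]) * div_diff (quot_at r) = - [:quot_at r:] - div_diff p"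
proof -
  have id: "(v - u) * ((v - c) * q') = (v - u) * (- q - p')"
    if "(v - u) * q' = qv - q" "(v - u) * p' = pv - pu" "(v - c) * qv = k - pv" "(u - c) * q = k - pu"
    for v u c q q' qv p' pv pu k :: "'a poly poly"
  proof -
    have "(v - u) * ((v - c) * q') = (v - c) * ((v - u) * q')" by (simp only: ac_simps)
    also have "\<dots> = (k - pv) - (v - c) * q" by (simp only: that(1) right_diff_distrib that(3))
    also have "\<dots> = (k - pu) - (pv - pu) - (v - c) * q" by simp
    also have "\<dots> = (u - c) * q - (v - u) * p' - (v - c) * q" by (simp only: that)
    finally show ?thesis by (simp add: algebra_simps)
  qed
  have "var_v - var_u \<noteq> (0 :: 'a poly poly)" by simp
  from mult_left_cancel[OF this, THEN iffD1, OF id[OF div_diff_eq div_diff_eq quot_at_v quot_at_u]]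
  show ?thesis .
qed

lemma div_diff_sol_poly: "div_diff (sol_poly \<zeta> x r) = [:[:x\<^sup>2 - 1:]:] * div_diff (quot_at r)"
proof (rule div_diff_unique[symmetric])
  have "(var_v - var_u) * ([:[:x\<^sup>2 - 1:]:] * div_diff (quot_at r))
    = [:[:x\<^sup>2 - 1:]:] * ((var_v - var_u) * div_diff (quot_at r))" by (simp only: ac_simps)
  also have "\<dots> = lift_v (sol_poly \<zeta> x r) - [:sol_poly \<zeta> x r:]"
    unfolding div_diff_eq by (simp add: sol_poly_def lift_v_add lift_v_smult lift_v_const smult_diff_right)
  finally show "(var_v - var_u) * ([:[:x\<^sup>2 - 1:]:] * div_diff (quot_at r))
    = lift_v (sol_poly \<zeta> x r) - [:sol_poly \<zeta> x r:]" .
qed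

text \<open>Let \<open>Q'\<close> be the divided difference of \<open>Q = quot_at r\<close>. Modulo \<open>p(u)\<close> and the divided
  difference of \<open>p\<close> one has \<open>(v - r) Q' = - Q\<close> and \<open>p(r) = (u - r) Q\<close>. This turns every term into
  a multiple of the product of the two divided differences, and the coefficients cancel.\<close>

lemma refl_poly_sol:
  assumes "\<zeta> * \<xi> = 1"
  shows "\<exists>m k. refl_poly x y (sol_poly \<zeta> x (\<xi> * x)) (sol_poly \<zeta> y (\<xi> * y)) = [:p:] * m + lift_v p * k"
proof -
  let ?c = "\<lambda>a::'a. [:[:a:]:]"
  let ?\<sigma> = "?c (\<xi> * x)" and ?\<rho> = "?c (\<xi> * y)"
  define xx yy Z \<Xi> where "xx = ?c x" and "yy = ?c y" and "Z = ?c \<zeta>" and "\<Xi> = ?c \<xi>"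
  define q g q' g' P where "q = [:quot_at (\<xi> * x):]" and "g = [:quot_at (\<xi> * y):]"
    and "q' = div_diff (quot_at (\<xi> * x))" and "g' = div_diff (quot_at (\<xi> * y))" and "P = div_diff p"
  define \<alpha> \<beta> s t where "\<alpha> = xx\<^sup>2 - 1" and "\<beta> = yy\<^sup>2 - 1" and "s = \<Xi> * xx" and "t = \<Xi> * yy"
  define ps pt where "ps = ?c (poly p (\<xi> * x))" and "pt = ?c (poly p (\<xi> * y))"
  define pu where "pu = [:p:]"
  define u v where "u = (var_u :: 'a poly poly)" and "v = (var_v :: 'a poly poly)"
  have st: "?\<sigma> = s" "?\<rho> = t" by (simp_all add: s_def t_def xx_def yy_def \<Xi>_def)
  have ZXi: "Z * \<Xi> = 1" using assms by (simp add: Z_def \<Xi>_def pCons_one)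
  have ab: "?c (x\<^sup>2 - 1) = \<alpha>" "?c (y\<^sup>2 - 1) = \<beta>"
    by (simp_all only: const2_simps \<alpha>_def \<beta>_def xx_def yy_def)
  have F: "[:sol_poly \<zeta> x (\<xi> * x):] = \<alpha> * q + Z * xx * ps" "[:sol_poly \<zeta> y (\<xi> * y):] = \<beta> * g + Z * yy * pt"
    unfolding ab[symmetric] by (simp_all add: sol_poly_def q_def g_def Z_def xx_def yy_def ps_def pt_def)
  have F': "div_diff (sol_poly \<zeta> x (\<xi> * x)) = \<alpha> * q'" "div_diff (sol_poly \<zeta> y (\<xi> * y)) = \<beta> * g'"
    unfolding div_diff_sol_poly ab q'_def g'_def by simp_all
  have q: "q = - (v - s) * q' - P" and g: "g = - (v - t) * g' - P"
    using div_diff_quot_at[of "\<xi> * x"] div_diff_quot_at[of "\<xi> * y"]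
    unfolding st q_def g_def q'_def g'_def P_def v_def by (simp_all only: minus_mult_left[symmetric]) simp_all
  have ps: "ps = pu + (u - s) * q" and pt: "pt = pu + (u - t) * g"
    using quot_at_u[of "\<xi> * x"] quot_at_u[of "\<xi> * y"]
    unfolding st q_def g_def ps_def pt_def u_def pu_def by simp_all
  \<comment> \<open>\<open>m1\<close> and \<open>m2\<close> collect what the substitutions for
    \<open>q\<close>, \<open>g\<close>, \<open>ps\<close>, \<open>pt\<close> leave over: the
    multiples of \<open>P\<close> and of p(u).\<close>
  define m1 where "m1 = xx * \<beta> * q' - yy * \<alpha> * g' - Z * xx * yy * ((u - s) * g' - (u - t) * q')"
  define m2 where "m2 = Z * xx * yy * (g' - q')"
  have main: "yy * \<alpha> * (\<alpha> * q + Z * xx * ps) * (\<beta> * g') - xx * \<beta> * (\<beta> * g + Z * yy * pt) * (\<alpha> * q')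
     + (xx - yy) * (v - xx * yy * u) * (\<alpha> * q') * (\<beta> * g') = \<alpha> * \<beta> * (P * m1 + pu * m2)"
  proof -
    have "yy * \<alpha> * (\<alpha> * q + Z * xx * ps) * (\<beta> * g') - xx * \<beta> * (\<beta> * g + Z * yy * pt) * (\<alpha> * q')
       + (xx - yy) * (v - xx * yy * u) * (\<alpha> * q') * (\<beta> * g')
      = \<alpha> * \<beta> * (yy * \<alpha> * q * g' - xx * \<beta> * g * q' + (xx - yy) * (v - xx * yy * u) * q' * g'
         + Z * xx * yy * (ps * g' - pt * q'))"
      by (simp add: algebra_simps)
    moreover have "ps * g' - pt * q' = pu * (g' - q') - P * ((u - s) * g' - (u - t) * q')
        + q' * g' * ((s - t) * (u + v) + t * t - s * s)"
      unfolding ps pt q g by (simp add: algebra_simps)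
    moreover have "yy * \<alpha> * q * g' - xx * \<beta> * g * q' + (xx - yy) * (v - xx * yy * u) * q' * g'
      = - yy * \<alpha> * P * g' + xx * \<beta> * P * q' + q' * g' * (xx * yy * (s * xx - t * yy - (xx - yy) * (u + v)))
        + q' * g' * (xx * t - yy * s)"
      unfolding q g \<alpha>_def \<beta>_def by (simp add: algebra_simps power2_eq_square)
    moreover have "xx * t - yy * s = 0" unfolding s_def t_def by (simp add: algebra_simps)
    \<comment> \<open>Here the inverse relation between \<zeta> and \<xi> enters: it turns
      \<open>Z * s\<close> and \<open>Z * t\<close> into \<open>xx\<close> and \<open>yy\<close>.
      This explains the factor \<zeta> at the constant term of \<open>sol_poly\<close>.\<close>
    moreover have "Z * xx * yy * ((s - t) * (u + v) + t * t - s * s)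
      = - (xx * yy * (s * xx - t * yy - (xx - yy) * (u + v)))"
    proof -
      have "Z * xx * yy * ((s - t) * (u + v) + t * t - s * s)
        = (Z * \<Xi>) * xx * yy * ((xx - yy) * (u + v) + \<Xi> * yy * yy - \<Xi> * xx * xx)"
        unfolding s_def t_def by (simp add: algebra_simps)
      then show ?thesis unfolding ZXi s_def t_def by (simp add: algebra_simps)
    qed
    ultimately show ?thesis unfolding m1_def m2_def
      by (simp only: distrib_left[of "Z * xx * yy"] right_diff_distrib[of "Z * xx * yy"]
          mult.left_commute[of "Z * xx * yy" "q' * g'"] mult.left_commute[of "Z * xx * yy" "pu"]
          mult.left_commute[of "Z * xx * yy" P])
        (simp add: algebra_simps)
  qed
  have "refl_poly x y (sol_poly \<zeta> x (\<xi> * x)) (sol_poly \<zeta> y (\<xi> * y))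
    = (v - u) * (\<alpha> * \<beta> * (P * m1 + pu * m2))"
    unfolding refl_poly_eq refl_quot_def F F' main[symmetric]
    by (simp only: const2_simps \<alpha>_def \<beta>_def xx_def yy_def u_def v_def)
  \<comment> \<open>The multiple of \<open>P\<close> enters the ideal generated by p(u) and p(v)
    through the factor v - u split off before, as (v - u) P = p(v) - p(u).\<close>
  also have "\<dots> = ((v - u) * P) * (\<alpha> * \<beta> * m1) + pu * ((v - u) * \<alpha> * \<beta> * m2)"
    by (simp add: algebra_simps)
  also have "(v - u) * P = lift_v p - pu"
    unfolding v_def u_def P_def pu_def by (rule div_diff_eq)
  finally have "refl_poly x y (sol_poly \<zeta> x (\<xi> * x)) (sol_poly \<zeta> y (\<xi> * y))
    = pu * ((v - u) * \<alpha> * \<beta> * m2 - \<alpha> * \<beta> * m1) + lift_v p * (\<alpha> * \<beta> * m1)"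
    by (simp add: algebra_simps)
  then show ?thesis unfolding pu_def by blast
qed

end

section \<open>Moments\<close>

definition mom :: "(nat \<Rightarrow> 'a::comm_ring_1) \<Rightarrow> 'a poly \<Rightarrow> 'a" where
  "mom t f = (\<Sum>i\<le>Polynomial.degree f. Polynomial.coeff f i * t i)"

text \<open>The product functional with value \<open>s i * t j\<close> at \<open>u^i v^j\<close>;
  \<open>s\<close> belongs to the inner variable u.\<close>

definition mom2 :: "(nat \<Rightarrow> 'a::comm_ring_1) \<Rightarrow> (nat \<Rightarrow> 'a) \<Rightarrow> 'a poly poly \<Rightarrow> 'a" where
  "mom2 s t m = (\<Sum>i\<le>Polynomial.degree m. mom s (Polynomial.coeff m i) * t i)"

text \<open>Transpose of multiplication by \<open>u^j\<close>: with moments \<open>shift t j\<close>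
  a polynomial \<open>f\<close> gets the value that \<open>t\<close> gives to \<open>u^j f\<close>.
  Thus products with powers of u need not be reduced modulo \<open>p\<close>.\<close>

definition shift :: "(nat \<Rightarrow> 'a) \<Rightarrow> nat \<Rightarrow> nat \<Rightarrow> 'a" where
  "shift t j i = t (i + j)"

lemma shift_Suc: "(\<lambda>i. shift t j (Suc i)) = shift t (Suc j)"
  by (rule ext) (simp add: shift_def)

lemma shift_shift: "shift (shift t i) j = shift t (i + j)"
  by (rule ext) (simp add: shift_def ac_simps)

lemma Suc_shift: "(\<lambda>i. t (Suc i)) = shift t 1"
  by (rule ext) (simp add: shift_def)

lemma shift_0 [simp]: "shift t 0 = t"
  by (rule ext) (simp add: shift_def)

lemma mom_bound: "Polynomial.degree f \<le> N \<Longrightarrow> mom t f = (\<Sum>i\<le>N. Polynomial.coeff f i * t i)"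
  unfolding mom_def by (rule sum.mono_neutral_left) (auto simp: coeff_eq_0)

lemma mom_0 [simp]: "mom t 0 = 0"
  by (simp add: mom_def)

lemma mom_pCons: "mom t (pCons a f) = a * t 0 + mom (\<lambda>i. t (Suc i)) f"
  using mom_bound[of "pCons a f" "Suc (Polynomial.degree f)" t]
  by (simp add: degree_pCons_le mom_def sum.atMost_Suc_shift del: sum.atMost_Suc)

lemma mom_add: "mom t (f + g) = mom t f + mom t g"
  by (induction f g arbitrary: t rule: poly_induct2) (simp_all add: mom_pCons algebra_simps)

lemma mom_smult: "mom t (smult a f) = a * mom t f"
  by (induction f arbitrary: t) (simp_all add: mom_pCons algebra_simps)

lemma mom_minus: "mom t (- f) = - mom t f"
  using mom_smult[of t "-1" f] by simp

lemma mom_diff: "mom t (f - g) = mom t f - mom t g"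
  using mom_add[of t f "- g"] by (simp add: mom_minus)

lemma mom_1: "mom t 1 = t 0"
  by (simp add: mom_def)

text \<open>Multiplication by \<open>g\<close> transposed to the moments. If the shifted moments of
  \<open>f\<close> are the powers of some r, the sum is g(r); this is the use with
  \<open>quot_at\<close>.\<close>

lemma mom_mult: "Polynomial.degree g \<le> N \<Longrightarrow>
  mom t (f * g) = (\<Sum>k\<le>N. Polynomial.coeff g k * mom (shift t k) f)"
proof (induction g arbitrary: t N)
  case (pCons b g)
  show ?case
  proof (cases "g = 0")
    case True
    have "(\<Sum>k\<le>N. Polynomial.coeff [:b:] k * mom (shift t k) f) = (\<Sum>k\<le>0. Polynomial.coeff [:b:] k * mom (shift t k) f)"
      by (rule sum.mono_neutral_right) (auto simp: coeff_pCons split: nat.splits)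
    with True show ?thesis by (simp add: mom_smult)
  next
    case False
    with pCons.prems obtain N' where N: "N = Suc N'" "Polynomial.degree g \<le> N'"
      by (cases N) auto
    have "mom t (f * pCons b g) = b * mom t f + mom (\<lambda>i. t (Suc i)) (f * g)"
      by (simp add: mult_pCons_right mom_add mom_smult mom_pCons)
    also have "\<dots> = b * mom (shift t 0) f
       + (\<Sum>k\<le>N'. Polynomial.coeff g k * mom (shift t (Suc k)) f)"
      using pCons.IH[OF N(2), of "shift t 1"] by (simp add: Suc_shift shift_shift)
    finally show ?thesis by (simp add: N(1) sum.atMost_Suc_shift del: sum.atMost_Suc)
  qed
qed simp

lemma mom_hom:
  assumes "h 0 = 0" "\<And>a b. h (a + b) = h a + h b" "\<And>a b. h (a * b) = h a * h b"
  shows "mom (\<lambda>i. h (t i)) (map_poly h f) = h (mom t f)"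
  by (induction f arbitrary: t) (simp_all add: mom_pCons map_poly_pCons assms)

lemma mom2_0 [simp]: "mom2 s t 0 = 0"
  by (simp add: mom2_def)

lemma mom2_pCons: "mom2 s t (pCons f m) = mom s f * t 0 + mom2 s (\<lambda>i. t (Suc i)) m"
proof -
  have "mom2 s t (pCons f m)
      = (\<Sum>i\<le>Suc (Polynomial.degree m). mom s (Polynomial.coeff (pCons f m) i) * t i)"
    unfolding mom2_def
    by (rule sum.mono_neutral_left) (auto simp: coeff_eq_0 degree_pCons_le)
  then show ?thesis by (simp add: mom2_def sum.atMost_Suc_shift del: sum.atMost_Suc)
qed

lemma mom2_add: "mom2 s t (m + k) = mom2 s t m + mom2 s t k"
  by (induction m k arbitrary: t rule: poly_induct2) (simp_all add: mom2_pCons mom_add algebra_simps)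

lemma mom2_const: "mom2 s t ([:[:a:]:] * m) = a * mom2 s t m"
  by (induction m arbitrary: t) (simp_all add: mom2_pCons mom_smult algebra_simps)

lemma mom2_minus: "mom2 s t (- m) = - mom2 s t m"
  using mom2_add[of s t m "- m"] by (simp add: eq_neg_iff_add_eq_0 add.commute)

lemma mom2_diff: "mom2 s t (m - k) = mom2 s t m - mom2 s t k"
  using mom2_add[of s t m "- k"] by (simp add: mom2_minus)

lemma mom2_v: "mom2 s t (var_v * m) = mom2 s (\<lambda>i. t (Suc i)) m"
  by (simp add: mom2_pCons)

lemma mom2_u: "mom2 s t (var_u * m) = mom2 (\<lambda>i. s (Suc i)) t m"
proof (induction m arbitrary: t)
  case (pCons f m)
  have "var_u * pCons f m = pCons ([:0, 1:] * f) (var_u * m)" by simp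
  moreover have "mom s ([:0, 1:] * f) = mom (\<lambda>i. s (Suc i)) f" by (simp add: mom_pCons)
  ultimately show ?case using pCons by (simp only: mom2_pCons)
qed simp

lemma mom2_uv: "mom2 s t ([:f:] * lift_v g) = mom s f * mom t g"
  by (induction g arbitrary: t)
    (simp_all add: lift_v_pCons mom2_pCons mom_pCons mom_smult algebra_simps)

lemma mom2_uv': "mom2 s t [:f:] = mom s f * t 0" "mom2 s t (lift_v g) = s 0 * mom t g"
  using mom2_uv[of s t f 1] mom2_uv[of s t 1 g] by (simp_all add: mom_1 mom2_pCons)

text \<open>A factor g(v) only forms linear combinations of the v-coefficients, each of which
  \<open>s\<close> annihilates.\<close>

lemma mom2_lift_eq_0:
  assumes "\<And>b. mom s (Polynomial.coeff m b) = 0"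
  shows "mom2 s t (m * lift_v g) = 0"
proof -
  have "mom s (Polynomial.coeff (m * lift_v g) b) = 0" for b
  proof (induction g arbitrary: b)
    case (pCons a g)
    have "m * lift_v (pCons a g) = [:[:a:]:] * m + pCons 0 (m * lift_v g)"
      by (simp add: lift_v_pCons mult_pCons_right)
    then show ?case using pCons assms
      by (simp add: mom_add mom_smult coeff_pCons split: nat.split)
  qed simp
  then show ?thesis by (simp add: mom2_def)
qed

lemma mom2_eq_0:
  assumes "\<And>b. b \<le> Polynomial.degree m \<Longrightarrow> t b = 0"
  shows "mom2 s t m = 0"
  using assms by (simp add: mom2_def)

lemma degree_lift_v: "Polynomial.degree (lift_v f) \<le> Polynomial.degree f"
  by (rule degree_le) (simp add: lift_v_def coeff_map_poly coeff_eq_0)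

lemma degree_div_diff: "Polynomial.degree (div_diff f) \<le> Polynomial.degree f - 1"
  unfolding div_diff_def degree_synthetic_div using degree_lift_v[of f] by simp

lemma degree_coeff_div_diff: "Polynomial.degree (Polynomial.coeff (div_diff f) b) \<le> Polynomial.degree f - 1"
proof (induction f arbitrary: b)
  case (pCons a f)
  show ?case
  proof (cases "f = 0")
    case False
    have "div_diff (pCons a f) = pCons f (div_diff f)"
      by (simp add: div_diff_pCons)
    moreover have "Polynomial.degree (Polynomial.coeff (div_diff f) (b - 1)) \<le> Polynomial.degree f"
      using pCons.IH[of "b - 1"] by simp
    ultimately show ?thesis using False by (cases b) (simp_all)
  qed (simp add: div_diff_pCons)
qed simp

section \<open>Solutions of the polynomial condition\<close>

lemma lift_v_inj: "lift_v f = lift_v g \<longleftrightarrow> f = g"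
  by (metis poly_lift_v_var)

text \<open>Compare the coefficients of the leading power of v in m(v): the one of \<open>m\<close>
  is a non-zero constant, so the ratio is an element of the ground field.\<close>

lemma separation:
  fixes h m :: "'a::field poly"
  assumes eq: "[:h:] * lift_v m = [:m:] * lift_v h" and m: "m \<noteq> 0"
  shows "\<exists>c. h = smult c m"
proof -
  define k where "k = Polynomial.degree m"
  have k: "Polynomial.coeff m k \<noteq> 0" using m by (simp add: k_def)
  from arg_cong[OF eq, of "\<lambda>r. Polynomial.coeff r k"]
  have "smult (Polynomial.coeff m k) h = smult (Polynomial.coeff h k) m"
    by (simp add: lift_v_def coeff_map_poly)
  then have "smult (inverse (Polynomial.coeff m k)) (smult (Polynomial.coeff m k) h)
    = smult (inverse (Polynomial.coeff m k)) (smult (Polynomial.coeff h k) m)" by simp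
  with k have "h = smult (inverse (Polynomial.coeff m k) * Polynomial.coeff h k) m" by simp
  then show ?thesis by blast
qed

text \<open>The sequence \<open>t\<close> consists of the coefficients of \<open>u\<^sup>n\<close> in the powers of \<open>u\<close>
  reduced modulo \<open>p\<close>.\<close>

locale moment_seq =
  fixes p :: "'a::field poly" and n :: nat and t :: "nat \<Rightarrow> 'a"
  assumes n: "n \<ge> 2" and degree_p: "Polynomial.degree p \<le> Suc n"
    and t_less: "i < n \<Longrightarrow> t i = 0" and t_n: "t n = 1"
    and recur: "mom (shift t j) p = 0"
begin

text \<open>From here on the coefficients are themselves polynomials in the parameter x, and
  \<open>t\<close> is read as constants among them. For \<open>f\<close> over z[x] the value
  \<open>mm j f\<close> is the \<open>a_j(x)\<close> of the overview.\<close>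

definition tc :: "nat \<Rightarrow> 'a poly" where "tc i = [:t i:]"

abbreviation mm :: "nat \<Rightarrow> 'a poly poly \<Rightarrow> 'a poly" where "mm j \<equiv> mom (shift tc j)"

lemma mom_top:
  assumes "Polynomial.degree f \<le> n"
  shows "mm 0 f = Polynomial.coeff f n"
proof -
  have "mm 0 f = (\<Sum>i\<le>n. Polynomial.coeff f i * tc i)" using mom_bound[OF assms] by simp
  also have "\<dots> = (\<Sum>i\<in>{n}. Polynomial.coeff f i * tc i)"
    by (rule sum.mono_neutral_right) (auto simp: tc_def t_less)
  finally show ?thesis by (simp add: tc_def t_n)
qed

lemma mom_p: "mm j (lift_v p) = 0"
proof -
  have "mom (\<lambda>i. [:shift t j i:]) (map_poly (\<lambda>c. [:c:]) p) = [:mom (shift t j) p:]"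
    by (rule mom_hom) simp_all
  then show ?thesis by (simp add: lift_v_def tc_def shift_def[abs_def] recur[unfolded shift_def[abs_def]])
qed

lemma degree_quot: "Polynomial.degree (quot_at (lift_v p) r) \<le> n"
  using degree_p degree_lift_v[of p] by (simp add: quot_at_def degree_synthetic_div)

text \<open>Apply the functional to (u - r) Q = p(r) - p(u); it kills \<open>p\<close>. As
  \<open>t j = 0\<close> for \<open>j < n\<close>, the moments of Q are the powers of r up to index
  n, and p(r) first shows at index n + 1.\<close>

lemma mom_quot_Suc:
  "mm (Suc j) (quot_at (lift_v p) r) = r * mm j (quot_at (lift_v p) r) + poly (lift_v p) r * tc j"
proof -
  let ?q = "quot_at (lift_v p) r"
  have "mm j ([:- r, 1:] * ?q) = mm (Suc j) ?q - r * mm j ?q"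
    by (simp add: mom_add mom_diff mom_smult mom_pCons Suc_shift shift_shift)
  moreover have "mm j ([:- r, 1:] * ?q) = poly (lift_v p) r * tc j"
    unfolding quot_at_eq mom_diff mom_p by (simp add: mom_pCons shift_def)
  ultimately show ?thesis by (simp add: algebra_simps)
qed

lemma mom_quot: "0 < n \<Longrightarrow> j \<le> n \<Longrightarrow> Polynomial.coeff (lift_v p) (Suc n) = - 1 \<Longrightarrow>
  mm j (quot_at (lift_v p) r) = r ^ j"
proof (induction j)
  case 0
  have "Polynomial.coeff (lift_v p) (Suc n) = Polynomial.coeff ([:- r, 1:] * synthetic_div (lift_v p) r) (Suc n)"
    using arg_cong[OF synthetic_div_correct'[of r "lift_v p"], of "\<lambda>f. Polynomial.coeff f (Suc n)"]
    by simp
  also have "\<dots> = Polynomial.coeff (synthetic_div (lift_v p) r) n - r * Polynomial.coeff (synthetic_div (lift_v p) r) (Suc n)"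
    by simp
  also have "Polynomial.coeff (synthetic_div (lift_v p) r) (Suc n) = 0"
    using degree_quot[of r] by (intro coeff_eq_0) (simp add: quot_at_def)
  finally have "Polynomial.coeff (synthetic_div (lift_v p) r) n = - 1"
    using 0 by simp
  then have "Polynomial.coeff (quot_at (lift_v p) r) n = 1"
    by (simp add: quot_at_def)
  then show ?case by (simp add: mom_top[OF degree_quot, simplified])
next
  case (Suc j)
  then show ?case by (simp add: mom_quot_Suc) (simp add: tc_def t_less)
qed

text \<open>The system is triangular: in \<open>mm j f\<close> the coefficient of
  \<open>u^(n-j)\<close> has factor \<open>t n = 1\<close>, lower coefficients have factor 0, and
  higher ones vanish by induction. The constant coefficient would be reached only at
  \<open>j = n\<close>.\<close>

lemma mom_eq_0_imp_const:
  assumes "Polynomial.degree f \<le> n" and mom: "\<And>j. j < n \<Longrightarrow> mm j f = 0"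
  shows "f = [:Polynomial.coeff f 0:]"
proof -
  have "j < n \<Longrightarrow> Polynomial.coeff f (n - j) = 0" for j
  proof (induction j rule: less_induct)
    case (less j)
    have "0 = (\<Sum>i\<le>n. Polynomial.coeff f i * tc (i + j))"
      using mom[OF less.prems] mom_bound[OF assms(1), of "shift tc j"] by (simp add: shift_def)
    also have "\<dots> = (\<Sum>i\<in>{n - j}. Polynomial.coeff f i * tc (i + j))"
    proof (rule sum.mono_neutral_right)
      show "\<forall>i\<in>{..n} - {n - j}. Polynomial.coeff f i * tc (i + j) = 0"
      proof
        fix i assume i: "i \<in> {..n} - {n - j}"
        show "Polynomial.coeff f i * tc (i + j) = 0"
        proof (cases "i < n - j")
          case True
          then have "tc (i + j) = 0" by (simp add: tc_def t_less)
          then show ?thesis by simp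
        next
          case False
          then have "n - i < j" using i less.prems by auto
          then have "Polynomial.coeff f (n - (n - i)) = 0" using less by simp
          then show ?thesis using i by simp
        qed
      qed
    qed auto
    also have "\<dots> = Polynomial.coeff f (n - j)" using less.prems by (simp add: tc_def t_n)
    finally show ?case by simp
  qed
  note * = this
  have "Polynomial.coeff f i = 0" if "0 < i" for i
  proof (cases "i \<le> n")
    case True
    then show ?thesis using *[of "n - i"] that by simp
  qed (use assms(1) in \<open>simp add: coeff_eq_0\<close>)
  then show ?thesis by (intro poly_eqI) (auto simp: coeff_pCons split: nat.split)
qed

text \<open>The same constants over z[x,y], with x the inner and y the outer variable. The two
  further variables on which \<open>mT\<close> acts stand for \<open>K\<close> to the left and to
  the right of \<open>R\<close>.\<close>

definition tcc :: "nat \<Rightarrow> 'a poly poly" where "tcc i = [:[:t i:]:]"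

abbreviation mM :: "nat \<Rightarrow> 'a poly poly poly \<Rightarrow> 'a poly poly" where "mM j \<equiv> mom (shift tcc j)"
abbreviation mT :: "nat \<Rightarrow> nat \<Rightarrow> 'a poly poly poly poly \<Rightarrow> 'a poly poly"
  where "mT j l \<equiv> mom2 (shift tcc j) (shift tcc l)"

text \<open>The polynomial \<open>W\<close> is the quotient of \<open>v f(u) - u f(v)\<close> by \<open>v - u\<close>. Its coefficients of
  powers of either variable have degree below \<open>n\<close>, which gives the boundary values of the moments of
  \<open>W(u, v) g(v)\<close> and \<open>W(u, v) g(u)\<close>.\<close>

context
  fixes f g :: "'a poly poly poly" and x y :: "'a poly poly"
  assumes deg_f: "Polynomial.degree f \<le> n" and deg_g: "Polynomial.degree g \<le> n"
    and refl: "\<And>j l. mT j l (refl_poly x y f g) = 0"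
begin

definition W where "W = [:f:] - var_u * div_diff f"

lemma W_mult: "(var_v - var_u) * W = var_v * [:f:] - var_u * lift_v f"
proof -
  have "(v - u) * (a - u * d) = v * a - u * b" if "(v - u) * d = b - a"
    for u v a b d :: "'a poly poly poly poly"
  proof -
    have "(v - u) * (a - u * d) = (v - u) * a - u * ((v - u) * d)" by (simp add: algebra_simps)
    also have "\<dots> = v * a - u * b" unfolding that by (simp add: algebra_simps)
    finally show ?thesis .
  qed
  from this[OF div_diff_eq] show ?thesis by (simp only: W_def)
qed

text \<open>For \<open>f = a + u h\<close> the terms \<open>u h(u)\<close> cancel. What is left has
  degree below \<open>n\<close> in either variable, because the divided difference of
  \<open>h\<close> has degree at most \<open>n - 2\<close> in each.\<close>

lemma W_decomp: "\<exists>a h. W = [:[:a:]:] - var_u * (var_v * div_diff h) \<and> Polynomial.degree h - 1 \<le> n - 2"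
proof (cases f)
  case (pCons a h)
  have "W = [:[:a:]:] - var_u * (var_v * div_diff h)"
    unfolding W_def unfolding pCons div_diff_pCons distrib_left by simp
  moreover have "Polynomial.degree h - 1 \<le> n - 2"
    using deg_f by (cases "h = 0") (simp_all add: pCons)
  ultimately show ?thesis by blast
qed

lemma tcc_0: "i < n \<Longrightarrow> tcc i = 0"
  by (simp add: tcc_def t_less)

lemma tcc_n: "tcc n = 1"
  by (simp add: tcc_def t_n pCons_one)

lemma n_pos: "0 < n" "1 < n" using n by auto

lemma mT_v: "mT j l (var_v * m) = mT j (Suc l) m"
  by (simp only: mom2_v shift_Suc)

lemma mT_u: "mT j l (var_u * m) = mT (Suc j) l m"
  by (simp only: mom2_u shift_Suc)

text \<open>(v f(u) - u f(v)) times the divided difference of \<open>g\<close> equals W (g(v) -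
  g(u)), so the first term of \<open>refl_poly\<close> contributes a multiple of
  \<open>Mv - Mu\<close>.\<close>

definition Mv where "Mv j l = mT j l (W * lift_v g)"
definition Mu where "Mu j l = mT j l (W * [:g:])"

lemma Mv_0: "Mv 0 l = 0"
proof -
  obtain a h where W: "W = [:[:a:]:] - var_u * (var_v * div_diff h)" and h: "Polynomial.degree h - 1 \<le> n - 2"
    using W_decomp by blast
  have "mT 0 l ([:[:a:]:] * lift_v g) = 0"
    using mom2_uv[of "shift tcc 0" "shift tcc l" "[:a:]" g] n_pos by (simp add: mom_pCons tcc_0)
  moreover have "mT (Suc 0) (Suc l) (div_diff h * lift_v g) = 0"
  proof (rule mom2_lift_eq_0)
    fix b
    have "Polynomial.degree (Polynomial.coeff (div_diff h) b) \<le> n - 2"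
      using degree_coeff_div_diff[of h b] h by simp
    then show "mM (Suc 0) (Polynomial.coeff (div_diff h) b) = 0"
      using n by (simp add: mom_bound[of _ "n - 2"] shift_def tcc_0)
  qed
  moreover have "W * lift_v g = [:[:a:]:] * lift_v g - var_u * (var_v * (div_diff h * lift_v g))"
    unfolding W by (simp only: left_diff_distrib mult.assoc)
  ultimately show ?thesis by (simp only: Mv_def mom2_diff mT_u mT_v diff_self)
qed

lemma Mu_0: "Mu j 0 = 0"
proof -
  obtain a h where W: "W = [:[:a:]:] - var_u * (var_v * div_diff h)" and h: "Polynomial.degree h - 1 \<le> n - 2"
    using W_decomp by blast
  have "mT j 0 ([:[:a:]:] * [:g:]) = 0"
    using mom2_uv'(1)[of "shift tcc j" "shift tcc 0" "[:a:] * g"] n_pos by (simp add: tcc_0)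
  moreover have "mT (Suc j) (Suc 0) ([:g:] * div_diff h) = 0"
  proof (rule mom2_eq_0)
    fix b assume "b \<le> Polynomial.degree ([:g:] * div_diff h)"
    then have "b \<le> n - 2"
      using degree_div_diff[of h] h degree_mult_le[of "[:g:]" "div_diff h"] by simp
    then show "shift tcc (Suc 0) b = 0" using n by (simp add: shift_def tcc_0)
  qed
  moreover have "W * [:g:] = [:[:a:]:] * [:g:] - var_u * (var_v * ([:g:] * div_diff h))"
    unfolding W by (simp only: left_diff_distrib mult.assoc mult.commute[of "div_diff h" "[:g:]"])
  ultimately show ?thesis by (simp only: Mu_def mom2_diff mT_u mT_v diff_self)
qed

text \<open>Under the functionals a factor v raises the second index and a factor u the first. Hence
  (v - u) W = v f(u) - u f(v) is a recurrence along the antidiagonals.\<close>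

lemma Mv_step: "Mv j (Suc l) = Mv (Suc j) l + mM j f * mM (Suc l) g - tcc (Suc j) * mM l (f * g)"
proof -
  have "mT j l ((var_v - var_u) * W * lift_v g) = Mv j (Suc l) - Mv (Suc j) l"
    unfolding Mv_def by (simp only: left_diff_distrib mom2_diff mult.assoc mT_u mT_v)
  moreover have "(var_v - var_u) * W * lift_v g = var_v * ([:f:] * lift_v g) - var_u * lift_v (f * g)"
    unfolding W_mult by (simp only: left_diff_distrib mult.assoc lift_v_mult)
  moreover have "mT j l (var_v * ([:f:] * lift_v g)) = mM j f * mM (Suc l) g"
    by (simp only: mT_v mom2_uv)
  moreover have "mT j l (var_u * lift_v (f * g)) = tcc (Suc j) * mM l (f * g)"
    unfolding mT_u by (simp only: mom2_uv') (simp add: shift_def)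
  ultimately have "Mv j (Suc l) - Mv (Suc j) l = mM j f * mM (Suc l) g - tcc (Suc j) * mM l (f * g)"
    by (simp only: mom2_diff)
  then show ?thesis by (simp add: algebra_simps)
qed

lemma Mu_step: "Mu j (Suc l) = Mu (Suc j) l + mM j (f * g) * tcc (Suc l) - mM (Suc j) g * mM l f"
proof -
  have "mT j l ((var_v - var_u) * W * [:g:]) = Mu j (Suc l) - Mu (Suc j) l"
    unfolding Mu_def by (simp only: left_diff_distrib mom2_diff mult.assoc mT_u mT_v)
  moreover have "(var_v - var_u) * W * [:g:] = var_v * [:f * g:] - var_u * ([:g:] * lift_v f)"
  proof -
    have "[:f:] * [:g:] = [:f * g:]" by simp
    then show ?thesis
      unfolding W_mult by (simp only: left_diff_distrib mult.assoc mult.commute[of "lift_v f"])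
  qed
  moreover have "mT j l (var_v * [:f * g:]) = mM j (f * g) * tcc (Suc l)"
    unfolding mT_v by (simp only: mom2_uv') (simp add: shift_def)
  moreover have "mT j l (var_u * ([:g:] * lift_v f)) = mM (Suc j) g * mM l f"
    unfolding mT_u by (simp only: mom2_uv)
  ultimately have "Mu j (Suc l) - Mu (Suc j) l = mM j (f * g) * tcc (Suc l) - mM (Suc j) g * mM l f"
    by (simp only: mom2_diff)
  then show ?thesis by (simp add: algebra_simps)
qed

lemma Mv_1: "Mv (Suc 0) l = - mM 0 f * mM (Suc l) g"
  using Mv_step[of 0 l] n_pos by (simp add: Mv_0 tcc_0 eq_neg_iff_add_eq_0)

text \<open>The recurrence solved from the boundary value 0 at \<open>l = 0\<close>. The moment of
  \<open>f * g\<close> carries the factor \<open>t l\<close> and so appears only at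
  \<open>l = n\<close>.\<close>

lemma Mu_sum: "l \<le> n \<Longrightarrow>
  Mu j l = (if l = n then mM j (f * g) else 0) - (\<Sum>r<l. mM r f * mM (j + l - r) g)"
proof (induction l arbitrary: j)
  case 0
  then show ?case using n_pos by (simp add: Mu_0)
next
  case (Suc l)
  have "tcc (Suc l) = (if Suc l = n then 1 else 0)"
    using Suc.prems by (auto simp: tcc_0 tcc_n)
  then show ?case using Suc by (simp add: Mu_step)
qed

lemma moment_eq:
  "(x - y) * (x * y - 1) * (Mv j l - Mu j l) + (x - y) * (tcc j * mM l (f * g) - mM j (f * g) * tcc l)
    + y * (x * y - 1) * (mM j f * mM l g - mM j g * mM l f) = 0"
proof -
  have "(var_v * [:f:] - var_u * lift_v f) * div_diff g = W * ((var_v - var_u) * div_diff g)"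
    unfolding W_mult[symmetric] by (simp only: ac_simps)
  also have "\<dots> = W * lift_v g - W * [:g:]"
    unfolding div_diff_eq by (simp only: right_diff_distrib)
  finally have "refl_poly x y f g = [:[:(x - y) * (x * y - 1):]:] * (W * lift_v g - W * [:g:])
      + [:[:x - y:]:] * (lift_v (f * g) - [:f * g:])
      + [:[:y * (x * y - 1):]:] * ([:f:] * lift_v g - [:g:] * lift_v f)"
    unfolding refl_poly_def by (simp only:)
  then have "0 = mT j l ([:[:(x - y) * (x * y - 1):]:] * (W * lift_v g - W * [:g:])
      + [:[:x - y:]:] * (lift_v (f * g) - [:f * g:])
      + [:[:y * (x * y - 1):]:] * ([:f:] * lift_v g - [:g:] * lift_v f))"
    using refl[of j l] by simp
  then show ?thesis
    by (simp only: mom2_add mom2_const mom2_diff mom2_uv mom2_uv' Mv_def Mu_def) (simp add: shift_def)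
qed

text \<open>In rows 0 and 1 the values of \<open>Mv\<close> are explicit, being on the boundary or
  one step away from it, and \<open>t 0 = t 1 = 0\<close> removes the term with f(v) g(v). These two
  rows determine \<open>f\<close>.\<close>

lemma row_0:
  assumes "l \<le> n"
  shows "(x - y) * (x * y - 1) * (\<Sum>r<l. mM r f * mM (l - r) g)
    - (if l = n then (x - y) * (x * y) * mM 0 (f * g) else 0)
    + y * (x * y - 1) * (mM 0 f * mM l g - mM 0 g * mM l f) = 0"
  using moment_eq[of 0 l] assms n_pos
  by (cases "l = n") (simp_all add: Mv_0 Mu_sum tcc_0 tcc_n algebra_simps)

lemma row_1:
  assumes "l \<le> n"
  shows "(x - y) * (x * y - 1) * ((\<Sum>r<l. mM r f * mM (Suc l - r) g) - mM 0 f * mM (Suc l) g)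
    - (if l = n then (x - y) * (x * y) * mM 1 (f * g) else 0)
    + y * (x * y - 1) * (mM 1 f * mM l g - mM 1 g * mM l f) = 0"
  using moment_eq[of "Suc 0" l] assms n_pos
  by (cases "l = n") (simp_all add: Mv_1 Mu_sum tcc_0 tcc_n algebra_simps)

end

section \<open>Recovering a principal solution from its moments\<close>

lemma moments_determine:
  fixes f :: "'a poly poly"
  assumes deg: "Polynomial.degree f \<le> n" and lead: "Polynomial.coeff p (Suc n) = - 1"
    and refl: "\<And>j l. mT j l (refl_poly var_u var_v (lift_v f) (map_poly lift_v f)) = 0"
    and principal: "mm 1 f \<noteq> 0"
  obtains \<xi> where "\<xi> \<noteq> 0" "Polynomial.coeff f n \<noteq> 0"
    "smult ([:0, 1:]\<^sup>2 - 1) f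
      = smult (Polynomial.coeff f n) (sol_poly (lift_v p) [:inverse \<xi>:] [:0, 1:] ([:\<xi>:] * [:0, 1:]))"
proof -
  \<comment> \<open>At the level of coefficients \<open>var_u\<close> and \<open>var_v\<close> are
    the spectral parameters x and y; \<open>\<alpha> j\<close> and \<open>\<beta> j\<close> below
    are \<open>a j\<close> with parameter x and y.\<close>
  define x y where "x = (var_u :: 'a poly poly)" and "y = (var_v :: 'a poly poly)"
  define fx fy where "fx = lift_v f" and "fy = map_poly lift_v f"
  define a where "a j = mm j f" for j
  define \<alpha> \<beta> where "\<alpha> j = [:a j:]" and "\<beta> j = lift_v (a j)" for j
  have deg_x: "Polynomial.degree fx \<le> n" using degree_lift_v[of f] deg by (simp add: fx_def)
  have deg_y: "Polynomial.degree fy \<le> n"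
    unfolding fy_def using deg by (intro degree_le) (simp add: coeff_map_poly coeff_eq_0)
  have refl': "mT j l (refl_poly x y fx fy) = 0" for j l
    using refl by (simp add: x_def y_def fx_def fy_def)
  have mx: "mM j fx = \<alpha> j" for j
  proof -
    have "mom (\<lambda>i. [:shift tc j i:]) (map_poly (\<lambda>c. [:c:]) f) = [:mm j f:]"
      by (rule mom_hom) simp_all
    then show ?thesis
      by (simp add: fx_def lift_v_def \<alpha>_def a_def tcc_def tc_def shift_def[abs_def])
  qed
  have my: "mM j fy = \<beta> j" for j
  proof -
    have "mom (\<lambda>i. lift_v (shift tc j i)) (map_poly lift_v f) = lift_v (mm j f)"
      by (rule mom_hom) (simp_all add: lift_v_add lift_v_mult)
    then show ?thesis
      by (simp add: fy_def \<beta>_def a_def tcc_def tc_def shift_def[abs_def] lift_v_const)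
  qed
  note row0 = row_0[OF deg_x deg_y refl', unfolded mx my]
  note row1 = row_1[OF deg_x deg_y refl', unfolded mx my]
  have xy: "x - y \<noteq> 0" "x * y - 1 \<noteq> 0" "y \<noteq> 0" "x \<noteq> 0"
    by (simp_all add: x_def y_def one_pCons)
  have inj: "\<alpha> j = 0 \<longleftrightarrow> a j = 0" "\<beta> j = 0 \<longleftrightarrow> a j = 0" for j
    using lift_v_inj[of "a j" 0] by (simp_all add: \<alpha>_def \<beta>_def)
  have a1: "a 1 \<noteq> 0" using principal by (simp add: a_def)
  have a0: "a 0 = Polynomial.coeff f n" unfolding a_def by (rule mom_top[OF deg])
  have n1: "1 < n" "0 < n" using n by auto

  \<comment> \<open>If \<open>a 0\<close> vanished, row 0 at \<open>l = 2\<close> would leave only a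
    multiple of \<open>\<alpha> 1 * \<beta> 1\<close>. For \<open>n = 2\<close> the moment of the
    product also equals \<open>\<alpha> 1 * \<beta> 1\<close>, which changes the factor
    \<open>x * y - 1\<close> to -1 but not the conclusion.\<close>
  have a0_nz: "a 0 \<noteq> 0"
  proof
    assume "a 0 = 0"
    then have z: "\<alpha> 0 = 0" "\<beta> 0 = 0" using inj by simp_all
    have s: "(\<Sum>r<2. \<alpha> r * \<beta> (2 - r)) = \<alpha> 1 * \<beta> 1"
      by (simp add: z numeral_2_eq_2)
    have nz: "\<alpha> 1 * \<beta> 1 \<noteq> 0" using a1 inj by simp
    show False
    proof (cases "n = 2")
      case False
      then show False using row0[of 2] n z s nz xy by simp
    next
      case True
      have "mM 0 (fx * fy) = (\<Sum>k\<le>n. Polynomial.coeff fy k * mM k fx)"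
        using mom_mult[OF deg_y, of tcc fx] by simp
      also have "\<dots> = Polynomial.coeff fy 1 * \<alpha> 1 + Polynomial.coeff fy 2 * \<alpha> 2"
        unfolding mx by (simp add: True numeral_2_eq_2 z)
      also have fy2: "Polynomial.coeff fy 2 = 0"
        using z(2) True a0 by (simp add: fy_def coeff_map_poly \<open>a 0 = 0\<close>)
      also have "Polynomial.coeff fy 1 = \<beta> 1"
      proof -
        have "\<beta> 1 = (\<Sum>i\<le>2. Polynomial.coeff fy i * tcc (i + 1))"
          using mom_bound[of fy 2 "shift tcc 1"] deg_y True my[of 1] by (simp add: shift_def)
        also have "\<dots> = Polynomial.coeff fy 1"
          using fy2 tcc_0[OF deg_x deg_y refl'] tcc_n[OF deg_x deg_y refl'] True
          by (simp add: numeral_2_eq_2)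
        finally show ?thesis by simp
      qed
      finally have mu: "mM 0 (fx * fy) = \<alpha> 1 * \<beta> 1" by (simp add: mult.commute)
      have "(x - y) * (x * y - 1) * (\<alpha> 1 * \<beta> 1) - (x - y) * (x * y) * (\<alpha> 1 * \<beta> 1) = 0"
        using row0[of 2] True z s mu by auto
      then have "(x - y) * (\<alpha> 1 * \<beta> 1) = 0" by (auto simp: algebra_simps)
      then show False using xy nz by simp
    qed
  qed

  have "(x - y) * (x * y - 1) * (\<alpha> 0 * \<beta> 1) + y * (x * y - 1) * (\<alpha> 0 * \<beta> 1 - \<beta> 0 * \<alpha> 1) = 0"
    using row0[of 1] n1 by simp
  then have "(x * y - 1) * (x * (\<alpha> 0 * \<beta> 1) - y * (\<beta> 0 * \<alpha> 1)) = 0"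
    by (simp add: algebra_simps)
  then have sep: "x * (\<alpha> 0 * \<beta> 1) = y * (\<beta> 0 * \<alpha> 1)" using xy by simp
  have "[:a 1:] * lift_v ([:0, 1:] * a 0) = [:[:0, 1:] * a 0:] * lift_v (a 1)"
  proof -
    have "lift_v ([:0, 1:] * a 0) = y * \<beta> 0"
      unfolding lift_v_mult by (simp add: y_def \<beta>_def lift_v_pCons pCons_one)
    moreover have "[:[:0, 1:] * a 0:] = x * \<alpha> 0" by (simp add: x_def \<alpha>_def)
    ultimately show ?thesis using sep by (simp only: \<alpha>_def[symmetric] \<beta>_def[symmetric] ac_simps)
  qed
  moreover have "[:0, 1:] * a 0 \<noteq> 0" using a0_nz by simp
  ultimately obtain \<xi> where "a 1 = smult \<xi> ([:0, 1:] * a 0)" using separation by blast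
  then have \<xi>: "a 1 = ([:\<xi>:] * [:0, 1:]) * a 0" by simp
  then have \<xi>_nz: "\<xi> \<noteq> 0" using a1 by auto
  define s where "s = [:\<xi>:] * [:0, 1:]"
  define \<Xi> where "\<Xi> = [:[:\<xi>:]:]"
  have \<Xi>: "\<Xi> \<noteq> 0" using \<xi>_nz by (simp add: \<Xi>_def)
  define \<sigma> \<rho> where "\<sigma> = [:s:]" and "\<rho> = lift_v s"
  have \<sigma>: "\<sigma> = \<Xi> * x" and \<rho>: "\<rho> = \<Xi> * y"
    by (simp_all add: \<sigma>_def \<rho>_def s_def \<Xi>_def x_def y_def lift_v_pCons)
  have \<alpha>1: "\<alpha> 1 = \<sigma> * \<alpha> 0" and \<beta>1: "\<beta> 1 = \<rho> * \<beta> 0"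
    using \<xi> by (simp_all add: \<alpha>_def \<beta>_def \<sigma>_def \<rho>_def s_def lift_v_mult[symmetric])
  have \<beta>0: "\<beta> 0 \<noteq> 0" using a0_nz inj by simp

  \<comment> \<open>\<sigma> times row 0 minus row 1: with the lower moments known, the two sums
    telescope and \<open>\<alpha> l\<close> is the only unknown. For \<open>l < n\<close> this
    yields the powers of \<sigma>, for \<open>l = n\<close> the constant term of
    \<open>f\<close>.\<close>
  have elim: "(x - y) * (x * y - 1) * (\<sigma> ^ l * \<alpha> 0 * (\<rho> * \<beta> 0))
      - (if l = n then (x - y) * (x * y) * (\<sigma> * mM 0 (fx * fy) - mM 1 (fx * fy)) else 0)
      - y * (x * y - 1) * (\<alpha> l * (\<sigma> - \<rho>) * \<beta> 0) = 0"
    if l: "l \<le> n" and pow: "\<And>r. r < l \<Longrightarrow> \<alpha> r = \<sigma> ^ r * \<alpha> 0" for l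
  proof -
    define S0 S1 where "S0 = (\<Sum>r<l. \<alpha> r * \<beta> (l - r))" and "S1 = (\<Sum>r<l. \<alpha> r * \<beta> (Suc l - r))"
    define c where "c r = \<sigma> ^ r * \<alpha> 0 * \<beta> (Suc l - r)" for r
    have "\<sigma> * S0 = (\<Sum>r<l. c (Suc r))"
      unfolding S0_def sum_distrib_left by (rule sum.cong[OF HOL.refl], subst pow) (simp_all add: c_def)
    moreover have "S1 = (\<Sum>r<l. c r)"
      unfolding S1_def by (rule sum.cong[OF HOL.refl], subst pow) (simp_all add: c_def)
    moreover have "c 0 + (\<Sum>r<l. c (Suc r)) = (\<Sum>r<l. c r) + c l"
      using sum.lessThan_Suc_shift[of c l] sum.lessThan_Suc[of c l] by simp
    ultimately have tele: "\<sigma> * S0 - (S1 - \<alpha> 0 * \<beta> (Suc l)) = \<sigma> ^ l * \<alpha> 0 * (\<rho> * \<beta> 0)"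
      by (simp add: c_def \<beta>1[simplified] algebra_simps)
    have comb: "A * (S * k0 - k1) - (S * e0 - e1) + B * (S * d0 - d1) = 0"
      if "A * k0 - e0 + B * d0 = 0" "A * k1 - e1 + B * d1 = 0"
      for A B S k0 k1 e0 e1 d0 d1 :: "'a poly poly"
    proof -
      have "A * (S * k0 - k1) - (S * e0 - e1) + B * (S * d0 - d1)
        = S * (A * k0 - e0 + B * d0) - (A * k1 - e1 + B * d1)" by (simp add: algebra_simps)
      then show ?thesis by (simp only: that) simp
    qed
    from comb[OF row0[OF l] row1[OF l], of \<sigma>]
    have "(x - y) * (x * y - 1) * (\<sigma> * S0 - (S1 - \<alpha> 0 * \<beta> (Suc l)))
      - (\<sigma> * (if l = n then (x - y) * (x * y) * mM 0 (fx * fy) else 0)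
        - (if l = n then (x - y) * (x * y) * mM 1 (fx * fy) else 0))
      + y * (x * y - 1) * (\<sigma> * (\<alpha> 0 * \<beta> l - \<beta> 0 * \<alpha> l) - (\<alpha> 1 * \<beta> l - \<beta> 1 * \<alpha> l)) = 0"
      unfolding S0_def S1_def .
    moreover have "\<sigma> * (\<alpha> 0 * \<beta> l - \<beta> 0 * \<alpha> l) - (\<alpha> 1 * \<beta> l - \<beta> 1 * \<alpha> l)
        = - (\<alpha> l * (\<sigma> - \<rho>) * \<beta> 0)"
      unfolding \<alpha>1 \<beta>1 by (simp add: algebra_simps)
    moreover have "\<sigma> * (if l = n then c * m0 else 0) - (if l = n then c * m1 else 0)
        = (if l = n then c * (\<sigma> * m0 - m1) else 0)" for c m0 m1
      by (simp add: right_diff_distrib mult.left_commute)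
    ultimately show ?thesis unfolding tele by simp
  qed

  have pow: "l < n \<Longrightarrow> \<alpha> l = \<sigma> ^ l * \<alpha> 0" for l
  proof (induction l rule: less_induct)
    case (less l)
    have "(x - y) * (x * y - 1) * (\<sigma> ^ l * \<alpha> 0 * (\<rho> * \<beta> 0)) - y * (x * y - 1) * (\<alpha> l * (\<sigma> - \<rho>) * \<beta> 0) = 0"
    proof -
      have "\<alpha> r = \<sigma> ^ r * \<alpha> 0" if "r < l" for r
        using less that by (meson less_trans)
      from elim[OF less_imp_le[OF less.prems] this] show ?thesis using less.prems by simp
    qed
    \<comment> \<open>\<open>\<sigma> - \<rho> = \<Xi> * (x - y)\<close> and
      \<open>\<rho> = \<Xi> * y\<close>, so both terms share the bracketed factor.\<close>
    then have "((x - y) * (x * y - 1) * y * \<Xi> * \<beta> 0) * (\<sigma> ^ l * \<alpha> 0 - \<alpha> l) = 0"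
      unfolding \<rho> \<sigma> by (simp add: algebra_simps)
    then show ?case using xy \<Xi> \<beta>0 by simp
  qed
  have pow_a: "a l = s ^ l * a 0" if "l < n" for l
  proof -
    have "[:s:] ^ l = [:s ^ l:]" by (simp add: poly_const_pow)
    then show ?thesis using pow[OF that] by (simp add: \<alpha>_def \<sigma>_def)
  qed

  define Q where "Q = quot_at (lift_v p) s"
  have lead': "Polynomial.coeff (lift_v p) (Suc n) = - 1"
    using lead by (simp add: lift_v_def coeff_map_poly one_pCons)
  have Q: "mm j Q = s ^ j" if "j \<le> n" for j
    unfolding Q_def by (rule mom_quot) (use that n1 lead' in auto)
  have deg_Q: "Polynomial.degree Q \<le> n" unfolding Q_def by (rule degree_quot)
  define d where "d = Polynomial.coeff (f - smult (a 0) Q) 0"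
  have "f - smult (a 0) Q = [:d:]"
    unfolding d_def
  proof (rule mom_eq_0_imp_const)
    show "Polynomial.degree (f - smult (a 0) Q) \<le> n"
      using deg deg_Q by (intro degree_diff_le order_trans[OF degree_smult_le])
    show "mm j (f - smult (a 0) Q) = 0" if "j < n" for j
      using pow_a[OF that] that by (simp add: mom_diff mom_smult Q a_def)
  qed
  then have f_eq: "f = smult (a 0) Q + [:d:]" by (simp add: algebra_simps)

  define \<delta> ps where "\<delta> = [:d:]" and "ps = poly (lift_v p) s"
  \<comment> \<open>Index \<open>n\<close> is the first at which the constant \<open>d\<close> is
    seen, since \<open>t n = 1\<close> and all earlier entries are 0.\<close>
  have an: "\<alpha> n = \<sigma> ^ n * \<alpha> 0 + \<delta>"
  proof -
    have "a n = a 0 * s ^ n + d"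
      unfolding a_def[of n] using Q[of n]
      by (subst f_eq) (simp add: mom_add mom_smult mom_pCons shift_def tc_def t_n)
    moreover have "[:s:] ^ n = [:s ^ n:]" by (simp add: poly_const_pow)
    ultimately show ?thesis by (simp add: \<alpha>_def \<sigma>_def \<delta>_def)
  qed
  have mQ: "mM j (lift_v Q) = [:mm j Q:]" for j
  proof -
    have "mom (\<lambda>i. [:shift tc j i:]) (map_poly (\<lambda>c. [:c:]) Q) = [:mm j Q:]"
      by (rule mom_hom) simp_all
    then show ?thesis
      by (simp add: lift_v_def tcc_def tc_def shift_def[abs_def])
  qed
  have fx_eq: "fx = smult (\<alpha> 0) (lift_v Q) + [:\<delta>:]"
    unfolding fx_def f_eq lift_v_add lift_v_smult lift_v_const by (simp add: \<alpha>_def \<delta>_def)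
  define \<gamma> where "\<gamma> = poly fy \<sigma>"
  have \<gamma>: "\<gamma> = (\<Sum>k\<le>n. Polynomial.coeff fy k * \<sigma> ^ k)"
    unfolding \<gamma>_def poly_altdef using deg_y
    by (intro sum.mono_neutral_left) (auto simp: coeff_eq_0)
  have sk: "[:s ^ k:] = \<sigma> ^ k" for k by (simp add: \<sigma>_def poly_const_pow)
  \<comment> \<open>The moments of \<open>Q\<close> are powers of \<sigma>, so pairing with
    \<open>Q\<close> evaluates \<open>fy\<close> at \<sigma>. Only the combination \<sigma> times
    moment 0 minus moment 1 is used, and there the value \<gamma> cancels.\<close>
  have Q0: "mM 0 (lift_v Q * fy) = \<gamma>"
    using mom_mult[OF deg_y, of tcc "lift_v Q"] by (simp add: mQ Q sk \<gamma>)
  have Q1: "mM 1 (lift_v Q * fy) = \<sigma> * \<gamma> + [:ps:] * \<beta> 0"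
  proof -
    have step: "mM (Suc k) (lift_v Q) = \<sigma> * \<sigma> ^ k + [:ps:] * tcc k" if "k \<le> n" for k
    proof -
      have "mm (Suc k) Q = s * s ^ k + ps * tc k"
        using Q[OF that] unfolding Q_def mom_quot_Suc by (simp add: ps_def)
      then show ?thesis unfolding mQ sk[symmetric] by (simp add: \<sigma>_def tcc_def tc_def)
    qed
    have "mM 1 (lift_v Q * fy) = (\<Sum>k\<le>n. Polynomial.coeff fy k * mM (Suc k) (lift_v Q))"
      using mom_mult[OF deg_y, of "shift tcc 1" "lift_v Q"] by (simp add: shift_shift)
    also have "\<dots> = (\<Sum>k\<le>n. \<sigma> * (Polynomial.coeff fy k * \<sigma> ^ k) + [:ps:] * (Polynomial.coeff fy k * tcc k))"
      by (rule sum.cong) (simp_all only: atMost_iff step distrib_left ac_simps)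
    also have "\<dots> = \<sigma> * \<gamma> + [:ps:] * mM 0 fy"
      using mom_bound[OF deg_y, of tcc] by (simp only: sum.distrib sum_distrib_left[symmetric] \<gamma> shift_0)
    finally show ?thesis unfolding my .
  qed
  have "\<sigma> * mM 0 (fx * fy) - mM 1 (fx * fy) = \<delta> * (\<sigma> - \<rho>) * \<beta> 0 - \<alpha> 0 * [:ps:] * \<beta> 0"
  proof -
    have "mM j (fx * fy) = \<alpha> 0 * mM j (lift_v Q * fy) + \<delta> * \<beta> j" for j
      unfolding fx_eq my[symmetric]
      by (simp only: distrib_right mult_smult_left mom_add mom_smult mult_pCons_left mult_zero_left)
        (simp add: mom_smult)
    note m = this
    have m0: "mM 0 (fx * fy) = \<alpha> 0 * \<gamma> + \<delta> * \<beta> 0" using m[of 0] by (simp only: Q0)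
    have m1: "mM 1 (fx * fy) = \<alpha> 0 * (\<sigma> * \<gamma> + [:ps:] * \<beta> 0) + \<delta> * \<beta> 1"
      using m[of 1] by (simp only: Q1)
    show ?thesis unfolding m0 m1 \<beta>1 by (simp add: algebra_simps del: mult_pCons_left mult_pCons_right)
  qed
  then have "(x - y) * (x * y - 1) * (\<sigma> ^ n * \<alpha> 0 * (\<rho> * \<beta> 0))
      - (x - y) * (x * y) * (\<delta> * (\<sigma> - \<rho>) * \<beta> 0 - \<alpha> 0 * [:ps:] * \<beta> 0)
      - y * (x * y - 1) * ((\<sigma> ^ n * \<alpha> 0 + \<delta>) * (\<sigma> - \<rho>) * \<beta> 0) = 0"
    using elim[OF order_refl pow] by (simp add: an)
  \<comment> \<open>The powers of \<sigma> cancel, and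
    \<open>x * (x - y) + (x * y - 1) = x^2 - 1\<close> is the origin of the denominator in
    \<open>K_sol\<close>. All dependence on y sits in the factor that is divided out.\<close>
  then have "((x - y) * y * \<beta> 0) * (\<Xi> * (x\<^sup>2 - 1) * \<delta> - x * [:ps:] * \<alpha> 0) = 0"
    unfolding \<rho> \<sigma> by (simp add: algebra_simps power2_eq_square)
  then have "\<Xi> * (x\<^sup>2 - 1) * \<delta> = x * [:ps:] * \<alpha> 0" using xy \<beta>0 by simp
  then have "[:[:\<xi>:] * ([:0, 1:]\<^sup>2 - 1) * d:] = [:[:0, 1:] * ps * a 0:]"
    by (simp add: \<Xi>_def x_def \<delta>_def \<alpha>_def poly_const_pow one_pCons power2_eq_square)
  then have key: "[:\<xi>:] * ([:0, 1:]\<^sup>2 - 1) * d = [:0, 1:] * ps * a 0" by (simp only: pCons_eq_iff)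
  have inv: "[:inverse \<xi>:] * [:\<xi>:] = 1" using \<xi>_nz by (simp add: pCons_one)
  have key': "([:0, 1:]\<^sup>2 - 1) * d = a 0 * ([:inverse \<xi>:] * [:0, 1:] * ps)"
  proof -
    have "([:0, 1:]\<^sup>2 - 1) * d = ([:inverse \<xi>:] * [:\<xi>:]) * (([:0, 1:]\<^sup>2 - 1) * d)" unfolding inv by simp
    also have "\<dots> = [:inverse \<xi>:] * ([:\<xi>:] * ([:0, 1:]\<^sup>2 - 1) * d)" by (simp only: mult.assoc)
    finally show ?thesis unfolding key by (simp only: ac_simps)
  qed
  have "smult ([:0, 1:]\<^sup>2 - 1) f = smult (a 0) (sol_poly (lift_v p) [:inverse \<xi>:] [:0, 1:] s)"
    unfolding sol_poly_def
    by (subst f_eq) (simp only: smult_add_right smult_smult Q_def[symmetric] ps_def[symmetric]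
        mult.commute[of "a 0"] key' mult_pCons_right smult_pCons smult_0_right mult_zero_right)
  then show thesis using that[OF \<xi>_nz] a0_nz a0 s_def by simp
qed

end

text \<open>Over a field, \<tau> reads off the coefficient of \<open>u^n\<close> in the remainder
  modulo \<open>p\<close>. It is linear and kills every multiple of \<open>p\<close>, which is the
  recurrence.\<close>

lemma exists_moment_seq:
  fixes p :: "'a::field poly"
  assumes n: "n \<ge> 2" and deg: "Polynomial.degree p = Suc n"
  shows "\<exists>t. moment_seq p n t"
proof -
  define \<tau> where "\<tau> f = Polynomial.coeff (f mod p) n" for f
  define t where "t i = \<tau> (Polynomial.monom 1 i)" for i
  have add: "\<tau> (f + g) = \<tau> f + \<tau> g" for f g by (simp add: \<tau>_def poly_mod_add_left)
  have smult: "\<tau> (smult c f) = c * \<tau> f" for c f by (simp add: \<tau>_def mod_smult_left)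
  have mom: "mom (shift t j) f = \<tau> (Polynomial.monom 1 j * f)" for f j
  proof (induction f arbitrary: j)
    case 0
    show ?case by (simp add: \<tau>_def)
  next
    case (pCons a f)
    have "Polynomial.monom 1 j * pCons a f = smult a (Polynomial.monom 1 j) + Polynomial.monom 1 (Suc j) * f"
      by (simp add: mult_pCons_right monom_Suc)
    then show ?case using pCons.IH[of "Suc j"]
      by (simp add: mom_pCons shift_Suc add smult) (simp add: shift_def t_def)
  qed
  have small: "t i = Polynomial.coeff (Polynomial.monom 1 i) n" if "i \<le> n" for i
    using that deg by (simp add: t_def \<tau>_def mod_poly_less degree_monom_eq)
  show ?thesis
  proof (intro exI[of _ t] moment_seq.intro)
    show "mom (shift t j) p = 0" for j by (simp add: mom \<tau>_def)
  qed (use n deg small in auto)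
qed

section \<open>Naturality in the coefficient ring\<close>

lemma map_poly_hom:
  fixes h :: "'a::comm_ring_1 \<Rightarrow> 'b::comm_ring_1"
  assumes "\<And>a b. h (a + b) = h a + h b" "\<And>a b. h (a * b) = h a * h b" "h 1 = 1" "h 0 = 0"
  shows "map_poly h (f + g) = map_poly h f + map_poly h g"
    and "map_poly h (f * g) = map_poly h f * map_poly h g" and "map_poly h 1 = 1"
    and "(\<And>a. h a = 0 \<longleftrightarrow> a = 0) \<Longrightarrow> map_poly h f = 0 \<longleftrightarrow> f = 0"
proof -
  show add: "map_poly h (f + g) = map_poly h f + map_poly h g" for f g
    by (rule poly_eqI) (simp add: coeff_map_poly assms)
  have "map_poly h (smult c g) = smult (h c) (map_poly h g)" for c
    by (rule poly_eqI) (simp add: coeff_map_poly assms)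
  then show "map_poly h (f * g) = map_poly h f * map_poly h g"
    by (induction f) (simp_all add: map_poly_pCons assms add)
  show "map_poly h 1 = 1" by (simp add: one_pCons map_poly_pCons assms del: pCons_one)
  show "(\<And>a. h a = 0 \<longleftrightarrow> a = 0) \<Longrightarrow> map_poly h f = 0 \<longleftrightarrow> f = 0"
    by (simp add: poly_eq_iff coeff_map_poly assms)
qed

lemma mom2_hom:
  assumes "h 0 = 0" "\<And>a b. h (a + b) = h a + h b" "\<And>a b. h (a * b) = h a * h b"
  shows "mom2 (\<lambda>i. h (s i)) (\<lambda>i. h (t i)) (map_poly (map_poly h) m) = h (mom2 s t m)"
  by (induction m arbitrary: t) (simp_all add: mom2_pCons map_poly_pCons mom_hom assms)

lemma xx_nonzero: "([:0, 1:]\<^sup>2 - 1 :: 'a::field poly) \<noteq> 0"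
  by (simp add: power2_eq_square one_pCons)

lemma coeff_lift_v: "Polynomial.coeff (lift_v f) i = [:Polynomial.coeff f i:]"
  by (simp add: lift_v_def coeff_map_poly)

lemma synthetic_div_hom:
  fixes h :: "'a::comm_ring_1 \<Rightarrow> 'b::comm_ring_1"
  assumes "\<And>a b. h (a + b) = h a + h b" "\<And>a b. h (a * b) = h a * h b" "h 0 = 0"
  shows "poly (map_poly h f) (h r) = h (poly f r)"
    and "synthetic_div (map_poly h f) (h r) = map_poly h (synthetic_div f r)"
proof -
  show p: "poly (map_poly h f) (h r) = h (poly f r)" for f
    by (induction f) (simp_all add: map_poly_pCons assms)
  show "synthetic_div (map_poly h f) (h r) = map_poly h (synthetic_div f r)"
    by (induction f) (simp_all add: map_poly_pCons assms p)
qed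

text \<open>Reading the parameter as x or as y turns one polynomial over z[x] into two instances of
  \<open>sol_poly\<close> over z[x,y].\<close>

lemma sol_poly_hom:
  fixes h :: "'a::idom \<Rightarrow> 'b::idom"
  assumes "\<And>a b. h (a + b) = h a + h b" "\<And>a b. h (a * b) = h a * h b" "h 0 = 0" "h 1 = 1"
    "\<And>a. h (- a) = - h a"
  shows "map_poly h (sol_poly f \<zeta> x r) = sol_poly (map_poly h f) (h \<zeta>) (h x) (h r)"
proof -
  have add: "map_poly h (a + b) = map_poly h a + map_poly h b" for a b
    by (rule poly_eqI) (simp add: coeff_map_poly assms)
  have smult: "map_poly h (smult c a) = smult (h c) (map_poly h a)" for c a
    by (rule poly_eqI) (simp add: coeff_map_poly assms)
  have minus: "map_poly h (- a) = - map_poly h a" for a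
    by (rule poly_eqI) (simp add: coeff_map_poly assms)
  have hdiff: "h (a - b) = h a - h b" for a b
    using assms(1)[of a "- b"] by (simp add: assms(5))
  have diff: "map_poly h (a - b) = map_poly h a - map_poly h b" for a b
    by (rule poly_eqI) (simp add: coeff_map_poly assms(3) hdiff)
  have "h (x\<^sup>2 - 1) = (h x)\<^sup>2 - 1"
    using assms(1)[of "x * x" "- 1"] by (simp add: power2_eq_square assms)
  then show ?thesis
    by (simp add: sol_poly_def quot_at_def add diff smult minus synthetic_div_hom[OF assms(1-3)]
        map_poly_pCons assms)
qed

lemma div_diff_smult:
  fixes f :: "'a::idom poly"
  shows "div_diff (smult a f) = [:[:a:]:] * div_diff f"
proof (rule div_diff_unique[symmetric])
  have "(var_v - var_u) * ([:[:a:]:] * div_diff f) = [:[:a:]:] * ((var_v - var_u) * div_diff f)"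
    by (simp only: ac_simps)
  then show "(var_v - var_u) * ([:[:a:]:] * div_diff f) = lift_v (smult a f) - [:smult a f:]"
    unfolding div_diff_eq by (simp add: lift_v_smult smult_diff_right)
qed

text \<open>This makes the condition insensitive to a scalar factor of the solution. It is read off
  from \<open>refl_quot\<close>, which is bilinear in \<open>f\<close> and \<open>g\<close>.\<close>

lemma refl_poly_smult:
  fixes f g :: "'a::idom poly"
  shows "refl_poly x y (smult a f) (smult b g) = [:[:a * b:]:] * refl_poly x y f g"
proof -
  have s: "[:smult a f:] = [:[:a:]:] * [:f:]" "lift_v (smult a f) = [:[:a:]:] * lift_v f"
    for a :: 'a and f by (simp_all add: lift_v_smult)
  have "refl_quot x y (smult a f) (smult b g) = [:[:a * b:]:] * refl_quot x y f g"
    unfolding refl_quot_def div_diff_smult s const2_simps(3)[of a b] by (simp only: algebra_simps)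
  then show ?thesis unfolding refl_poly_eq by (simp only: ac_simps)
qed

section \<open>A faithful representation\<close>

text \<open>The affine Hecke algebra acts on pairs of double sequences. This is the dual of left
  multiplication on the elements \<open>\<Sum> f(K) R g(K) + \<Sum> R f(K) R g(K)\<close>: the first sequence of a
  pair is dual to the first summand, its two indices count powers of \<open>K\<close> on either side. On sequences
  satisfying the recurrence given by \<open>p\<close> in both indices, \<open>p(K)\<close> acts as zero.\<close>

type_synonym 'l dseq = "(nat \<Rightarrow> nat \<Rightarrow> 'l) \<times> (nat \<Rightarrow> nat \<Rightarrow> 'l)"

definition scale_op :: "'l::comm_ring_1 \<Rightarrow> 'l dseq \<Rightarrow> 'l dseq" where
  "scale_op c v = ((\<lambda>i j. c * fst v i j), (\<lambda>i j. c * snd v i j))"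

text \<open>Maps are set to 0 outside \<open>V\<close>, so that two elements of the carrier are
  equal as soon as they agree on \<open>V\<close>.\<close>

definition endo_ring :: "'l::comm_ring_1 dseq set \<Rightarrow> ('l dseq \<Rightarrow> 'l dseq) ring" where
  "endo_ring V = \<lparr>carrier = {F. (\<forall>v\<in>V. F v \<in> V) \<and> (\<forall>v\<in>V. \<forall>u\<in>V. F (v + u) = F v + F u)
       \<and> (\<forall>v\<in>V. \<forall>c. F (scale_op c v) = scale_op c (F v)) \<and> (\<forall>v. v \<notin> V \<longrightarrow> F v = 0)},
     monoid.mult = (\<lambda>F G v. F (G v)), one = (\<lambda>v. if v \<in> V then v else 0),
     ring.zero = (\<lambda>v. 0), add = (\<lambda>F G v. F v + G v)\<rparr>"

lemma scale_op_simps: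
  "scale_op c (v + u) = scale_op c v + scale_op c u"
  "scale_op (c + d) v = scale_op c v + scale_op d v"
  "scale_op (c * d) v = scale_op c (scale_op d v)"
  "scale_op 1 v = v" "scale_op c 0 = 0"
  by (auto simp: scale_op_def prod_eq_iff fun_eq_iff algebra_simps)

lemma endo_ring_carrier: "F \<in> carrier (endo_ring V) \<longleftrightarrow>
    (\<forall>v\<in>V. F v \<in> V) \<and> (\<forall>v\<in>V. \<forall>u\<in>V. F (v + u) = F v + F u)
    \<and> (\<forall>v\<in>V. \<forall>c. F (scale_op c v) = scale_op c (F v)) \<and> (\<forall>v. v \<notin> V \<longrightarrow> F v = 0)"
  by (simp add: endo_ring_def)

lemma endo_ringD:
  assumes "F \<in> carrier (endo_ring V)"
  shows "v \<in> V \<Longrightarrow> F v \<in> V" "v \<in> V \<Longrightarrow> u \<in> V \<Longrightarrow> F (v + u) = F v + F u"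
    "v \<in> V \<Longrightarrow> F (scale_op c v) = scale_op c (F v)" "v \<notin> V \<Longrightarrow> F v = 0"
  using assms unfolding endo_ring_carrier by blast+

lemma endo_ring_simps [simp]:
  "F \<otimes>\<^bsub>endo_ring V\<^esub> G = (\<lambda>v. F (G v))" "F \<oplus>\<^bsub>endo_ring V\<^esub> G = (\<lambda>v. F v + G v)"
  "\<zero>\<^bsub>endo_ring V\<^esub> = (\<lambda>v. 0)" "\<one>\<^bsub>endo_ring V\<^esub> = (\<lambda>v. if v \<in> V then v else 0)"
  by (simp_all add: endo_ring_def)

definition rec_seq :: "'l::comm_ring_1 poly \<Rightarrow> (nat \<Rightarrow> nat \<Rightarrow> 'l) \<Rightarrow> bool" where
  "rec_seq p a \<longleftrightarrow> (\<forall>i j. mom (\<lambda>k. a (i + k) j) p = 0 \<and> mom (\<lambda>k. a i (j + k)) p = 0)"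

lemma mom_seq_add: "mom (\<lambda>i. s i + t i) f = mom s f + mom t f"
  by (simp add: mom_def distrib_left sum.distrib)

lemma mom_seq_scale: "mom (\<lambda>i. c * t i) f = c * mom t f"
  by (simp add: mom_def sum_distrib_left mult.left_commute)

lemma mom_seq_diff: "mom (\<lambda>i. s i - t i) f = mom s f - mom t f"
  by (simp add: mom_def right_diff_distrib sum_subtractf)

lemma mom_seq_0: "mom (\<lambda>i. 0) f = 0"
  by (simp add: mom_def)

locale double_seq_rep =
  fixes w :: "'l::comm_ring_1" and p :: "'l poly"
begin

definition V :: "'l dseq set" where "V = {v. rec_seq p (fst v) \<and> rec_seq p (snd v)}"

definition R_op :: "'l dseq \<Rightarrow> 'l dseq" where
  "R_op v = (snd v, \<lambda>i j. fst v i j + w * snd v i j)"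

text \<open>The second entry is the dual of
  \<open>K R K^i R = R K^i R K - w K^i R K + w K R K^i\<close>, multiplied by \<open>K^j\<close> on
  the right; this is \<open>R_ev_R_K\<close> for a power of \<open>K\<close>.\<close>

definition K_op :: "'l dseq \<Rightarrow> 'l dseq" where
  "K_op v = (\<lambda>i j. fst v (Suc i) j,
     \<lambda>i j. snd v i (Suc j) - w * fst v i (Suc j) + w * fst v 1 (i + j))"

definition restr :: "('l dseq \<Rightarrow> 'l dseq) \<Rightarrow> 'l dseq \<Rightarrow> 'l dseq" where
  "restr F v = (if v \<in> V then F v else 0)"

abbreviation T where "T \<equiv> endo_ring V"

lemma V_0: "0 \<in> V"
  by (simp add: V_def rec_seq_def mom_seq_0 zero_fun_def)

lemma V_add: "v \<in> V \<Longrightarrow> u \<in> V \<Longrightarrow> v + u \<in> V"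
  by (simp add: V_def rec_seq_def mom_seq_add)

lemma V_scale: "v \<in> V \<Longrightarrow> scale_op c v \<in> V"
  by (simp add: V_def rec_seq_def scale_op_def mom_seq_scale)

lemma V_R: "v \<in> V \<Longrightarrow> R_op v \<in> V"
  by (simp add: V_def rec_seq_def R_op_def mom_seq_add mom_seq_scale)

lemma V_K:
  assumes "v \<in> V"
  shows "K_op v \<in> V"
proof -
  have *: "mom (\<lambda>k. fst v (i + k) j) p = 0" "mom (\<lambda>k. fst v i (j + k)) p = 0"
    "mom (\<lambda>k. snd v (i + k) j) p = 0" "mom (\<lambda>k. snd v i (j + k)) p = 0" for i j
    using assms by (auto simp: V_def rec_seq_def)
  have "mom (\<lambda>k. fst (K_op v) (i + k) j) p = 0" "mom (\<lambda>k. fst (K_op v) i (j + k)) p = 0" for i j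
    using *(1)[of "Suc i" j] *(2)[of "Suc i" j] by (simp_all add: K_op_def)
  moreover have "mom (\<lambda>k. snd (K_op v) (i + k) j) p = 0" for i j
  proof -
    have "i + k + j = (i + j) + k" for k by simp
    then have "mom (\<lambda>k. fst v 1 (i + k + j)) p = 0" using *(2)[of 1 "i + j"] by presburger
    then show ?thesis
      using *(3)[of i "Suc j"] *(1)[of i "Suc j"]
      by (simp add: K_op_def mom_seq_add mom_seq_diff mom_seq_scale)
  qed
  moreover have "mom (\<lambda>k. snd (K_op v) i (j + k)) p = 0" for i j
    using *(4)[of i "Suc j"] *(2)[of i "Suc j"] *(2)[of 1 "i + j"]
    by (simp add: K_op_def mom_seq_add mom_seq_diff mom_seq_scale add.assoc)
  ultimately show ?thesis by (simp add: V_def rec_seq_def)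
qed

lemma T_carrierI:
  assumes "\<And>v. v \<in> V \<Longrightarrow> F v \<in> V" "\<And>v u. v \<in> V \<Longrightarrow> u \<in> V \<Longrightarrow> F (v + u) = F v + F u"
    "\<And>v c. v \<in> V \<Longrightarrow> F (scale_op c v) = scale_op c (F v)"
  shows "restr F \<in> carrier T"
  using assms by (auto simp: endo_ring_carrier restr_def V_add V_scale)

lemma T_at_0: "F \<in> carrier T \<Longrightarrow> F 0 = 0"
  using endo_ringD(3)[of F V 0 0] V_0 by (simp add: scale_op_simps) (simp add: scale_op_def zero_prod_def zero_fun_def)

lemma T_add: "F \<in> carrier T \<Longrightarrow> G \<in> carrier T \<Longrightarrow> F \<oplus>\<^bsub>T\<^esub> G \<in> carrier T"
  unfolding endo_ring_carrier endo_ring_simps by (auto simp: V_add scale_op_simps add_ac)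

lemma T_mult: "F \<in> carrier T \<Longrightarrow> G \<in> carrier T \<Longrightarrow> F \<otimes>\<^bsub>T\<^esub> G \<in> carrier T"
  using T_at_0[of F] unfolding endo_ring_carrier endo_ring_simps by auto

lemma T_zero: "\<zero>\<^bsub>T\<^esub> \<in> carrier T"
  unfolding endo_ring_carrier endo_ring_simps by (auto simp: V_0 scale_op_simps)

lemma T_one: "\<one>\<^bsub>T\<^esub> \<in> carrier T"
  unfolding endo_ring_carrier endo_ring_simps by (auto simp: V_add V_scale)

lemma T_minus: "F \<in> carrier T \<Longrightarrow> (\<lambda>v. scale_op (- 1) (F v)) \<in> carrier T"
  unfolding endo_ring_carrier
  by (auto simp: V_scale scale_op_simps(1,5)) (simp add: scale_op_simps(3)[symmetric] mult.commute)

sublocale T: ring T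
proof (rule ringI)
  show "abelian_group T"
  proof (rule abelian_groupI)
    fix F assume F: "F \<in> carrier T"
    have "scale_op (- 1) (F v) + F v = 0" for v
      by (auto simp: scale_op_def prod_eq_iff fun_eq_iff)
    then have "(\<lambda>v. scale_op (- 1) (F v)) \<oplus>\<^bsub>T\<^esub> F = \<zero>\<^bsub>T\<^esub>" by simp
    with T_minus[OF F] show "\<exists>G\<in>carrier T. G \<oplus>\<^bsub>T\<^esub> F = \<zero>\<^bsub>T\<^esub>" by blast
  qed (simp_all only: T_add T_zero, simp_all add: add_ac)
  show "Group.monoid T"
  proof (rule monoidI)
    fix F assume F: "F \<in> carrier T"
    show "\<one>\<^bsub>T\<^esub> \<otimes>\<^bsub>T\<^esub> F = F" "F \<otimes>\<^bsub>T\<^esub> \<one>\<^bsub>T\<^esub> = F"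
      using endo_ringD(1)[OF F] endo_ringD(4)[OF F] T_at_0[OF F] by (auto simp: fun_eq_iff)
  qed (simp_all only: T_mult T_one, simp_all)
next
  fix F G H assume "F \<in> carrier T" "G \<in> carrier T" "H \<in> carrier T"
  then show "H \<otimes>\<^bsub>T\<^esub> (F \<oplus>\<^bsub>T\<^esub> G) = H \<otimes>\<^bsub>T\<^esub> F \<oplus>\<^bsub>T\<^esub> H \<otimes>\<^bsub>T\<^esub> G"
    unfolding endo_ring_simps fun_eq_iff by (metis add_0 endo_ringD(1,2,4) T_at_0)
qed simp

lemma R_op_T: "restr R_op \<in> carrier T"
  by (rule T_carrierI[OF V_R]) (auto simp: R_op_def scale_op_def fun_eq_iff prod_eq_iff algebra_simps)

lemma K_op_T: "restr K_op \<in> carrier T"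
  by (rule T_carrierI[OF V_K]) (auto simp: K_op_def scale_op_def fun_eq_iff prod_eq_iff algebra_simps)

lemma scale_T: "restr (scale_op c) \<in> carrier T"
  by (rule T_carrierI[OF V_scale]) (auto simp: scale_op_def fun_eq_iff prod_eq_iff algebra_simps)

lemma restr_comp:
  assumes "F 0 = 0" "\<And>v. v \<in> V \<Longrightarrow> G v \<in> V"
  shows "restr F \<otimes>\<^bsub>T\<^esub> restr G = restr (\<lambda>v. F (G v))"
  using assms by (auto simp: restr_def fun_eq_iff V_0)

lemma op_0: "R_op 0 = 0" "K_op 0 = 0" "scale_op c 0 = 0"
  by (simp_all add: R_op_def K_op_def scale_op_def zero_prod_def zero_fun_def)

lemma scale_central:
  assumes F: "F \<in> carrier T"
  shows "restr (scale_op c) \<otimes>\<^bsub>T\<^esub> F = F \<otimes>\<^bsub>T\<^esub> restr (scale_op c)"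
proof
  fix v
  show "(restr (scale_op c) \<otimes>\<^bsub>T\<^esub> F) v = (F \<otimes>\<^bsub>T\<^esub> restr (scale_op c)) v"
    using endo_ringD[OF F, of v] T_at_0[OF F] V_0 by (cases "v \<in> V") (auto simp: restr_def op_0)
qed

sublocale scale: type_hom T "\<lambda>c. restr (scale_op c)"
proof unfold_locales
  show "restr (scale_op (a * b)) = restr (scale_op a) \<otimes>\<^bsub>T\<^esub> restr (scale_op b)" for a b
    by (simp only: restr_comp[where F = "scale_op a" and G = "scale_op b", OF op_0(3) V_scale])
      (simp add: restr_def scale_op_simps(3) fun_eq_iff)
qed (simp_all add: scale_T, simp_all add: restr_def scale_op_simps fun_eq_iff)

lemma quadratic: "restr R_op \<otimes>\<^bsub>T\<^esub> restr R_op = restr (scale_op w) \<otimes>\<^bsub>T\<^esub> restr R_op \<oplus>\<^bsub>T\<^esub> \<one>\<^bsub>T\<^esub>"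
proof -
  have "R_op (R_op v) = scale_op w (R_op v) + v" for v
    by (auto simp: R_op_def scale_op_def prod_eq_iff fun_eq_iff algebra_simps)
  then show ?thesis
    unfolding restr_comp[where F = R_op and G = R_op, OF op_0(1) V_R]
      restr_comp[where F = "scale_op w" and G = R_op, OF op_0(3) V_R]
    by (auto simp: restr_def fun_eq_iff V_R op_0)
qed

text \<open>Transposed operators compose in the opposite order, but the defining relations of the
  algebra are stable under reversal of words, so the dual operators satisfy them too.\<close>

lemma braid_op: "R_op (K_op (R_op (K_op v))) = K_op (R_op (K_op (R_op v)))"
  by (auto simp: R_op_def K_op_def prod_eq_iff fun_eq_iff algebra_simps)

lemma braid: "restr R_op \<otimes>\<^bsub>T\<^esub> restr K_op \<otimes>\<^bsub>T\<^esub> restr R_op \<otimes>\<^bsub>T\<^esub> restr K_op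
    = restr K_op \<otimes>\<^bsub>T\<^esub> restr R_op \<otimes>\<^bsub>T\<^esub> restr K_op \<otimes>\<^bsub>T\<^esub> restr R_op"
  using braid_op V_R V_K by (auto simp: restr_def fun_eq_iff V_0 op_0)

sublocale K: poly_eval T "\<lambda>c. restr (scale_op c)" "restr K_op"
  by (unfold_locales, rule K_op_T, rule scale_central[OF K_op_T, symmetric])

abbreviation K_ev where "K_ev \<equiv> poly_ev T (\<lambda>c. restr (scale_op c)) (restr K_op)"

lemma K_ev_pCons: "v \<in> V \<Longrightarrow> K_ev (pCons c f) v = scale_op c v + K_op (K_ev f v)"
  using endo_ringD(1)[OF K.ev_closed] by (simp add: K.ev_pCons restr_def)

text \<open>The value of the double sequence \<open>a\<close> at \<open>u^i v^j\<close> times the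
  divided difference of \<open>u^k\<close>.\<close>

definition diag :: "(nat \<Rightarrow> nat \<Rightarrow> 'l) \<Rightarrow> nat \<Rightarrow> nat \<Rightarrow> nat \<Rightarrow> 'l" where
  "diag a i j k = (\<Sum>r<k. a (i + r) (j + k - Suc r))"

lemma op_entries:
  "fst (scale_op c v) i j = c * fst v i j" "snd (scale_op c v) i j = c * snd v i j"
  "fst (K_op v) i j = fst v (Suc i) j"
  "snd (K_op v) i j = snd v i (Suc j) - w * fst v i (Suc j) + w * fst v 1 (i + j)"
  by (simp_all add: scale_op_def K_op_def)

lemma K_ev_fst: "v \<in> V \<Longrightarrow> fst (K_ev f v) i j = mom (\<lambda>k. fst v (i + k) j) f"
  by (induction f arbitrary: i)
    (simp_all add: K_ev_pCons op_entries mom_pCons)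

text \<open>The dual form of \<open>R_ev_R_ev\<close>: moving f(K) past \<open>R K^i R\<close> costs
  a multiple of \<open>w\<close> with the divided difference of \<open>f\<close>.\<close>

lemma K_ev_snd: "v \<in> V \<Longrightarrow> snd (K_ev f v) i j
    = mom (\<lambda>k. snd v i (j + k)) f + w * (mom (diag (fst v) 1 (i + j)) f - mom (diag (fst v) i (Suc j)) f)"
proof (induction f arbitrary: i j)
  case (pCons c f)
  have d: "(\<lambda>k. diag a i j (Suc k)) = (\<lambda>k. diag a i (Suc j) k + a (i + k) j)" for a i j
    by (auto simp: diag_def fun_eq_iff)
  show ?case using pCons
    by (simp add: K_ev_pCons op_entries mom_pCons K_ev_fst d mom_seq_add
        diag_def[of _ _ _ 0] algebra_simps)
qed simp

text \<open>On the divided difference of \<open>p\<close>, multiplication by u and by v have the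
  same effect modulo p(u) and p(v), since (v - u) times it is p(v) - p(u).\<close>

lemma diag_shift:
  assumes "rec_seq p a"
  shows "mom (diag a (Suc i) j) p = mom (diag a i (Suc j)) p"
proof -
  have "diag a (Suc i) j k = diag a i (Suc j) k - a i (j + k) + a (i + k) j" for k
  proof -
    let ?c = "\<lambda>r. a (i + r) (j + k - r)"
    have "(\<Sum>r<k. ?c (Suc r)) + ?c 0 = (\<Sum>r<k. ?c r) + ?c k"
      using sum.lessThan_Suc_shift[of ?c k] sum.lessThan_Suc[of ?c k] by (simp add: add.commute)
    moreover have "(\<Sum>r<k. ?c (Suc r)) = diag a (Suc i) j k"
      by (simp add: diag_def)
    moreover have "(\<Sum>r<k. ?c r) = diag a i (Suc j) k"
      by (simp add: diag_def)
    ultimately show ?thesis by (simp add: algebra_simps)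
  qed
  then have "mom (diag a (Suc i) j) p
      = mom (\<lambda>k. diag a i (Suc j) k - a i (j + k) + a (i + k) j) p" by presburger
  then show ?thesis using assms by (simp add: mom_seq_add mom_seq_diff rec_seq_def)
qed

lemma diag_swap:
  assumes "rec_seq p a"
  shows "mom (diag a 1 (i + j)) p = mom (diag a i (Suc j)) p"
proof (induction i arbitrary: j)
  case 0
  show ?case using diag_shift[OF assms, of 0 j] by simp
next
  case (Suc i)
  show ?case using Suc[of "Suc j"] diag_shift[OF assms, of i "Suc j"] by simp
qed

text \<open>The two correction terms in \<open>K_ev_snd\<close> agree by \<open>diag_swap\<close>,
  and the rest is the recurrence. Hence the action factors through the cyclotomic quotient.\<close>

lemma K_ev_p: "K_ev p = \<zero>\<^bsub>T\<^esub>"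
proof
  fix v
  show "K_ev p v = \<zero>\<^bsub>T\<^esub> v"
  proof (cases "v \<in> V")
    case True
    then have r: "rec_seq p (fst v)" "rec_seq p (snd v)" by (auto simp: V_def)
    have "fst (K_ev p v) i j = 0" "snd (K_ev p v) i j = 0" for i j
      using r diag_swap[OF r(1), of i j]
      by (simp_all add: K_ev_fst[OF True] K_ev_snd[OF True] rec_seq_def)
    then show ?thesis by (simp add: prod_eq_iff fun_eq_iff)
  next
    case False
    then show ?thesis using endo_ringD(4)[OF K.ev_closed] by simp
  qed
qed

text \<open>The value at \<open>K^i\<close> of \<open>v\<close> as a functional, because
  \<open>R R K^i - w R K^i = K^i\<close> by the quadratic relation. In particular
  \<open>coord 0\<close> is the value at 1.\<close>

definition coord :: "nat \<Rightarrow> 'l dseq \<Rightarrow> 'l" where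
  "coord i v = snd v 0 i - w * fst v 0 i"

lemma coord_K: "coord i (K_op v) = coord (Suc i) v"
  by (simp add: coord_def K_op_def)

lemma coord_R: "coord i (R_op v) = fst v 0 i"
  by (simp add: coord_def R_op_def)

lemma coord_add: "coord i (v + u) = coord i v + coord i u"
  by (simp add: coord_def algebra_simps)

lemma coord_K_ev: "v \<in> V \<Longrightarrow> coord i (K_ev f v) = mom (\<lambda>k. coord (i + k) v) f"
proof (induction f arbitrary: i)
  case (pCons c f)
  have "coord i (scale_op c v) = c * coord i v"
    by (simp add: coord_def scale_op_def algebra_simps)
  with pCons show ?case by (simp add: K_ev_pCons coord_add coord_K mom_pCons)
qed (simp add: coord_def)

text \<open>When the first entry is a product sequence, the operator of \<open>K^i R K^j\<close>
  followed by \<open>coord 0\<close> yields \<open>\<alpha> i * \<beta> j\<close>. So a vanishing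
  \<open>sandwich m\<close> lets \<open>m\<close> be tested by every pair of functionals compatible
  with \<open>p\<close>.\<close>

lemma coord_sandwich:
  assumes H: "hecke_ring S s R K w'" and \<Phi>: "\<Phi> \<in> ring_hom S T"
    and gen: "\<Phi> R = restr R_op" "\<Phi> K = restr K_op" "\<And>a. \<Phi> (s a) = restr (scale_op (e a))"
    and e: "e 0 = 0" and v: "v \<in> V" and prod: "\<And>i j. fst v i j = \<beta> i * \<alpha> j"
  shows "coord 0 (\<Phi> (hecke_ring.sandwich S s R K m) v) = mom2 \<alpha> \<beta> (map_poly (map_poly e) m)"
  using v prod
proof (induction m arbitrary: v \<beta>)
  case 0
  interpret H: hecke_ring S s R K w' by fact
  interpret \<Phi>: ring_hom_ring S T \<Phi>
    by (rule ring_hom_ringI2[OF H.T.ring_axioms T.ring_axioms \<Phi>])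
  show ?case by (simp add: coord_def)
next
  case (pCons f m)
  interpret H: hecke_ring S s R K w' by fact
  interpret \<Phi>: ring_hom_ring S T \<Phi>
    by (rule ring_hom_ringI2[OF H.T.ring_axioms T.ring_axioms \<Phi>])
  have ev: "\<Phi> (H.ev f) = K_ev (map_poly e f)"
  proof (induction f)
    case (pCons a f)
    then show ?case
      by (simp add: H.K.ev_pCons K.ev_pCons map_poly_pCons e gen del: endo_ring_simps)
  qed simp
  have "\<Phi> (H.sandwich (pCons f m)) = K_ev (map_poly e f) \<otimes>\<^bsub>T\<^esub> restr R_op \<oplus>\<^bsub>T\<^esub> \<Phi> (H.sandwich m) \<otimes>\<^bsub>T\<^esub> restr K_op"
    by (simp add: H.sandwich_pCons gen ev del: endo_ring_simps)
  then have "\<Phi> (H.sandwich (pCons f m)) v = K_ev (map_poly e f) (R_op v) + \<Phi> (H.sandwich m) (K_op v)"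
    using pCons.prems(1) by (simp add: restr_def)
  moreover have "coord 0 (K_ev (map_poly e f) (R_op v)) = \<beta> 0 * mom \<alpha> (map_poly e f)"
    using coord_K_ev[OF V_R[OF pCons.prems(1)], of 0 "map_poly e f"]
    by (simp add: coord_R pCons.prems(2) mom_seq_scale)
  moreover have "coord 0 (\<Phi> (H.sandwich m) (K_op v)) = mom2 \<alpha> (\<lambda>i. \<beta> (Suc i)) (map_poly (map_poly e) m)"
    by (rule pCons.IH[OF V_K[OF pCons.prems(1)]]) (simp add: K_op_def pCons.prems(2))
  ultimately show ?case by (simp add: coord_add mom2_pCons map_poly_pCons mult.commute)
qed

end

section \<open>Homomorphisms of fraction fields\<close>

lemma fract_map_hom:
  fixes h :: "'a::idom \<Rightarrow> 'b::idom"
  assumes "\<And>a b. h (a + b) = h a + h b" "\<And>a b. h (a * b) = h a * h b" "h 1 = 1" "\<And>a. h a = 0 \<longleftrightarrow> a = 0"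
  shows "fract_map h (r + s) = fract_map h r + fract_map h s"
    and "fract_map h (r * s) = fract_map h r * fract_map h s"
    and "fract_map h 1 = 1"
    and "fract_map h (Fract a 1) = Fract (h a) 1"
proof -
  note ev = fract_map_Fract[of h, OF assms(2,4)]
  have "b \<noteq> 0 \<Longrightarrow> h b \<noteq> 0" for b using assms(4) by simp
  then show "fract_map h (r + s) = fract_map h r + fract_map h s"
    "fract_map h (r * s) = fract_map h r * fract_map h s"
    by (cases r; cases s; simp add: ev assms)+
  show "fract_map h (Fract a 1) = Fract (h a) 1" for a by (simp add: ev assms)
  from this[of 1] show "fract_map h 1 = 1" by (simp add: One_fract_def assms)
qed

lemma lift_v_eq_0_iff: "lift_v f = 0 \<longleftrightarrow> f = 0"
  using lift_v_inj[of f 0] by simp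

lemma at_x_simps:
  "at_x (r + s) = at_x r + at_x s" "at_x (r * s) = at_x r * at_x s" "at_x 1 = 1"
  "at_x (Fract a 1) = Fract [:a:] 1"
  unfolding at_x_def by (rule fract_map_hom; simp add: pCons_one)+

lemma at_y_simps:
  "at_y (r + s) = at_y r + at_y s" "at_y (r * s) = at_y r * at_y s" "at_y 1 = 1"
  "at_y (Fract a 1) = Fract (lift_v a) 1"
  unfolding at_y_def lift_v_def[symmetric]
  by (rule fract_map_hom; simp add: lift_v_add lift_v_mult lift_v_eq_0_iff)+

section \<open>The algebras\<close>

lemma algebra_via_simps [simp]:
  "carrier (algebra_via h A) = carrier A" "a \<otimes>\<^bsub>algebra_via h A\<^esub> b = a \<otimes>\<^bsub>A\<^esub> b"
  "a \<oplus>\<^bsub>algebra_via h A\<^esub> b = a \<oplus>\<^bsub>A\<^esub> b" "\<one>\<^bsub>algebra_via h A\<^esub> = \<one>\<^bsub>A\<^esub>" "\<zero>\<^bsub>algebra_via h A\<^esub> = \<zero>\<^bsub>A\<^esub>"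
  "c \<odot>\<^bsub>algebra_via h A\<^esub> a = h c \<otimes>\<^bsub>A\<^esub> a"
  by (simp_all add: algebra_via_def)

lemma ring_algebra_via:
  assumes "ring A"
  shows "ring (algebra_via h A)"
proof -
  interpret A: ring A by fact
  show ?thesis
  proof (rule ringI)
    show "abelian_group (algebra_via h A)"
    proof (rule abelian_groupI)
      fix a assume "a \<in> carrier (algebra_via h A)"
      then show "\<exists>b\<in>carrier (algebra_via h A). b \<oplus>\<^bsub>algebra_via h A\<^esub> a = \<zero>\<^bsub>algebra_via h A\<^esub>"
        by (intro bexI[of _ "\<ominus>\<^bsub>A\<^esub> a"]) (simp_all add: A.l_neg)
    qed (simp_all add: A.a_ac)
    show "Group.monoid (algebra_via h A)" by (rule monoidI) (simp_all add: A.m_assoc)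
  qed (simp_all add: A.l_distr A.r_distr)
qed

lemma type_algebra_simps [simp]:
  "carrier ring_of_type_algebra = UNIV" "a \<otimes>\<^bsub>ring_of_type_algebra\<^esub> b = a * b"
  "a \<oplus>\<^bsub>ring_of_type_algebra\<^esub> b = a + b" "\<one>\<^bsub>ring_of_type_algebra\<^esub> = 1" "\<zero>\<^bsub>ring_of_type_algebra\<^esub> = 0"
  for a b :: "'a::comm_ring_1"
  by (simp_all add: ring_of_type_algebra_def)

lemma ring_k_x: "ring k_x" and ring_k_xy: "ring k_xy" and ring_z_alg: "ring (z_alg \<iota>)"
  unfolding k_x_def k_xy_def z_alg_def by (auto intro!: ring_algebra_via)

lemma k_x_simps [simp]:
  "carrier k_x = UNIV" "a \<otimes>\<^bsub>k_x\<^esub> b = a * b" "a \<oplus>\<^bsub>k_x\<^esub> b = a + b" "\<one>\<^bsub>k_x\<^esub> = 1" "\<zero>\<^bsub>k_x\<^esub> = 0"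
  "c \<odot>\<^bsub>k_x\<^esub> a = Fract [:c:] 1 * a"
  by (simp_all add: k_x_def)

lemma k_xy_simps [simp]:
  "carrier k_xy = UNIV" "a \<otimes>\<^bsub>k_xy\<^esub> b = a * b" "a \<oplus>\<^bsub>k_xy\<^esub> b = a + b" "\<one>\<^bsub>k_xy\<^esub> = 1" "\<zero>\<^bsub>k_xy\<^esub> = 0"
  "c \<odot>\<^bsub>k_xy\<^esub> a = Fract [:[:c:]:] 1 * a"
  by (simp_all add: k_xy_def)

lemma z_alg_simps [simp]:
  "carrier (z_alg \<iota>) = UNIV" "a \<otimes>\<^bsub>z_alg \<iota>\<^esub> b = a * b" "a \<oplus>\<^bsub>z_alg \<iota>\<^esub> b = a + b"
  "\<one>\<^bsub>z_alg \<iota>\<^esub> = 1" "\<zero>\<^bsub>z_alg \<iota>\<^esub> = 0" "c \<odot>\<^bsub>z_alg \<iota>\<^esub> a = \<iota> c * a"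
  by (simp_all add: z_alg_def)

abbreviation word_monoid :: "gen list monoid" where
  "word_monoid \<equiv> \<lparr>carrier = UNIV, monoid.mult = (@), one = []\<rparr>"

lemma monoid_words: "Group.monoid word_monoid"
  by (rule monoidI) auto

lemma ring_free_alg: "ring free_alg"
  unfolding free_alg_def by (rule ring_monoid_ring[OF monoid_words])

lemma free_alg_simps [simp]:
  "carrier free_alg = UNIV" "f \<oplus>\<^bsub>free_alg\<^esub> g = f + g" "\<zero>\<^bsub>free_alg\<^esub> = 0"
  "\<one>\<^bsub>free_alg\<^esub> = Poly_Mapping.single [] 1"
  "Poly_Mapping.single a c \<otimes>\<^bsub>free_alg\<^esub> Poly_Mapping.single b d = Poly_Mapping.single (a @ b) (c * d)"
  by (simp_all add: free_alg_def monoid_ring_mult_single) (simp_all add: monoid_ring_def)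

locale cyclotomic =
  fixes \<iota> :: "'k::field \<Rightarrow> 'z::field" and q :: 'k and p :: "'z poly"
  assumes \<iota>_hom: "\<iota> \<in> ring_hom ring_of_type_algebra ring_of_type_algebra"
begin

abbreviation "Hp \<equiv> H_p \<iota> q p"
abbreviation "Kp \<equiv> K_p \<iota> q p"

lemma \<iota>_simps: "\<iota> (a + b) = \<iota> a + \<iota> b" "\<iota> (a * b) = \<iota> a * \<iota> b" "\<iota> 1 = 1"
  using ring_hom_add[OF \<iota>_hom, of a b] ring_hom_mult[OF \<iota>_hom, of a b] ring_hom_one[OF \<iota>_hom] by auto

lemma \<iota>_0 [simp]: "\<iota> 0 = 0"
  by (metis \<iota>_simps(1) add_0 add_cancel_right_right)

lemma \<iota>_eq_0_iff: "\<iota> a = 0 \<longleftrightarrow> a = 0"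
proof
  assume a: "\<iota> a = 0"
  show "a = 0"
  proof (rule ccontr)
    assume "a \<noteq> 0"
    then have "\<iota> a * \<iota> (inverse a) = 1" unfolding \<iota>_simps(2)[symmetric] using \<iota>_simps(3) by simp
    with a show False by simp
  qed
qed simp

definition om :: 'k where "om = q - inverse q"

sublocale free: ring "free_alg :: (gen list \<Rightarrow>\<^sub>0 'z) ring" by (rule ring_free_alg)

abbreviation hecke_rels :: "(gen list \<Rightarrow>\<^sub>0 'z) set" where
  "hecke_rels \<equiv> {Poly_Mapping.single [GenR, GenR] 1
        - (Poly_Mapping.single [GenR] (\<iota> (q - inverse q)) + Poly_Mapping.single [] 1),
      Poly_Mapping.single [GenR, GenK, GenR, GenK] 1 - Poly_Mapping.single [GenK, GenR, GenK, GenR] 1}"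

sublocale hI: ideal "hecke_ideal \<iota> q" "free_alg :: (gen list \<Rightarrow>\<^sub>0 'z) ring"
  unfolding hecke_ideal_def by (rule free.genideal_ideal) simp

sublocale hecke: ring "hecke \<iota> q"
  unfolding hecke_def by (rule hI.quotient_is_ring)

lemma hecke_class_hom: "hecke_class \<iota> q \<in> ring_hom free_alg (hecke \<iota> q)"
proof -
  have "hecke_class \<iota> q = (+>\<^bsub>free_alg\<^esub>) (hecke_ideal \<iota> q)" by (rule ext) (simp add: hecke_class_def)
  then show ?thesis unfolding hecke_def using hI.rcos_ring_hom by simp
qed

lemma hecke_class_eqI:
  assumes "f - g \<in> hecke_ideal \<iota> q"
  shows "hecke_class \<iota> q f = hecke_class \<iota> q g"
proof -
  have "f = (f - g) \<oplus>\<^bsub>free_alg\<^esub> g" by simp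
  then have "f \<in> hecke_ideal \<iota> q +>\<^bsub>free_alg\<^esub> g" unfolding a_r_coset_def' using assms by blast
  then show ?thesis unfolding hecke_class_def using hI.a_repr_independence' by simp
qed

lemma hecke_rels_ideal: "r \<in> hecke_rels \<Longrightarrow> r \<in> hecke_ideal \<iota> q"
  unfolding hecke_ideal_def using free.genideal_self[of hecke_rels] unfolding free_alg_simps by blast

lemma free_to_ring:
  fixes h :: "(gen list \<Rightarrow>\<^sub>0 'z) \<Rightarrow> 't"
  assumes "h \<in> ring_hom free_alg T" "ring T"
  shows "type_hom T (\<lambda>c. h (Poly_Mapping.single [] c))"
    and "poly_eval T (\<lambda>c. h (Poly_Mapping.single [] c)) (h (Poly_Mapping.single [GenK] 1))"
proof -
  interpret T: ring T by fact
  interpret h: ring_hom_ring free_alg T h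
    by (rule ring_hom_ringI2[OF free.ring_axioms T.ring_axioms assms(1)])
  have m: "h f \<otimes>\<^bsub>T\<^esub> h g = h (f \<otimes>\<^bsub>free_alg\<^esub> g)" for f g by simp
  have a: "h f \<oplus>\<^bsub>T\<^esub> h g = h (f + g)" for f g using h.hom_add[of f g] by simp
  have cl: "h f \<in> carrier T" for f by (rule h.hom_closed) simp
  show "type_hom T (\<lambda>c. h (Poly_Mapping.single [] c))"
    using h.hom_one by unfold_locales (simp_all add: cl a single_add m del: h.hom_mult h.hom_add h.hom_one)
  then interpret t: type_hom T "\<lambda>c. h (Poly_Mapping.single [] c)" .
  show "poly_eval T (\<lambda>c. h (Poly_Mapping.single [] c)) (h (Poly_Mapping.single [GenK] 1))"
    by unfold_locales (simp_all add: cl m del: h.hom_mult)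
qed

abbreviation h_scalar where "h_scalar c \<equiv> hecke_class \<iota> q (Poly_Mapping.single [] c)"
abbreviation h_K where "h_K \<equiv> hecke_class \<iota> q (Poly_Mapping.single [GenK] 1)"

sublocale hK: poly_eval "hecke \<iota> q" "\<lambda>c. h_scalar c" h_K
  by (rule free_to_ring(2)[OF hecke_class_hom hecke.ring_axioms])

lemma hecke_poly_K_eq: "hecke_poly_K \<iota> q p = poly_ev (hecke \<iota> q) (\<lambda>c. h_scalar c) h_K p"
  unfolding hecke_poly_K_def by (rule hK.ev_finsum[symmetric]) simp

sublocale cI: ideal "cyc_ideal \<iota> q p" "hecke \<iota> q"
  unfolding cyc_ideal_def by (rule hecke.genideal_ideal) (simp add: hecke_poly_K_eq)

abbreviation Hq where "Hq \<equiv> hecke \<iota> q Quot cyc_ideal \<iota> q p"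

sublocale Hq: ring Hq by (rule cI.quotient_is_ring)

lemma cyc_class_hom: "cyc_class \<iota> q p \<in> ring_hom free_alg Hp"
proof -
  have "cyc_class \<iota> q p = (+>\<^bsub>hecke \<iota> q\<^esub>) (cyc_ideal \<iota> q p) \<circ> hecke_class \<iota> q"
    by (rule ext) (simp add: cyc_class_def)
  then have "cyc_class \<iota> q p \<in> ring_hom free_alg Hq"
    using ring_hom_trans[OF hecke_class_hom cI.rcos_ring_hom] by simp
  then show ?thesis by (simp add: ring_hom_def H_p_def)
qed

sublocale H: ring Hp
  unfolding H_p_def by (rule ring_algebra_via[OF Hq.ring_axioms])

sublocale cls: ring_hom_ring free_alg Hp "cyc_class \<iota> q p"
  by (rule ring_hom_ringI2[OF free.ring_axioms H.ring_axioms cyc_class_hom])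

lemma cyc_class_closed [simp, intro]: "cyc_class \<iota> q p f \<in> carrier Hp"
  by (rule cls.hom_closed) simp

abbreviation c_scalar where "c_scalar \<equiv> cyc_scalar \<iota> q p"
abbreviation c_K where "c_K \<equiv> cyc_K \<iota> q p"
abbreviation c_R where "c_R \<equiv> cyc_R \<iota> q p"

lemma gen_closed [simp, intro]:
  "c_scalar c \<in> carrier Hp" "c_K \<in> carrier Hp" "c_R \<in> carrier Hp"
  by (simp_all add: cyc_scalar_def cyc_K_def cyc_R_def)

lemma cyc_scalar_eta: "c_scalar = (\<lambda>c. cyc_class \<iota> q p (Poly_Mapping.single [] c))"
  by (rule ext) (simp add: cyc_scalar_def)

sublocale HK: poly_eval Hp c_scalar c_K
  unfolding cyc_scalar_eta cyc_K_def by (rule free_to_ring(2)[OF cyc_class_hom H.ring_axioms])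

lemma H_K_p: "poly_ev Hp c_scalar c_K p = \<zero>\<^bsub>Hp\<^esub>"
proof -
  let ?\<pi> = "(+>\<^bsub>hecke \<iota> q\<^esub>) (cyc_ideal \<iota> q p)"
  have \<pi>: "?\<pi> \<in> ring_hom (hecke \<iota> q) Hp"
    using cI.rcos_ring_hom by (simp add: ring_hom_def H_p_def)
  have "?\<pi> (hecke_poly_K \<iota> q p) = poly_ev Hp c_scalar c_K p"
    unfolding hecke_poly_K_eq
    by (rule hK.ev_natural[OF \<pi> HK.poly_eval_axioms]) (simp_all add: cyc_scalar_def cyc_K_def cyc_class_def)
  moreover have "hecke_poly_K \<iota> q p \<in> cyc_ideal \<iota> q p"
    unfolding cyc_ideal_def by (rule hecke.genideal_self') (simp add: hecke_poly_K_eq)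
  then have "?\<pi> (hecke_poly_K \<iota> q p) = cyc_ideal \<iota> q p"
    by (intro hecke.a_coset_join2 cI.a_subgroup) (simp_all add: hecke_poly_K_eq)
  moreover have "\<zero>\<^bsub>Hp\<^esub> = cyc_ideal \<iota> q p"
    by (simp add: H_p_def FactRing_def)
  ultimately show ?thesis by simp
qed

lemma cyc_class_mult: "cyc_class \<iota> q p f \<otimes>\<^bsub>Hp\<^esub> cyc_class \<iota> q p g = cyc_class \<iota> q p (f \<otimes>\<^bsub>free_alg\<^esub> g)"
  by simp

lemma cyc_class_add: "cyc_class \<iota> q p f \<oplus>\<^bsub>Hp\<^esub> cyc_class \<iota> q p g = cyc_class \<iota> q p (f + g)"
  using cls.hom_add[of f g] by simp

lemma R_scalar: "c_R \<otimes>\<^bsub>Hp\<^esub> c_scalar c = c_scalar c \<otimes>\<^bsub>Hp\<^esub> c_R"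
  unfolding cyc_R_def cyc_scalar_def cyc_class_mult by simp

lemma R_R: "c_R \<otimes>\<^bsub>Hp\<^esub> c_R = c_scalar (\<iota> om) \<otimes>\<^bsub>Hp\<^esub> c_R \<oplus>\<^bsub>Hp\<^esub> \<one>\<^bsub>Hp\<^esub>"
proof -
  have "hecke_class \<iota> q (Poly_Mapping.single [GenR, GenR] 1)
    = hecke_class \<iota> q (Poly_Mapping.single [GenR] (\<iota> om) + Poly_Mapping.single [] 1)"
    by (rule hecke_class_eqI[OF hecke_rels_ideal]) (simp add: om_def)
  then have "cyc_class \<iota> q p (Poly_Mapping.single [GenR, GenR] 1)
    = cyc_class \<iota> q p (Poly_Mapping.single [GenR] (\<iota> om) + Poly_Mapping.single [] 1)"
    by (simp add: cyc_class_def)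
  then show ?thesis
    unfolding cyc_R_def cyc_scalar_def cyc_class_mult HK.hom_one[symmetric] cyc_class_add by simp
qed

lemma R_K_braid: "c_R \<otimes>\<^bsub>Hp\<^esub> c_K \<otimes>\<^bsub>Hp\<^esub> c_R \<otimes>\<^bsub>Hp\<^esub> c_K
    = c_K \<otimes>\<^bsub>Hp\<^esub> c_R \<otimes>\<^bsub>Hp\<^esub> c_K \<otimes>\<^bsub>Hp\<^esub> c_R"
proof -
  have "hecke_class \<iota> q (Poly_Mapping.single [GenR, GenK, GenR, GenK] 1)
    = hecke_class \<iota> q (Poly_Mapping.single [GenK, GenR, GenK, GenR] 1)"
    by (rule hecke_class_eqI[OF hecke_rels_ideal]) simp
  then show ?thesis
    unfolding cyc_R_def cyc_K_def cyc_class_mult by (simp add: cyc_class_def)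
qed

lemma R_inv: "inv\<^bsub>Hp\<^esub> c_R = c_R \<ominus>\<^bsub>Hp\<^esub> c_scalar (\<iota> om)"
proof (rule H.inv_char)
  show "c_R \<otimes>\<^bsub>Hp\<^esub> (c_R \<ominus>\<^bsub>Hp\<^esub> c_scalar (\<iota> om)) = \<one>\<^bsub>Hp\<^esub>"
    by (simp add: H.minus_eq H.r_distr H.r_minus R_R R_scalar)
      (simp add: H.a_comm[of "c_scalar (\<iota> om) \<otimes>\<^bsub>Hp\<^esub> c_R"] H.a_assoc H.r_neg)
  show "(c_R \<ominus>\<^bsub>Hp\<^esub> c_scalar (\<iota> om)) \<otimes>\<^bsub>Hp\<^esub> c_R = \<one>\<^bsub>Hp\<^esub>"
    by (simp add: H.minus_eq H.l_distr H.l_minus R_R)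
      (simp add: H.a_comm[of "c_scalar (\<iota> om) \<otimes>\<^bsub>Hp\<^esub> c_R"] H.a_assoc H.r_neg)
qed auto

lemma K_p_gens: "insert c_K (range c_scalar) \<subseteq> carrier Hp"
  by auto

sublocale Kp: ring Kp
  unfolding K_p_def by (rule H.generate_ring_is_ring[OF K_p_gens])

lemma K_p_simps [simp]:
  "a \<otimes>\<^bsub>Kp\<^esub> b = a \<otimes>\<^bsub>Hp\<^esub> b" "a \<oplus>\<^bsub>Kp\<^esub> b = a \<oplus>\<^bsub>Hp\<^esub> b"
  "\<one>\<^bsub>Kp\<^esub> = \<one>\<^bsub>Hp\<^esub>" "\<zero>\<^bsub>Kp\<^esub> = \<zero>\<^bsub>Hp\<^esub>"
  "c \<odot>\<^bsub>Kp\<^esub> a = c \<odot>\<^bsub>Hp\<^esub> a"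
  by (simp_all add: K_p_def)

lemma K_p_carrier: "carrier Kp = generate_ring Hp (insert c_K (range c_scalar))"
  by (simp add: K_p_def)

lemma K_p_closed [simp, intro]: "c_K \<in> carrier Kp" "c_scalar c \<in> carrier Kp"
  unfolding K_p_carrier by (auto intro: generate_ring.incl)

lemma K_p_sub: "a \<in> carrier Kp \<Longrightarrow> a \<in> carrier Hp"
  unfolding K_p_carrier using H.generate_ring_incl[OF K_p_gens] by blast

lemma H_smult: "c \<odot>\<^bsub>Hp\<^esub> a = c_scalar (\<iota> c) \<otimes>\<^bsub>Hp\<^esub> a"
  by (simp add: H_p_def)

sublocale KK: poly_eval Kp c_scalar c_K
  by unfold_locales (simp_all add: HK.hom_add HK.hom_mult HK.hom_one HK.u_comm)

sublocale Zx: algebra_pair "z_alg \<iota>" k_x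
  by (rule algebra_pair.intro[OF ring_z_alg ring_k_x]) simp_all

sublocale Kx: algebra_pair Kp k_x
  by (rule algebra_pair.intro[OF Kp.ring_axioms ring_k_x])
    (use Kp.m_closed in \<open>simp_all add: H_smult\<close>)

sublocale Hxy: algebra_pair Hp k_xy
  by (rule algebra_pair.intro[OF H.ring_axioms ring_k_xy]) (simp_all add: H_smult)

sublocale sc: tensor_map_pair "z_alg \<iota>" k_x Kp k_x c_scalar id
proof (rule tensor_map_pair.intro[OF Zx.algebra_pair_axioms Kx.algebra_pair_axioms],
    rule tensor_map_pair_axioms.intro)
  show "c_scalar \<in> ring_hom (z_alg \<iota>) Kp"
    by (rule ring_hom_memI) (simp_all add: HK.hom_add HK.hom_mult HK.hom_one)
  show "id \<in> ring_hom k_x k_x" by (rule ring_hom_memI) simp_all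
qed (simp_all add: H_smult HK.hom_mult)

lemma tensor_map_pair_xy:
  assumes "\<And>r s. g (r + s) = g r + g s" "\<And>r s. g (r * s) = g r * g s" "g 1 = 1"
    and "\<And>c. g (Fract [:c:] 1) = Fract [:[:c:]:] 1"
  shows "tensor_map_pair Kp k_x Hp k_xy id g"
proof (rule tensor_map_pair.intro[OF Kx.algebra_pair_axioms Hxy.algebra_pair_axioms],
    rule tensor_map_pair_axioms.intro)
  show "id \<in> ring_hom Kp Hp"
    by (rule ring_hom_memI) (simp_all add: K_p_sub)
  show "g \<in> ring_hom k_x k_xy" by (rule ring_hom_memI) (simp_all add: assms)
qed (simp_all add: assms)

sublocale tx: tensor_map_pair Kp k_x Hp k_xy id at_x
  by (rule tensor_map_pair_xy) (simp_all add: at_x_simps)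

sublocale ty: tensor_map_pair Kp k_x Hp k_xy id at_y
  by (rule tensor_map_pair_xy) (simp_all add: at_y_simps lift_v_const)

section \<open>Action on double sequences and scalars in rational functions\<close>

text \<open>The sequences take values in the fraction field of z[x,y], into which both
  \<open>z\<close> and k(x,y) embed.\<close>

definition emb :: "'z \<Rightarrow> 'z poly poly fract" where "emb c = Fract [:[:c:]:] 1"

lemma emb_simps: "emb (a + b) = emb a + emb b" "emb (a * b) = emb a * emb b" "emb 1 = 1" "emb 0 = 0"
  by (simp_all add: emb_def One_fract_def Zero_fract_def pCons_one)

sublocale rep: double_seq_rep "emb (\<iota> om)" "map_poly emb p" .

abbreviation scl where "scl c \<equiv> rep.restr (scale_op c)"

definition gen_op where
  "gen_op g = (case g of GenR \<Rightarrow> rep.restr rep.R_op | GenK \<Rightarrow> rep.restr rep.K_op)"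

definition word_op where "word_op ws = foldr (\<lambda>g F. gen_op g \<otimes>\<^bsub>rep.T\<^esub> F) ws \<one>\<^bsub>rep.T\<^esub>"

lemma gen_op_closed: "gen_op g \<in> carrier rep.T"
  by (simp add: gen_op_def rep.R_op_T rep.K_op_T split: gen.split)

lemma word_op_closed: "word_op ws \<in> carrier rep.T"
  by (induction ws) (simp_all add: word_op_def gen_op_closed rep.T.m_closed del: endo_ring_simps)

lemma word_op_append: "word_op (us @ ws) = word_op us \<otimes>\<^bsub>rep.T\<^esub> word_op ws"
proof (induction us)
  case Nil
  show ?case using word_op_closed by (simp add: word_op_def[of "[]"] rep.T.l_one del: endo_ring_simps)
next
  case (Cons g us)
  then show ?case
    using word_op_closed[of us] word_op_closed[of ws] gen_op_closed[of g]
    by (simp add: word_op_def rep.T.m_assoc del: endo_ring_simps)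
qed

sublocale act: monoid_ring_hom rep.T word_monoid "\<lambda>c. scl (emb c)" word_op
proof (rule monoid_ring_hom.intro[OF rep.T.ring_axioms monoid_words], rule monoid_ring_hom_axioms.intro)
  show "word_op \<one>\<^bsub>word_monoid\<^esub> = \<one>\<^bsub>rep.T\<^esub>" by (simp add: word_op_def del: endo_ring_simps)
  show "scl (emb c) \<otimes>\<^bsub>rep.T\<^esub> word_op a = word_op a \<otimes>\<^bsub>rep.T\<^esub> scl (emb c)" for a c
    by (rule rep.scale_central[OF word_op_closed])
qed (simp_all only: emb_simps rep.scale.hom_add rep.scale.hom_mult rep.scale.hom_one rep.scale.closed
    word_op_closed monoid.simps word_op_append)

abbreviation act where "act \<equiv> monoid_ring_lift rep.T (\<lambda>c. scl (emb c)) word_op"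

lemma act_hom: "act \<in> ring_hom free_alg rep.T"
  unfolding free_alg_def by (rule act.lift_hom)

sublocale acth: ring_hom_ring free_alg rep.T act
  by (rule ring_hom_ringI2[OF free.ring_axioms rep.T.ring_axioms act_hom])

lemma act_single: "act (Poly_Mapping.single ws c) = scl (emb c) \<otimes>\<^bsub>rep.T\<^esub> word_op ws"
  by (rule act.lift_single) simp

lemma act_gens: "act (Poly_Mapping.single [GenR] 1) = rep.restr rep.R_op"
  "act (Poly_Mapping.single [GenK] 1) = rep.restr rep.K_op"
  "act (Poly_Mapping.single [] c) = scl (emb c)"
proof -
  have "word_op [g] = gen_op g" for g
    using gen_op_closed[of g] by (simp add: word_op_def rep.T.r_one del: endo_ring_simps)
  then show "act (Poly_Mapping.single [GenR] 1) = rep.restr rep.R_op"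
    "act (Poly_Mapping.single [GenK] 1) = rep.restr rep.K_op"
    using gen_op_closed
    by (simp_all add: act_single emb_simps rep.scale.hom_one rep.T.l_one del: endo_ring_simps)
      (simp_all add: gen_op_def)
  show "act (Poly_Mapping.single [] c) = scl (emb c)"
    by (simp add: act_single word_op_def[of "[]"] rep.T.r_one rep.scale.closed del: endo_ring_simps)
qed

lemma act_diff: "act f = act g \<Longrightarrow> act (f - g) = \<zero>\<^bsub>rep.T\<^esub>"
  using acth.hom_add[of "f - g" g] acth.hom_closed[of "f - g"] acth.hom_closed[of g]
  by (simp del: endo_ring_simps)

lemma act_split: "act (Poly_Mapping.single (us @ ws) 1) = act (Poly_Mapping.single us 1) \<otimes>\<^bsub>rep.T\<^esub> act (Poly_Mapping.single ws 1)"
  using acth.hom_mult[of "Poly_Mapping.single us 1" "Poly_Mapping.single ws 1"] by (simp del: endo_ring_simps)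

lemma act_rels: "r \<in> hecke_rels \<Longrightarrow> act r = \<zero>\<^bsub>rep.T\<^esub>"
proof -
  have "act (Poly_Mapping.single [GenR, GenR] 1)
    = act (Poly_Mapping.single [GenR] (\<iota> om) + Poly_Mapping.single [] 1)"
    using act_split[of "[GenR]" "[GenR]"] acth.hom_add[of "Poly_Mapping.single [GenR] (\<iota> om)" "Poly_Mapping.single [] 1"]
      acth.hom_mult[of "Poly_Mapping.single [] (\<iota> om)" "Poly_Mapping.single [GenR] 1"]
    by (simp add: act_gens rep.quadratic emb_simps rep.scale.hom_one del: endo_ring_simps)
  moreover have "act (Poly_Mapping.single [GenR, GenK, GenR, GenK] 1)
    = act (Poly_Mapping.single [GenK, GenR, GenK, GenR] 1)"
    using act_split[of "[GenR]" "[GenK, GenR, GenK]"] act_split[of "[GenK]" "[GenR, GenK]"]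
      act_split[of "[GenR]" "[GenK]"] act_split[of "[GenK]" "[GenR, GenK, GenR]"]
      act_split[of "[GenR]" "[GenK, GenR]"] act_split[of "[GenK]" "[GenR]"] rep.braid
    by (simp add: act_gens rep.T.m_assoc rep.R_op_T rep.K_op_T del: endo_ring_simps)
  ultimately show "r \<in> hecke_rels \<Longrightarrow> act r = \<zero>\<^bsub>rep.T\<^esub>"
    by (auto simp: om_def simp del: endo_ring_simps intro!: act_diff)
qed

text \<open>\<open>H_p\<close> is a quotient of a quotient, so the action descends in two stages:
  here past the Hecke relations, in \<open>act_c\<close> past p(K).\<close>

definition act_h where "act_h U = the_elem (act ` U)"

lemma act_h: "act_h \<in> ring_hom (hecke \<iota> q) rep.T" "act_h (hecke_class \<iota> q f) = act f"
proof -
  note * = genideal_quot_lift[OF free.ring_axioms rep.T.ring_axioms act_hom, of hecke_rels, OF _ act_rels]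
  show "act_h \<in> ring_hom (hecke \<iota> q) rep.T"
    unfolding hecke_def hecke_ideal_def act_h_def[abs_def] by (rule *(1)) simp
  show "act_h (hecke_class \<iota> q f) = act f"
    unfolding act_h_def hecke_class_def hecke_ideal_def by (rule *(2)) simp_all
qed

lemma K_ev_emb: "poly_ev rep.T (\<lambda>c. scl (emb c)) (rep.restr rep.K_op) p = \<zero>\<^bsub>rep.T\<^esub>"
proof -
  have "poly_eval rep.T (\<lambda>c. scl (emb c)) (rep.restr rep.K_op)"
    using free_to_ring(2)[OF act_hom rep.T.ring_axioms] by (simp only: act_gens)
  from rep.K.ev_map_poly[OF emb_simps(4) this HOL.refl, of p] rep.K_ev_p show ?thesis by (simp only:)
qed

lemma act_h_p: "act_h (hecke_poly_K \<iota> q p) = \<zero>\<^bsub>rep.T\<^esub>"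
proof -
  have "poly_eval rep.T (\<lambda>c. scl (emb c)) (rep.restr rep.K_op)"
    using free_to_ring(2)[OF act_hom rep.T.ring_axioms] by (simp only: act_gens)
  from hK.ev_natural[OF act_h(1) this] show ?thesis
    unfolding hecke_poly_K_eq by (simp only: act_h(2) act_gens K_ev_emb)
qed

definition act_c where "act_c U = the_elem (act_h ` U)"

lemma act_c: "act_c \<in> ring_hom Hp rep.T" "act_c (cyc_class \<iota> q p f) = act f"
proof -
  note * = genideal_quot_lift[OF hecke.ring_axioms rep.T.ring_axioms act_h(1), of "{hecke_poly_K \<iota> q p}"]
  have sub: "{hecke_poly_K \<iota> q p} \<subseteq> carrier (hecke \<iota> q)" by (simp add: hecke_poly_K_eq)
  have "act_c \<in> ring_hom Hq rep.T"
    unfolding cyc_ideal_def act_c_def[abs_def] by (rule *(1)[OF sub]) (simp add: act_h_p del: endo_ring_simps)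
  then show "act_c \<in> ring_hom Hp rep.T" by (simp add: ring_hom_def H_p_def)
  have "act_c (cyc_class \<iota> q p f) = act_h (hecke_class \<iota> q f)"
    unfolding act_c_def cyc_class_def cyc_ideal_def
  proof (rule *(2)[OF sub])
    show "hecke_class \<iota> q f \<in> carrier (hecke \<iota> q)"
      using hecke_class_hom by (auto simp: ring_hom_def)
  qed (simp add: act_h_p del: endo_ring_simps)
  then show "act_c (cyc_class \<iota> q p f) = act f" by (simp only: act_h(2))
qed

lemma map_\<iota>:
  "map_poly \<iota> (f + g) = map_poly \<iota> f + map_poly \<iota> g" "map_poly \<iota> (f * g) = map_poly \<iota> f * map_poly \<iota> g"
  "map_poly \<iota> 1 = 1" "map_poly \<iota> f = 0 \<longleftrightarrow> f = 0"
  by (rule map_poly_hom; simp add: \<iota>_simps \<iota>_eq_0_iff)+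

lemma map_map_\<iota>:
  "map_poly (map_poly \<iota>) (f + g) = map_poly (map_poly \<iota>) f + map_poly (map_poly \<iota>) g"
  "map_poly (map_poly \<iota>) (f * g) = map_poly (map_poly \<iota>) f * map_poly (map_poly \<iota>) g"
  "map_poly (map_poly \<iota>) 1 = 1" "map_poly (map_poly \<iota>) f = 0 \<longleftrightarrow> f = 0"
  by (rule map_poly_hom; simp add: map_\<iota>)+

definition emb_xy where "emb_xy = fract_map (map_poly (map_poly \<iota>))"
definition emb_x where "emb_x = fract_map (map_poly \<iota>)"

lemma emb_xy_simps:
  "emb_xy (r + s) = emb_xy r + emb_xy s" "emb_xy (r * s) = emb_xy r * emb_xy s" "emb_xy 1 = 1"
  "emb_xy (Fract a 1) = Fract (map_poly (map_poly \<iota>) a) 1"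
  unfolding emb_xy_def by (rule fract_map_hom; simp add: map_map_\<iota>)+

lemma emb_x_simps:
  "emb_x (r + s) = emb_x r + emb_x s" "emb_x (r * s) = emb_x r * emb_x s" "emb_x 1 = 1"
  "emb_x (Fract a 1) = Fract (map_poly \<iota> a) 1"
  unfolding emb_x_def by (rule fract_map_hom; simp add: map_\<iota>)+

sublocale rho: tensor_lift Hp k_xy rep.T "\<lambda>i. scl (of_int i)" act_c "\<lambda>b. scl (emb_xy b)"
proof (rule tensor_lift.intro[OF Hxy.algebra_pair_axioms rep.T.ring_axioms], rule tensor_lift_axioms.intro)
  show "(\<lambda>b. scl (emb_xy b)) \<in> ring_hom k_xy rep.T"
    by (rule ring_hom_memI)
      (simp_all add: emb_xy_simps rep.scale.hom_add rep.scale.hom_mult rep.scale.hom_one del: endo_ring_simps)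
  show "scl (of_int i) \<otimes>\<^bsub>rep.T\<^esub> F = F \<otimes>\<^bsub>rep.T\<^esub> scl (of_int i)" if "F \<in> carrier rep.T" for i F
    by (rule rep.scale_central[OF that])
  fix a b r assume a: "a \<in> carrier Hp"
  then have ca: "act_c a \<in> carrier rep.T" using act_c(1) by (auto simp: ring_hom_def)
  show "act_c a \<otimes>\<^bsub>rep.T\<^esub> scl (emb_xy b) = scl (emb_xy b) \<otimes>\<^bsub>rep.T\<^esub> act_c a"
    by (rule rep.scale_central[OF ca, symmetric])
  have "emb (\<iota> r) = emb_xy (Fract [:[:r:]:] 1)"
    by (simp add: emb_def emb_xy_simps map_poly_pCons)
  then have "act_c (r \<odot>\<^bsub>Hp\<^esub> a) = scl (emb_xy (Fract [:[:r:]:] 1)) \<otimes>\<^bsub>rep.T\<^esub> act_c a"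
    using ring_hom_mult[OF act_c(1) gen_closed(1) a, of "\<iota> r"]
    by (simp add: H_smult act_c(2) act_gens cyc_scalar_eta del: endo_ring_simps)
  then show "act_c (r \<odot>\<^bsub>Hp\<^esub> a) \<otimes>\<^bsub>rep.T\<^esub> scl (emb_xy b)
    = act_c a \<otimes>\<^bsub>rep.T\<^esub> scl (emb_xy (r \<odot>\<^bsub>k_xy\<^esub> b))"
    by (simp add: rep.scale_central[OF ca] emb_xy_simps rep.scale.hom_mult rep.T.m_assoc ca rep.scale.closed
        del: endo_ring_simps)
qed (simp_all add: act_c(1) rep.scale.hom_add rep.scale.hom_mult rep.scale.hom_one rep.scale.closed
    del: endo_ring_simps)

abbreviation rho where "rho \<equiv> rho.lift"

text \<open>The map from z(x), a tensor product, to the fraction field of z[x]. It shows in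
  \<open>zx_eq_0\<close> that z[x] embeds into z(x).\<close>

sublocale ex: tensor_lift "z_alg \<iota>" k_x "ring_of_type_algebra :: 'z poly fract ring" of_int "\<lambda>c. Fract [:c:] 1" emb_x
proof (rule tensor_lift.intro[OF Zx.algebra_pair_axioms ring_from_type_algebra], rule tensor_lift_axioms.intro)
  show "(\<lambda>c. Fract [:c:] 1) \<in> ring_hom (z_alg \<iota>) (ring_of_type_algebra :: 'z poly fract ring)"
    by (rule ring_hom_memI) (simp_all add: One_fract_def pCons_one mult.commute)
  show "emb_x \<in> ring_hom k_x (ring_of_type_algebra :: 'z poly fract ring)"
    by (rule ring_hom_memI) (simp_all add: emb_x_simps)
qed (simp_all add: emb_x_simps map_poly_pCons mult.commute)

section \<open>Polynomial scalars\<close>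

abbreviation Z where "Z \<equiv> z_of_x \<iota>"
abbreviation M where "M \<equiv> K_p_of_x \<iota> q p"
abbreviation S where "S \<equiv> H_p_of_xy \<iota> q p"

lemma Z_tensor: "tensor (z_alg \<iota>) k_x = Z" and M_tensor: "tensor Kp k_x = M"
  and S_tensor: "tensor Hp k_xy = S"
  by (simp_all add: z_of_x_def K_p_of_x_def H_p_of_xy_def)

sublocale Z: ring Z using Zx.tensor.ring_axioms unfolding Z_tensor .
sublocale M: ring M using Kx.tensor.ring_axioms unfolding M_tensor .
sublocale S: ring S using Hxy.tensor.ring_axioms unfolding S_tensor .

lemmas Zpt = Zx.pt_closed[unfolded Z_tensor] Zx.pt_mult[unfolded Z_tensor]
lemmas Mpt = Kx.pt_closed[unfolded M_tensor] Kx.pt_mult[unfolded M_tensor]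
lemmas Spt = Hxy.pt_closed[unfolded S_tensor] Hxy.pt_mult[unfolded S_tensor]

sublocale z0: type_hom Z "\<lambda>c. Zx.pt c 1"
  by unfold_locales (simp_all add: Zpt Zx.pt_add_left[unfolded Z_tensor, simplified]
      Zx.pt_one[unfolded Z_tensor, simplified])

text \<open>Maps out of polynomial rings: \<open>zx\<close> and \<open>mx\<close> send z[x] to z(x)
  and to \<open>K_p(x)\<close>, \<open>mK\<close> sends z[x][u] to \<open>K_p(x)\<close> with u
  going to \<open>K\<close>, while \<open>sx\<close> and \<open>sxy\<close> send z[x] and z[x,y] to
  \<open>H_p(x,y)\<close>.\<close>

sublocale zx: poly_eval Z "\<lambda>c. Zx.pt c 1" "Zx.pt 1 var_x"
  by unfold_locales (simp_all add: Zpt)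

abbreviation zx where "zx \<equiv> poly_ev Z (\<lambda>c. Zx.pt c 1) (Zx.pt 1 var_x)"

sublocale m0: type_hom M "\<lambda>c. Kx.pt (c_scalar c) 1"
  by unfold_locales (simp_all add: Mpt HK.hom_add HK.hom_mult HK.hom_one
     Kx.pt_add_left[unfolded M_tensor, simplified] Kx.pt_one[unfolded M_tensor, simplified])

sublocale mx: poly_eval M "\<lambda>c. Kx.pt (c_scalar c) 1" "Kx.pt \<one>\<^bsub>Hp\<^esub> var_x"
  using Kp.one_closed by unfold_locales (simp_all add: Mpt)

abbreviation mx where "mx \<equiv> poly_ev M (\<lambda>c. Kx.pt (c_scalar c) 1) (Kx.pt \<one>\<^bsub>Hp\<^esub> var_x)"

sublocale mK: poly_eval M mx "Kx.pt c_K 1"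
proof unfold_locales
  show "Kx.pt c_K 1 \<otimes>\<^bsub>M\<^esub> mx a = mx a \<otimes>\<^bsub>M\<^esub> Kx.pt c_K 1" for a
    using Kp.one_closed by (intro mx.ev_comm) (simp_all add: Mpt HK.u_comm)
qed (simp_all add: Mpt)

abbreviation mK where "mK \<equiv> poly_ev M mx (Kx.pt c_K 1)"

sublocale s0: type_hom S "\<lambda>c. Hxy.pt (c_scalar c) 1"
  by unfold_locales (simp_all add: Spt HK.hom_add HK.hom_mult HK.hom_one
     Hxy.pt_add_left[unfolded S_tensor, simplified] Hxy.pt_one[unfolded S_tensor, simplified])

lemma poly_eval_S: "poly_eval S (\<lambda>c. Hxy.pt (c_scalar c) 1) (Hxy.pt \<one>\<^bsub>Hp\<^esub> b)"
  by unfold_locales (simp_all add: Spt)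

sublocale sx: poly_eval S "\<lambda>c. Hxy.pt (c_scalar c) 1" "Hxy.pt \<one>\<^bsub>Hp\<^esub> var2_x"
  by (rule poly_eval_S)

abbreviation sx where "sx \<equiv> poly_ev S (\<lambda>c. Hxy.pt (c_scalar c) 1) (Hxy.pt \<one>\<^bsub>Hp\<^esub> var2_x)"

sublocale sxy: poly_eval S sx "Hxy.pt \<one>\<^bsub>Hp\<^esub> var2_y"
proof unfold_locales
  show "Hxy.pt \<one>\<^bsub>Hp\<^esub> var2_y \<otimes>\<^bsub>S\<^esub> sx a = sx a \<otimes>\<^bsub>S\<^esub> Hxy.pt \<one>\<^bsub>Hp\<^esub> var2_y" for a
    by (intro sx.ev_comm) (simp_all add: Spt mult.commute)
qed (simp_all add: Spt)

abbreviation sxy where "sxy \<equiv> poly_ev S sx (Hxy.pt \<one>\<^bsub>Hp\<^esub> var2_y)"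

lemma sxy_comm:
  assumes "a \<in> carrier Hp" "\<And>c. a \<otimes>\<^bsub>Hp\<^esub> c_scalar c = c_scalar c \<otimes>\<^bsub>Hp\<^esub> a"
  shows "Hxy.pt a b \<otimes>\<^bsub>S\<^esub> sxy f = sxy f \<otimes>\<^bsub>S\<^esub> Hxy.pt a b"
  using assms by (intro sxy.ev_comm sx.ev_comm) (simp_all add: Spt mult.commute)

definition w :: "'z poly poly" where "w = [:[:\<iota> om:]:]"

lemma sxy_const: "sxy [:[:c:]:] = Hxy.pt (c_scalar c) 1"
  by (simp add: sxy.ev_const sx.ev_const)

sublocale hr: hecke_ring S sxy "Hxy.pt c_R 1" "Hxy.pt c_K 1" w
proof (rule hecke_ring.intro[OF sxy.ev.type_hom_axioms], rule hecke_ring_axioms.intro)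
  show "Hxy.pt c_R 1 \<otimes>\<^bsub>S\<^esub> Hxy.pt c_R 1 = sxy w \<otimes>\<^bsub>S\<^esub> Hxy.pt c_R 1 \<oplus>\<^bsub>S\<^esub> \<one>\<^bsub>S\<^esub>"
    unfolding w_def sxy_const
    by (simp add: Spt R_R Hxy.pt_add_left[unfolded S_tensor, simplified] Hxy.pt_one[unfolded S_tensor, simplified])
qed (simp_all add: Spt R_K_braid sxy_comm R_scalar HK.u_comm)

lemma rho_hom: "rho \<in> ring_hom S rep.T"
  using rho.lift_hom unfolding S_tensor .

sublocale rhoh: ring_hom_ring S rep.T rho
  by (rule ring_hom_ringI2[OF S.ring_axioms rep.T.ring_axioms rho_hom])

lemma rho_pt: "a \<in> carrier Hp \<Longrightarrow> rho (Hxy.pt a b) = act_c a \<otimes>\<^bsub>rep.T\<^esub> scl (emb_xy b)"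
  by (rule rho.lift_pt) simp_all

lemma rho_scalar: "rho (Hxy.pt (c_scalar c) 1) = scl (emb c)"
  by (simp add: rho_pt emb_xy_simps rep.scale.hom_one rep.T.r_one rep.scale.closed cyc_scalar_eta
      act_c(2) act_gens del: endo_ring_simps)

lemma rho_var: "rho (Hxy.pt \<one>\<^bsub>Hp\<^esub> b) = scl (emb_xy b)"
  by (simp add: rho_pt rep.T.l_one rep.scale.closed del: endo_ring_simps)

lemma rho_sx: "rho (sx a) = scl (Fract [:a:] 1)"
proof (induction a)
  case 0
  show ?case using rep.scale.hom_zero by (simp add: Zero_fract_def del: endo_ring_simps)
next
  case (pCons c a)
  have "Fract [:pCons c a:] 1 = emb c + emb_xy var2_x * Fract [:a:] 1"
    by (simp add: emb_def var2_x_def emb_xy_simps map_poly_pCons map_\<iota> \<iota>_simps)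
  with pCons show ?case
    by (simp add: sx.ev_pCons rho_scalar rho_var rep.scale.hom_add rep.scale.hom_mult Spt del: endo_ring_simps)
qed

lemma rho_sxy: "rho (sxy a) = scl (Fract a 1)"
proof (induction a)
  case 0
  show ?case using rep.scale.hom_zero by (simp add: Zero_fract_def del: endo_ring_simps)
next
  case (pCons c a)
  have "Fract (pCons c a) 1 = Fract [:c:] 1 + emb_xy var2_y * Fract a 1"
    by (simp add: var2_y_def emb_xy_simps map_poly_pCons map_\<iota> \<iota>_simps)
  with pCons show ?case
    by (simp add: sxy.ev_pCons rho_sx rho_var rep.scale.hom_add rep.scale.hom_mult Spt del: endo_ring_simps)
qed

text \<open>This takes the place of the independence of the \<open>K^i R K^j\<close>. The test
  vector has the product of two shifts of \<open>t\<close> as first entry and 0 as second; it lies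
  in \<open>V\<close> because \<open>t\<close> satisfies the recurrence of \<open>p\<close>.\<close>

lemma sandwich_eq_0_imp_moments:
  assumes t: "moment_seq p n t" and "hr.sandwich m = \<zero>\<^bsub>S\<^esub>"
  shows "mom2 (shift (moment_seq.tcc t) j) (shift (moment_seq.tcc t) l) m = 0"
proof -
  interpret t: moment_seq p n t by fact
  let ?e = "\<lambda>a :: 'z poly poly. Fract a 1"
  define \<alpha> \<beta> where "\<alpha> = shift t.tcc j" and "\<beta> = shift t.tcc l"
  let ?v = "(\<lambda>i k. ?e (\<beta> i) * ?e (\<alpha> k), \<lambda>i k. 0)"
  have e: "?e 0 = 0" "\<And>a b. ?e (a + b) = ?e a + ?e b" "\<And>a b. ?e (a * b) = ?e a * ?e b"
    by (simp_all add: Zero_fract_def)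
  have rc: "mom (\<lambda>k. ?e (shift t.tcc j (i + k))) (map_poly emb p) = 0" for i j
  proof -
    have "mom (\<lambda>k. emb (shift t (j + i) k)) (map_poly emb p) = emb (mom (shift t (j + i)) p)"
      by (rule mom_hom) (simp_all add: emb_simps)
    then show ?thesis unfolding t.recur
      by (simp add: emb_simps(4)) (simp add: emb_def t.tcc_def shift_def ac_simps)
  qed
  have v: "?v \<in> rep.V"
    unfolding rep.V_def rec_seq_def
    by (simp add: mom_seq_0 mom_seq_scale rc[of l, folded \<beta>_def] rc[of j, folded \<alpha>_def]
       mult.commute[of "Fract (\<beta> _) 1" "Fract (\<alpha> _) 1"] del: mult_fract)
      (simp add: mult.commute mom_seq_scale rc[of j, folded \<alpha>_def] del: mult_fract)
  have "rep.coord 0 (rho (hr.sandwich m) ?v)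
      = mom2 (\<lambda>k. ?e (\<alpha> k)) (\<lambda>k. ?e (\<beta> k)) (map_poly (map_poly ?e) m)"
  proof (rule rep.coord_sandwich[where e = ?e, OF hr.hecke_ring_axioms rho_hom _ _ rho_sxy e(1) v])
    show "rho (Hxy.pt c_R 1) = rep.restr rep.R_op" "rho (Hxy.pt c_K 1) = rep.restr rep.K_op"
      by (simp_all add: rho_pt emb_xy_simps rep.scale.hom_one rep.T.r_one rep.R_op_T rep.K_op_T
        cyc_R_def cyc_K_def act_c(2) act_gens del: endo_ring_simps)
  qed simp
  then have "mom2 (\<lambda>k. ?e (\<alpha> k)) (\<lambda>k. ?e (\<beta> k)) (map_poly (map_poly ?e) m) = 0"
    unfolding assms(2) rhoh.hom_zero by (simp add: rep.coord_def)
  then have "?e (mom2 \<alpha> \<beta> m) = 0" by (simp only: mom2_hom[OF e])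
  then show ?thesis by (simp add: \<alpha>_def \<beta>_def Zero_fract_def eq_fract)
qed

section \<open>Clearing denominators in the reflection equation\<close>

lemma S_central: "U \<in> carrier S \<Longrightarrow>
    Hxy.pt \<one>\<^bsub>Hp\<^esub> b \<otimes>\<^bsub>S\<^esub> U = U \<otimes>\<^bsub>S\<^esub> Hxy.pt \<one>\<^bsub>Hp\<^esub> b"
  using Hxy.pt_one_central[of b U] unfolding S_tensor by (simp add: mult.commute)

lemma S_cancel: "b \<noteq> 0 \<Longrightarrow> U \<in> carrier S \<Longrightarrow> V \<in> carrier S \<Longrightarrow>
    Hxy.pt \<one>\<^bsub>Hp\<^esub> b \<otimes>\<^bsub>S\<^esub> U = Hxy.pt \<one>\<^bsub>Hp\<^esub> b \<otimes>\<^bsub>S\<^esub> V \<Longrightarrow> U = V"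
  using Hxy.pt_one_cancel[of b "inverse b" U V] unfolding S_tensor by simp

lemma M_central: "U \<in> carrier M \<Longrightarrow>
    Kx.pt \<one>\<^bsub>Hp\<^esub> b \<otimes>\<^bsub>M\<^esub> U = U \<otimes>\<^bsub>M\<^esub> Kx.pt \<one>\<^bsub>Hp\<^esub> b"
  using Kx.pt_one_central[of b U] unfolding M_tensor by (simp add: mult.commute)

lemma M_cancel: "b \<noteq> 0 \<Longrightarrow> U \<in> carrier M \<Longrightarrow> V \<in> carrier M \<Longrightarrow>
    Kx.pt \<one>\<^bsub>Hp\<^esub> b \<otimes>\<^bsub>M\<^esub> U = Kx.pt \<one>\<^bsub>Hp\<^esub> b \<otimes>\<^bsub>M\<^esub> V \<Longrightarrow> U = V"
  using Kx.pt_one_cancel[of b "inverse b" U V] unfolding M_tensor by simp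

lemma Z_central: "U \<in> carrier Z \<Longrightarrow> Zx.pt 1 b \<otimes>\<^bsub>Z\<^esub> U = U \<otimes>\<^bsub>Z\<^esub> Zx.pt 1 b"
  using Zx.pt_one_central[of b U] unfolding Z_tensor by (simp add: mult.commute)

lemma Z_cancel: "b \<noteq> 0 \<Longrightarrow> U \<in> carrier Z \<Longrightarrow> V \<in> carrier Z \<Longrightarrow>
    Zx.pt 1 b \<otimes>\<^bsub>Z\<^esub> U = Zx.pt 1 b \<otimes>\<^bsub>Z\<^esub> V \<Longrightarrow> U = V"
  using Zx.pt_one_cancel[of b "inverse b" U V] unfolding Z_tensor by simp

abbreviation tm_x where "tm_x \<equiv> tensor_map Hp k_xy id at_x"
abbreviation tm_y where "tm_y \<equiv> tensor_map Hp k_xy id at_y"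

lemma tm_hom: "tm_x \<in> ring_hom M S" "tm_y \<in> ring_hom M S"
  using tx.tensor_map_hom ty.tensor_map_hom unfolding M_tensor S_tensor .

lemma tm_pt: "a \<in> carrier Kp \<Longrightarrow> tm_x (Kx.pt a b) = Hxy.pt a (at_x b)"
  "a \<in> carrier Kp \<Longrightarrow> tm_y (Kx.pt a b) = Hxy.pt a (at_y b)"
  using tx.tensor_map_pt[of a b] ty.tensor_map_pt[of a b] by simp_all

lemma one_K_p [simp]: "\<one>\<^bsub>Hp\<^esub> \<in> carrier Kp"
  using Kp.one_closed by simp

lemma sxy_eq: "sxy [:a:] = sx a" "sxy (lift_v a) = poly_ev S (\<lambda>c. Hxy.pt (c_scalar c) 1) (Hxy.pt \<one>\<^bsub>Hp\<^esub> var2_y) a"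
  unfolding lift_v_def
  by (rule sxy.ev_const, rule sxy.ev_map_poly[OF _ poly_eval_S]) (simp_all add: sx.ev_const)

lemma tm_mx: "tm_x (mx a) = sxy [:a:]" "tm_y (mx a) = sxy (lift_v a)"
proof -
  show "tm_x (mx a) = sxy [:a:]" unfolding sxy_eq
    by (rule mx.ev_natural[OF tm_hom(1) poly_eval_S])
      (simp_all add: tm_pt at_x_simps var_x_def var2_x_def)
  show "tm_y (mx a) = sxy (lift_v a)" unfolding sxy_eq
    by (rule mx.ev_natural[OF tm_hom(2) poly_eval_S])
      (simp_all add: tm_pt at_y_simps var_x_def var2_y_def lift_v_pCons pCons_one)
qed

lemma tm_mK: "tm_x (mK f) = hr.ev (lift_v f)" "tm_y (mK f) = hr.ev (map_poly lift_v f)"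
proof -
  have px: "poly_eval S (\<lambda>a. sxy [:a:]) (Hxy.pt c_K 1)"
    by unfold_locales
      (simp_all add: sxy_eq sx.ev_add sx.ev_mult sx.ev.hom_one Spt hr.K_comm[of "[:_:]", unfolded sxy_eq])
  have py: "poly_eval S (\<lambda>a. sxy (lift_v a)) (Hxy.pt c_K 1)"
    by unfold_locales
      (simp_all add: lift_v_add lift_v_mult sxy.ev_add sxy.ev_mult sxy.ev.hom_one Spt hr.K_comm)
  show "tm_x (mK f) = hr.ev (lift_v f)"
    unfolding lift_v_def hr.K.ev_map_poly[where h = "\<lambda>c. [:c:]", OF _ px, simplified]
    by (rule mK.ev_natural[OF tm_hom(1) px]) (simp_all add: tm_mx tm_pt at_x_simps)
  show "tm_y (mK f) = hr.ev (map_poly lift_v f)"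
    unfolding hr.K.ev_map_poly[where h = lift_v, OF _ py, simplified]
    by (rule mK.ev_natural[OF tm_hom(2) py]) (simp_all add: tm_mx tm_pt at_y_simps)
qed

lemma R_at_closed: "R_at \<iota> q p t \<in> carrier S"
  unfolding R_at_def R_inv by (simp add: Spt)

lemma pt_add_S:
  "a \<in> carrier Hp \<Longrightarrow> a' \<in> carrier Hp \<Longrightarrow> Hxy.pt (a \<oplus>\<^bsub>Hp\<^esub> a') b = Hxy.pt a b \<oplus>\<^bsub>S\<^esub> Hxy.pt a' b"
  "a \<in> carrier Hp \<Longrightarrow> Hxy.pt a (b + b') = Hxy.pt a b \<oplus>\<^bsub>S\<^esub> Hxy.pt a b'"
  "a \<in> carrier Hp \<Longrightarrow> Hxy.pt (\<ominus>\<^bsub>Hp\<^esub> a) b = \<ominus>\<^bsub>S\<^esub> Hxy.pt a b"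
  using Hxy.pt_add_left[of a a' b] Hxy.pt_add_right[of a b b'] Hxy.pt_minus_left[of a b]
  unfolding S_tensor by simp_all

lemma sxy_vars: "sxy var_u = Hxy.pt \<one>\<^bsub>Hp\<^esub> var2_x" "sxy var_v = Hxy.pt \<one>\<^bsub>Hp\<^esub> var2_y"
  by (simp_all add: sxy_eq sx.ev_var sxy.ev_var)

text \<open>Uses \<open>R^-1 = R - w\<close>. The two instances are \<open>b = x\<close>,
  \<open>c = y\<close> for R(x/y), and \<open>b = x y\<close>, \<open>c = 1\<close> for
  R(xy).\<close>

lemma R_at_aux:
  assumes "b \<noteq> 0" "c = b * inverse t"
  shows "Hxy.pt \<one>\<^bsub>Hp\<^esub> b \<otimes>\<^bsub>S\<^esub> R_at \<iota> q p t
    = Hxy.pt c_R (b - c) \<oplus>\<^bsub>S\<^esub> Hxy.pt (c_scalar (\<iota> om)) c"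
proof -
  have "Hxy.pt c_R b = Hxy.pt c_R (b - c) \<oplus>\<^bsub>S\<^esub> Hxy.pt c_R c"
    using pt_add_S(2)[of c_R "b - c" c] by simp
  then show ?thesis using assms(2)
    unfolding R_at_def R_inv H_p_of_xy_def[symmetric]
    by (simp add: S.minus_eq H.minus_eq S.r_distr S.r_minus Spt pt_add_S S.minus_add S.a_assoc S.r_neg1 S.r_neg2)
qed

lemma var2_nz: "var2_x \<noteq> (0 :: 'k poly poly fract)" "var2_y \<noteq> (0 :: 'k poly poly fract)"
  by (simp_all add: var2_x_def var2_y_def Zero_fract_def eq_fract)

lemma R_quot: "Hxy.pt \<one>\<^bsub>Hp\<^esub> var2_x \<otimes>\<^bsub>S\<^esub> R_at \<iota> q p (var2_x / var2_y)
    = sxy (var_u - var_v) \<otimes>\<^bsub>S\<^esub> Hxy.pt c_R 1 \<oplus>\<^bsub>S\<^esub> sxy (var_v * w)"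
proof -
  have 1: "sxy (var_u - var_v) = Hxy.pt \<one>\<^bsub>Hp\<^esub> (var2_x - var2_y)"
    using pt_add_S(2)[of "\<one>\<^bsub>Hp\<^esub>" "var2_x - var2_y" var2_y]
    unfolding sxy.ev.hom_diff sxy_vars by (simp add: S.minus_eq S.a_assoc S.r_neg Spt)
  have 2: "sxy (var_v * w) = Hxy.pt (c_scalar (\<iota> om)) var2_y"
    unfolding sxy.ev.hom_mult sxy_vars w_def sxy_const by (simp add: Spt)
  show ?thesis unfolding 1 2 using R_at_aux[of var2_x var2_y "var2_x / var2_y"] var2_nz
    by (simp add: Spt)
qed

lemma R_prod: "Hxy.pt \<one>\<^bsub>Hp\<^esub> (var2_x * var2_y) \<otimes>\<^bsub>S\<^esub> R_at \<iota> q p (var2_x * var2_y)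
    = sxy (var_u * var_v - 1) \<otimes>\<^bsub>S\<^esub> Hxy.pt c_R 1 \<oplus>\<^bsub>S\<^esub> sxy w"
proof -
  have 1: "sxy (var_u * var_v - 1) = Hxy.pt \<one>\<^bsub>Hp\<^esub> (var2_x * var2_y - 1)"
    using pt_add_S(2)[of "\<one>\<^bsub>Hp\<^esub>" "var2_x * var2_y - 1" 1] Hxy.pt_one
    unfolding sxy.ev.hom_diff sxy.ev.hom_mult sxy.ev.hom_one sxy_vars S_tensor
    by (simp add: S.minus_eq S.a_assoc S.r_neg Spt)
  show ?thesis unfolding 1 w_def sxy_const
    using R_at_aux[of "var2_x * var2_y" 1 "var2_x * var2_y"] var2_nz
      right_inverse[of "var2_x * var2_y :: 'k poly poly fract"] by (simp add: Spt)
qed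

text \<open>\<omega> comes from \<open>k\<close>, so it can be moved across the tensor sign to
  k(x,y), where it is invertible once it is non-zero.\<close>

lemma sxy_w: "sxy w = Hxy.pt \<one>\<^bsub>Hp\<^esub> (Fract [:[:om:]:] 1)"
  using Hxy.pt_smult[of "\<one>\<^bsub>Hp\<^esub>" 1 om] unfolding w_def sxy_const by (simp add: H_smult)

text \<open>Both sides are multiplied by a central unit from k(x,y), which turns all four factors
  into polynomials; then \<open>reflection_diff\<close> applies and \<omega> is cancelled. It
  matters that \<open>d\<close> lies in k[x], not only in z[x].\<close>

lemma reflection_eq_iff:
  assumes om: "om \<noteq> 0" and d: "d \<noteq> 0" and U: "U \<in> carrier M"
    and F: "Kx.pt \<one>\<^bsub>Hp\<^esub> (Fract d 1) \<otimes>\<^bsub>M\<^esub> U = mK f"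
  shows "reflection_eq \<iota> q p U \<longleftrightarrow>
    hr.sandwich (refl_poly var_u var_v (lift_v f) (map_poly lift_v f)) = \<zero>\<^bsub>S\<^esub>"
proof -
  let ?c = "\<lambda>b. Hxy.pt \<one>\<^bsub>Hp\<^esub> b"
  define Kx Ky Rq Rp where "Kx = tm_x U" and "Ky = tm_y U"
    and "Rq = R_at \<iota> q p (var2_x / var2_y)" and "Rp = R_at \<iota> q p (var2_x * var2_y)"
  have cl [simp]: "Kx \<in> carrier S" "Ky \<in> carrier S" "Rq \<in> carrier S" "Rp \<in> carrier S"
    using tm_hom U R_at_closed by (auto simp: Kx_def Ky_def Rq_def Rp_def ring_hom_def)
  have ccl [simp]: "?c b \<in> carrier S" for b by (simp add: Spt)
  have ca: "Kx.pt \<one>\<^bsub>Hp\<^esub> b \<in> carrier M" for b by (simp add: Mpt)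
  have x: "hr.ev (lift_v f) = ?c (Fract [:d:] 1) \<otimes>\<^bsub>S\<^esub> Kx"
    using ring_hom_mult[OF tm_hom(1) ca U, of "Fract d 1"] unfolding F tm_mK
    by (simp add: tm_pt at_x_simps Kx_def)
  have y: "hr.ev (map_poly lift_v f) = ?c (Fract (lift_v d) 1) \<otimes>\<^bsub>S\<^esub> Ky"
    using ring_hom_mult[OF tm_hom(2) ca U, of "Fract d 1"] unfolding F tm_mK
    by (simp add: tm_pt at_y_simps Ky_def)
  define L N where "L = sxy (var_u - var_v) \<otimes>\<^bsub>S\<^esub> Hxy.pt c_R 1 \<oplus>\<^bsub>S\<^esub> sxy (var_v * w)"
    and "N = sxy (var_u * var_v - 1) \<otimes>\<^bsub>S\<^esub> Hxy.pt c_R 1 \<oplus>\<^bsub>S\<^esub> sxy w"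
  have L: "L = ?c var2_x \<otimes>\<^bsub>S\<^esub> Rq" and N: "N = ?c (var2_x * var2_y) \<otimes>\<^bsub>S\<^esub> Rp"
    unfolding L_def N_def Rq_def Rp_def R_quot R_prod by simp_all
  have c4: "?c b1 \<otimes>\<^bsub>S\<^esub> t1 \<otimes>\<^bsub>S\<^esub> (?c b2 \<otimes>\<^bsub>S\<^esub> t2) \<otimes>\<^bsub>S\<^esub> (?c b3 \<otimes>\<^bsub>S\<^esub> t3) \<otimes>\<^bsub>S\<^esub> (?c b4 \<otimes>\<^bsub>S\<^esub> t4)
      = ?c (b1 * b2 * b3 * b4) \<otimes>\<^bsub>S\<^esub> (t1 \<otimes>\<^bsub>S\<^esub> t2 \<otimes>\<^bsub>S\<^esub> t3 \<otimes>\<^bsub>S\<^esub> t4)"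
    if t: "t1 \<in> carrier S" "t2 \<in> carrier S" "t3 \<in> carrier S" "t4 \<in> carrier S" for t1 t2 t3 t4 b1 b2 b3 b4
  proof -
    have c2: "?c b \<otimes>\<^bsub>S\<^esub> t \<otimes>\<^bsub>S\<^esub> (?c b' \<otimes>\<^bsub>S\<^esub> u) = ?c (b * b') \<otimes>\<^bsub>S\<^esub> (t \<otimes>\<^bsub>S\<^esub> u)"
      if "t \<in> carrier S" "u \<in> carrier S" for b b' t u
    proof -
      have "?c b \<otimes>\<^bsub>S\<^esub> t \<otimes>\<^bsub>S\<^esub> (?c b' \<otimes>\<^bsub>S\<^esub> u) = ?c b \<otimes>\<^bsub>S\<^esub> (t \<otimes>\<^bsub>S\<^esub> ?c b') \<otimes>\<^bsub>S\<^esub> u"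
        using that by (simp add: S.m_assoc)
      also have "\<dots> = ?c b \<otimes>\<^bsub>S\<^esub> ?c b' \<otimes>\<^bsub>S\<^esub> (t \<otimes>\<^bsub>S\<^esub> u)"
        using that by (simp only: S_central[OF that(1), symmetric]) (simp add: S.m_assoc)
      finally show ?thesis by (simp add: Spt)
    qed
    show ?thesis using t by (simp add: c2)
  qed
  \<comment> \<open>One factor for each term of the product: x for R(x/y), d(x) for K(x), xy for
    R(xy) and d(y) for K(y).\<close>
  let ?b = "var2_x * Fract [:d:] 1 * (var2_x * var2_y) * Fract (lift_v d) 1"
  have b: "?b \<noteq> 0"
  proof -
    have "Fract [:d:] 1 \<noteq> 0" "Fract (lift_v d) 1 \<noteq> 0"
      using d by (simp_all add: Zero_fract_def eq_fract lift_v_eq_0_iff)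
    with var2_nz show ?thesis by (simp del: mult_fract)
  qed
  let ?l = "Rq \<otimes>\<^bsub>S\<^esub> Kx \<otimes>\<^bsub>S\<^esub> Rp \<otimes>\<^bsub>S\<^esub> Ky" and ?r = "Ky \<otimes>\<^bsub>S\<^esub> Rp \<otimes>\<^bsub>S\<^esub> Kx \<otimes>\<^bsub>S\<^esub> Rq"
  have l: "L \<otimes>\<^bsub>S\<^esub> hr.ev (lift_v f) \<otimes>\<^bsub>S\<^esub> N \<otimes>\<^bsub>S\<^esub> hr.ev (map_poly lift_v f) = ?c ?b \<otimes>\<^bsub>S\<^esub> ?l"
    unfolding L N x y by (rule c4) simp_all
  have r: "hr.ev (map_poly lift_v f) \<otimes>\<^bsub>S\<^esub> N \<otimes>\<^bsub>S\<^esub> hr.ev (lift_v f) \<otimes>\<^bsub>S\<^esub> L = ?c ?b \<otimes>\<^bsub>S\<^esub> ?r"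
  proof -
    have "hr.ev (map_poly lift_v f) \<otimes>\<^bsub>S\<^esub> N \<otimes>\<^bsub>S\<^esub> hr.ev (lift_v f) \<otimes>\<^bsub>S\<^esub> L
      = ?c (Fract (lift_v d) 1 * (var2_x * var2_y) * Fract [:d:] 1 * var2_x) \<otimes>\<^bsub>S\<^esub> ?r"
      unfolding L N x y by (rule c4) simp_all
    also have "Fract (lift_v d) 1 * (var2_x * var2_y) * Fract [:d:] 1 * var2_x = ?b"
      by (simp only: ac_simps)
    finally show ?thesis .
  qed
  have "reflection_eq \<iota> q p U \<longleftrightarrow> ?l = ?r"
    unfolding reflection_eq_def Let_def Kx_def Ky_def Rq_def Rp_def ..
  also have "\<dots> \<longleftrightarrow> ?c ?b \<otimes>\<^bsub>S\<^esub> ?l = ?c ?b \<otimes>\<^bsub>S\<^esub> ?r"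
    using S_cancel[OF b, of ?l ?r] by auto
  also have "\<dots> \<longleftrightarrow> ?c ?b \<otimes>\<^bsub>S\<^esub> ?l \<ominus>\<^bsub>S\<^esub> ?c ?b \<otimes>\<^bsub>S\<^esub> ?r = \<zero>\<^bsub>S\<^esub>"
    by (rule S.r_right_minus_eq[symmetric]) simp_all
  also have "?c ?b \<otimes>\<^bsub>S\<^esub> ?l \<ominus>\<^bsub>S\<^esub> ?c ?b \<otimes>\<^bsub>S\<^esub> ?r
    = sxy w \<otimes>\<^bsub>S\<^esub> hr.sandwich (refl_poly var_u var_v (lift_v f) (map_poly lift_v f))"
    unfolding l[symmetric] r[symmetric] L_def N_def by (rule hr.reflection_diff)
  also have "\<dots> = \<zero>\<^bsub>S\<^esub> \<longleftrightarrow> sxy w \<otimes>\<^bsub>S\<^esub> hr.sandwich (refl_poly var_u var_v (lift_v f) (map_poly lift_v f))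
      = sxy w \<otimes>\<^bsub>S\<^esub> \<zero>\<^bsub>S\<^esub>" by simp
  also have "\<dots> \<longleftrightarrow> hr.sandwich (refl_poly var_u var_v (lift_v f) (map_poly lift_v f)) = \<zero>\<^bsub>S\<^esub>"
  proof -
    have "Fract [:[:om:]:] 1 \<noteq> 0" using om by (simp add: Zero_fract_def eq_fract)
    note * = S_cancel[OF this, folded sxy_w, OF hr.sandwich_closed S.zero_closed]
    show ?thesis by (rule iffI, erule *) simp
  qed
  finally show ?thesis .
qed

section \<open>Principal solutions\<close>

abbreviation scal where "scal \<equiv> scalar_x \<iota> q p"

lemma scal_hom: "scal \<in> ring_hom Z M"
  using sc.tensor_map_hom unfolding Z_tensor M_tensor scalar_x_def .

sublocale scal: ring_hom_ring Z M scal
  by (rule ring_hom_ringI2[OF Z.ring_axioms M.ring_axioms scal_hom])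

lemma scal_pt: "scal (Zx.pt c b) = Kx.pt (c_scalar c) b"
  using sc.tensor_map_pt[of c b] by (simp add: scalar_x_def)

lemma scal_zx: "scal (zx a) = mx a"
  by (rule zx.ev_natural[OF scal_hom mx.poly_eval_axioms]) (simp_all add: scal_pt HK.hom_one)

lemma zx_k: "zx (map_poly \<iota> a) = Zx.pt 1 (Fract a 1)"
proof (induction a)
  case 0
  show ?case using Zx.pt_zero_right[of 1] unfolding Z_tensor by (simp add: Zero_fract_def)
next
  case (pCons c a)
  have "Fract (pCons c a) 1 = Fract [:c:] 1 + var_x * Fract a 1" by (simp add: var_x_def)
  moreover have "Zx.pt (\<iota> c) 1 = Zx.pt 1 (Fract [:c:] 1)"
    using Zx.pt_smult[of 1 1 c] by simp
  ultimately show ?case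
    using pCons Zx.pt_add_right[of 1 "Fract [:c:] 1" "var_x * Fract a 1"] unfolding Z_tensor
    by (simp add: map_poly_pCons zx.ev_pCons Zpt)
qed

lemma mx_k: "mx (map_poly \<iota> a) = Kx.pt \<one>\<^bsub>Hp\<^esub> (Fract a 1)"
  unfolding scal_zx[symmetric] zx_k scal_pt by (simp add: HK.hom_one)

lemma denom_mult:
  assumes "c \<in> carrier Z" "Zx.pt 1 (Fract d 1) \<otimes>\<^bsub>Z\<^esub> c = zx a"
  shows "Zx.pt 1 (Fract (e * d) 1) \<otimes>\<^bsub>Z\<^esub> c = zx (map_poly \<iota> e * a)"
proof -
  have "Zx.pt 1 (Fract (e * d) 1) = Zx.pt 1 (Fract e 1) \<otimes>\<^bsub>Z\<^esub> Zx.pt 1 (Fract d 1)"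
    by (simp add: Zpt)
  then show ?thesis using assms by (simp add: Z.m_assoc Zpt(1) zx.ev_mult zx_k del: mult_fract)
qed

text \<open>A pure tensor has the denominator of its second factor; sums use the product. The
  denominator stays in k[x] and hence is a unit of z(x).\<close>

lemma denom:
  assumes "c \<in> carrier Z"
  shows "\<exists>d a. d \<noteq> 0 \<and> Zx.pt 1 (Fract d 1) \<otimes>\<^bsub>Z\<^esub> c = zx a"
  using assms[folded Z_tensor]
proof (induction c rule: Zx.tensor_induct)
  case (pure z r)
  obtain a b where r: "r = Fract a b" "b \<noteq> 0" by (cases r)
  have "Zx.pt 1 (Fract b 1) \<otimes>\<^bsub>Z\<^esub> Zx.pt z r = Zx.pt z 1 \<otimes>\<^bsub>Z\<^esub> Zx.pt 1 (Fract a 1)"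
  proof -
    have "Fract b 1 * r = Fract a 1" using r by (simp add: eq_fract mult.commute)
    then show ?thesis by (simp add: Zpt)
  qed
  also have "\<dots> = zx ([:z:] * map_poly \<iota> a)"
    unfolding zx.ev_mult zx_k by (simp add: zx.ev_const)
  finally show ?case using r(2) by blast
next
  case (add c c')
  then obtain d a d' a' where *: "d \<noteq> 0" "Zx.pt 1 (Fract d 1) \<otimes>\<^bsub>Z\<^esub> c = zx a"
    "d' \<noteq> 0" "Zx.pt 1 (Fract d' 1) \<otimes>\<^bsub>Z\<^esub> c' = zx a'" by blast
  have cl: "c \<in> carrier Z" "c' \<in> carrier Z" using add by (simp_all only: Z_tensor)
  have "Zx.pt 1 (Fract (d' * d) 1) \<otimes>\<^bsub>Z\<^esub> (c \<oplus>\<^bsub>Z\<^esub> c') = zx (map_poly \<iota> d' * a + map_poly \<iota> d * a')"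
    using denom_mult[OF cl(1) *(2), of d'] denom_mult[OF cl(2) *(4), of d] cl
    by (simp add: Z.r_distr Zpt zx.ev_add mult.commute del: mult_fract)
  then show ?case using * unfolding Z_tensor by (intro exI[of _ "d' * d"]) auto
qed

lemma denoms:
  fixes c :: "nat \<Rightarrow> _"
  assumes "\<forall>i\<le>m. c i \<in> carrier Z"
  shows "\<exists>d a. d \<noteq> 0 \<and> (\<forall>i\<le>m. Zx.pt 1 (Fract d 1) \<otimes>\<^bsub>Z\<^esub> c i = zx (a i))"
  using assms
proof (induction m)
  case 0
  then obtain d a where "d \<noteq> 0" "Zx.pt 1 (Fract d 1) \<otimes>\<^bsub>Z\<^esub> c 0 = zx a" using denom by blast
  then show ?case by (intro exI[of _ d] exI[of _ "\<lambda>_. a"]) simp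
next
  case (Suc m)
  then obtain d a where d: "d \<noteq> 0" "\<And>i. i \<le> m \<Longrightarrow> Zx.pt 1 (Fract d 1) \<otimes>\<^bsub>Z\<^esub> c i = zx (a i)" by auto
  obtain d' a' where d': "d' \<noteq> 0" "Zx.pt 1 (Fract d' 1) \<otimes>\<^bsub>Z\<^esub> c (Suc m) = zx a'"
    using denom Suc.prems by blast
  define b where "b i = (if i = Suc m then map_poly \<iota> d * a' else map_poly \<iota> d' * a i)" for i
  have "Zx.pt 1 (Fract (d' * d) 1) \<otimes>\<^bsub>Z\<^esub> c i = zx (b i)" if "i \<le> Suc m" for i
    using that denom_mult[OF _ d(2), of i d'] denom_mult[OF _ d'(2), of d] Suc.prems
    by (cases "i = Suc m") (simp_all add: b_def mult.commute[of d d'])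
  with d(1) d'(1) show ?case by (intro exI[of _ "d' * d"] exI[of _ b]) simp
qed

lemma ex_hom: "ex.lift \<in> ring_hom Z ring_of_type_algebra"
  using ex.lift_hom unfolding Z_tensor .

lemma ex_zx: "ex.lift (zx a) = Fract a 1"
proof (induction a)
  case 0
  interpret e: ring_hom_ring Z "ring_of_type_algebra :: 'z poly fract ring" ex.lift
    by (rule ring_hom_ringI2[OF Z.ring_axioms ring_from_type_algebra ex_hom])
  show ?case using e.hom_zero by (simp add: Zero_fract_def)
next
  case (pCons c a)
  have "Fract (pCons c a) 1 = Fract [:c:] 1 + emb_x var_x * Fract a 1"
    by (simp add: var_x_def emb_x_simps map_poly_pCons \<iota>_simps)
  then show ?case
    using pCons ring_hom_add[OF ex_hom, of "Zx.pt c 1" "Zx.pt 1 var_x \<otimes>\<^bsub>Z\<^esub> zx a"]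
      ring_hom_mult[OF ex_hom, of "Zx.pt 1 var_x" "zx a"]
    by (simp add: zx.ev_pCons Zpt(1) ex.lift_pt emb_x_simps One_fract_def[symmetric] pCons_one)
qed

lemma zx_eq_0: "zx a = \<zero>\<^bsub>Z\<^esub> \<Longrightarrow> a = 0"
  using ex_zx[of a] ex_zx[of 0] by (simp add: eq_fract)

lemma denom_nonzero:
  assumes "f \<in> carrier Z" "f \<noteq> \<zero>\<^bsub>Z\<^esub>" "d \<noteq> 0" "Zx.pt 1 (Fract d 1) \<otimes>\<^bsub>Z\<^esub> f = zx a"
  shows "a \<noteq> 0"
proof
  assume "a = 0"
  then have "Zx.pt 1 (Fract d 1) \<otimes>\<^bsub>Z\<^esub> f = Zx.pt 1 (Fract d 1) \<otimes>\<^bsub>Z\<^esub> \<zero>\<^bsub>Z\<^esub>"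
    using assms(4) by (simp add: Zpt)
  moreover have "Fract d 1 \<noteq> 0" using assms(3) by (simp add: Zero_fract_def eq_fract)
  ultimately show False using Z_cancel assms(1,2) by blast
qed

text \<open>Clearing the denominator of \<open>f\<close> moves the product into the domain z[x],
  which embeds by \<open>zx_eq_0\<close>.\<close>

lemma zx_mult_nonzero:
  assumes f: "f \<in> carrier Z" "f \<noteq> \<zero>\<^bsub>Z\<^esub>" and a: "a \<noteq> 0"
  shows "f \<otimes>\<^bsub>Z\<^esub> zx a \<noteq> \<zero>\<^bsub>Z\<^esub>"
proof
  assume z: "f \<otimes>\<^bsub>Z\<^esub> zx a = \<zero>\<^bsub>Z\<^esub>"
  obtain d b where d: "d \<noteq> 0" "Zx.pt 1 (Fract d 1) \<otimes>\<^bsub>Z\<^esub> f = zx b" using denom[OF f(1)] by blast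
  have "zx (b * a) = Zx.pt 1 (Fract d 1) \<otimes>\<^bsub>Z\<^esub> (f \<otimes>\<^bsub>Z\<^esub> zx a)"
    unfolding zx.ev_mult d(2)[symmetric] using f by (simp add: Z.m_assoc Zpt)
  then have "b * a = 0" using z by (intro zx_eq_0) (simp add: Zpt)
  then show False using a denom_nonzero[OF f d] by simp
qed

lemma pt_hom: "(\<lambda>a. Kx.pt a 1) \<in> ring_hom Kp M"
  by (intro ring_hom_memI) (simp_all add: Mpt Kx.pt_add_left[unfolded M_tensor, simplified]
      Kx.pt_one[unfolded M_tensor, simplified])

abbreviation kK where "kK \<equiv> poly_ev Kp c_scalar c_K"

lemma mK_lift: "mK (lift_v f) = Kx.pt (kK f) 1"
proof -
  have e: "poly_eval M (\<lambda>c. Kx.pt (c_scalar c) 1) (Kx.pt c_K 1)"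
    by unfold_locales (simp_all add: Mpt HK.u_comm)
  show ?thesis
    unfolding lift_v_def mK.ev_map_poly[where h = "\<lambda>c. [:c:]", OF _ e, simplified mx.ev_const, simplified]
    by (rule KK.ev_natural[OF pt_hom e, symmetric]) simp_all
qed

section \<open>Expansions over the modified basis as polynomials of degree at most n\<close>

context
  fixes n :: nat and A :: "nat \<Rightarrow> 'z"
  assumes n: "n \<ge> 2"
    and p_eq: "p = - Polynomial.monom 1 (n + 1) + (\<Sum>i\<le>n. Polynomial.monom (A i) (n - i))"
begin

definition tilde :: "'z poly" where
  "tilde = Polynomial.monom 1 n - (\<Sum>i<n. Polynomial.monom (A i) (n - 1 - i))"

lemma K_tilde_eq: "K_tilde \<iota> q p n A = kK tilde"
  unfolding K_tilde_def tilde_def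
  by (simp only: KK.ev.hom_diff KK.ev.hom_sum finite_lessThan KK.ev_monom)
    (simp add: HK.hom_one Kp.l_one[OF Kp.nat_pow_closed[OF K_p_closed(1)], simplified])

definition basis_sum :: "(nat \<Rightarrow> 'z poly) \<Rightarrow> 'z poly poly" where
  "basis_sum c = (\<Sum>i<n. smult (c i) (lift_v (Polynomial.monom 1 i))) + smult (c n) (lift_v tilde)"

lemma const_pow: "const_x \<iota> q p (c_K [^]\<^bsub>Kp\<^esub> i) = mK (lift_v (Polynomial.monom 1 i))"
  unfolding const_x_def mK_lift KK.ev_monom using KK.hom_one Kp.l_one[OF Kp.nat_pow_closed[OF K_p_closed(1)]] by simp

lemma const_tilde: "const_x \<iota> q p (K_tilde \<iota> q p n A) = mK (lift_v tilde)"
  unfolding const_x_def mK_lift K_tilde_eq ..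

lemma mK_basis_sum: "mK (basis_sum c)
  = (\<Oplus>\<^bsub>M\<^esub>i\<in>{..<n}. mx (c i) \<otimes>\<^bsub>M\<^esub> const_x \<iota> q p (c_K [^]\<^bsub>Kp\<^esub> i))
    \<oplus>\<^bsub>M\<^esub> mx (c n) \<otimes>\<^bsub>M\<^esub> const_x \<iota> q p (K_tilde \<iota> q p n A)"
  unfolding basis_sum_def const_pow const_tilde
  by (simp only: mK.ev_add mK.ev.hom_sum finite_lessThan mK.ev_smult)

lemma coeff_p: "i \<le> n \<Longrightarrow> Polynomial.coeff p (n - i) = A i" "Polynomial.coeff p (Suc n) = - 1"
  and degree_p: "Polynomial.degree p = Suc n"
proof -
  have c: "Polynomial.coeff p k = (if k = Suc n then - 1 else 0) + (\<Sum>j\<le>n. if n - j = k then A j else 0)" for k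
    unfolding p_eq by (simp add: coeff_sum)
  show "Polynomial.coeff p (n - i) = A i" if "i \<le> n" for i
  proof -
    have "(\<Sum>j\<le>n. if n - j = n - i then A j else 0) = (\<Sum>j\<le>n. if j = i then A j else 0)"
      using that by (intro sum.cong) auto
    then show ?thesis using that by (simp add: c)
  qed
  show l: "Polynomial.coeff p (Suc n) = - 1"
    by (simp add: c) (intro sum.neutral, auto)
  have "Polynomial.degree p \<le> Suc n"
    by (rule degree_le) (auto simp: c intro!: sum.neutral)
  moreover have "Suc n \<le> Polynomial.degree p" using l by (intro le_degree) simp
  ultimately show "Polynomial.degree p = Suc n" by simp
qed

text \<open>The reason for the choice of the modified top element: modulo \<open>p\<close>,
  multiplication by u sends it to the constant \<open>A n\<close>, so its moment of index 1
  vanishes.\<close>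

lemma tilde_shift: "pCons 0 tilde = [:A n:] - p"
proof -
  have s: "pCons 0 (\<Sum>i\<in>I. f i) = (\<Sum>i\<in>I. pCons 0 (f i))" if "finite I" for I :: "nat set" and f :: "nat \<Rightarrow> 'z poly"
    using that
  proof (induction I rule: finite_induct)
    case (insert i I)
    show ?case by (simp only: sum.insert[OF insert.hyps] insert.IH[symmetric] add_pCons add_0)
  qed simp
  have "pCons 0 (\<Sum>i<n. Polynomial.monom (A i) (n - 1 - i)) = (\<Sum>i<n. Polynomial.monom (A i) (n - i))"
    unfolding s[OF finite_lessThan]
    by (intro sum.cong) (auto simp: monom_Suc[symmetric] Suc_diff_Suc)
  then have "pCons 0 tilde = Polynomial.monom 1 (Suc n) - (\<Sum>i<n. Polynomial.monom (A i) (n - i))"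
  proof -
    have "pCons 0 (a - b) = pCons 0 a - pCons 0 b" for a b :: "'z poly" by simp
    then show ?thesis
      unfolding tilde_def
      using \<open>pCons 0 (\<Sum>i<n. Polynomial.monom (A i) (n - 1 - i)) = _\<close> by (simp only: monom_Suc)
  qed
  moreover have "(\<Sum>i\<le>n. Polynomial.monom (A i) (n - i)) = (\<Sum>i<n. Polynomial.monom (A i) (n - i)) + [:A n:]"
    by (simp add: lessThan_Suc_atMost[symmetric] monom_0)
  ultimately show ?thesis unfolding p_eq by simp
qed

lemma degree_tilde: "Polynomial.degree tilde \<le> n" and coeff_tilde: "Polynomial.coeff tilde n = 1"
proof -
  have "Polynomial.coeff tilde k = (if k = n then 1 else 0) - (\<Sum>i<n. if n - 1 - i = k then A i else 0)" for k
    unfolding tilde_def by (simp add: coeff_sum)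
  moreover have "(\<Sum>i<n. if n - 1 - i = k then A i else 0) = 0" if "k \<ge> n" for k
    using that n by (intro sum.neutral) auto
  ultimately show "Polynomial.degree tilde \<le> n" "Polynomial.coeff tilde n = 1"
    by (auto intro!: degree_le)
qed

lemma degree_basis_sum: "Polynomial.degree (basis_sum c) \<le> n"
  unfolding basis_sum_def
proof (intro degree_add_le degree_sum_le)
  show "Polynomial.degree (smult (c i) (lift_v (Polynomial.monom 1 i))) \<le> n" if "i \<in> {..<n}" for i
    using that degree_monom_le[of "1 :: 'z" i]
    by (intro order_trans[OF degree_smult_le order_trans[OF degree_lift_v]]) auto
  show "Polynomial.degree (smult (c n) (lift_v tilde)) \<le> n"
    by (intro order_trans[OF degree_smult_le order_trans[OF degree_lift_v degree_tilde]])
qed simp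

lemma coeff_basis_sum: "Polynomial.coeff (basis_sum c) n = c n"
  unfolding basis_sum_def
  by (simp add: coeff_sum lift_v_def coeff_map_poly coeff_tilde pCons_one)

lemma basis_sum_surj:
  assumes "Polynomial.degree f \<le> n"
  shows "\<exists>c. f = basis_sum c"
proof -
  let ?l = "Polynomial.coeff f n"
  define g where "g = f - smult ?l (lift_v tilde)"
  define c where "c i = (if i = n then ?l else Polynomial.coeff g i)" for i
  have "Polynomial.coeff g n = 0"
    by (simp add: g_def lift_v_def coeff_map_poly coeff_tilde pCons_one)
  moreover have "Polynomial.degree g \<le> n"
    unfolding g_def using assms
    by (intro degree_diff_le order_trans[OF degree_smult_le order_trans[OF degree_lift_v degree_tilde]])
  ultimately have g: "g = (\<Sum>i<n. Polynomial.monom (Polynomial.coeff g i) i)"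
    using poly_as_sum_of_monoms'[of g n] by (simp add: lessThan_Suc_atMost[symmetric])
  have m: "Polynomial.monom a i = smult a (lift_v (Polynomial.monom 1 i))" for a :: "'z poly" and i
    by (rule poly_eqI) (simp add: lift_v_def coeff_map_poly pCons_one)
  have "f = g + smult ?l (lift_v tilde)" by (simp add: g_def)
  also have "g = (\<Sum>i<n. smult (c i) (lift_v (Polynomial.monom 1 i)))"
    by (subst g) (simp add: m[symmetric] c_def)
  finally show ?thesis by (intro exI[of _ c]) (simp add: basis_sum_def c_def)
qed

text \<open>Among the \<open>u^i\<close> with \<open>i < n\<close> only \<open>u^(n-1)\<close>
  reaches \<open>u^n\<close> after one multiplication by u, and \<open>tilde\<close> contributes 0
  by \<open>tilde_shift\<close>. Hence principal means a non-zero moment of index 1.\<close>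

lemma mm_basis_sum:
  assumes "moment_seq p n t"
  shows "mom (shift (moment_seq.tc t) 1) (basis_sum c) = c (n - 1)"
proof -
  interpret t: moment_seq p n t by fact
  have m: "t.mm 1 (lift_v f) = [:mom (shift t 1) f:]" for f
  proof -
    have "mom (\<lambda>i. [:shift t 1 i:]) (map_poly (\<lambda>c. [:c:]) f) = [:mom (shift t 1) f:]"
      by (rule mom_hom) simp_all
    then show ?thesis by (simp add: lift_v_def t.tc_def shift_def[abs_def])
  qed
  have "mom (shift t 1) tilde = mom t (pCons 0 tilde)"
    by (simp add: mom_pCons Suc_shift)
  also have "\<dots> = 0"
    unfolding tilde_shift mom_diff using t.recur[of 0] n by (simp add: mom_pCons t.t_less)
  finally have tl: "mom (shift t 1) tilde = 0" .
  have mo: "mom s (Polynomial.monom 1 i) = s i" for s :: "nat \<Rightarrow> 'z" and i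
    by (induction i arbitrary: s) (simp_all add: monom_0 monom_Suc mom_pCons)
  have s: "t.mm 1 (\<Sum>i\<in>I. f i) = (\<Sum>i\<in>I. t.mm 1 (f i))" if "finite I" for I :: "nat set" and f
    using that by (induction I rule: finite_induct) (simp_all add: mom_add)
  have "t.mm 1 (basis_sum c) = (\<Sum>i<n. c i * [:shift t 1 i:])"
    unfolding basis_sum_def mom_add mom_smult s[OF finite_lessThan] m mo tl by simp
  also have "\<dots> = (\<Sum>i\<in>{n - 1}. c i * [:shift t 1 i:])"
    using n by (intro sum.mono_neutral_right) (auto simp: shift_def t.t_less)
  finally show ?thesis using n by (simp add: shift_def t.t_n pCons_one)
qed

section \<open>The elements \<open>K_sol\<close>\<close>

context
  fixes \<xi> :: 'z
  assumes \<xi>: "\<xi> \<noteq> 0"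
begin

definition sq :: "'z poly" where "sq = [:\<xi>:] * [:0, 1:]"
definition Qp :: "'z poly poly" where "Qp = quot_at (lift_v p) sq"
definition sol :: "'z poly poly" where "sol = sol_poly (lift_v p) [:inverse \<xi>:] [:0, 1:] sq"

lemma degree_Qp: "Polynomial.degree Qp \<le> n"
  using degree_p degree_lift_v[of p] by (simp add: Qp_def quot_at_def degree_synthetic_div)

lemma degree_sol: "Polynomial.degree sol \<le> n"
  unfolding sol_def sol_poly_def Qp_def[symmetric]
  by (intro degree_add_le order_trans[OF degree_smult_le degree_Qp]) simp

text \<open>Coefficients of (u - \<xi> x) Q = p(\<xi> x) - p(u), compared from the top down, give
  the recursion of the \<phi>; the constant coefficient expresses p(\<xi> x) through p(0) and the
  last \<phi>.\<close>

lemma coeff_Qp: "Polynomial.coeff Qp n = 1"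
  "i < n \<Longrightarrow> Polynomial.coeff Qp (n - Suc i) = sq * Polynomial.coeff Qp (n - i) - [:A i:]"
  "[:poly p 0:] - sq * Polynomial.coeff Qp 0 = poly (lift_v p) sq"
proof -
  have c: "Polynomial.coeff Qp j = sq * Polynomial.coeff Qp (Suc j) - [:Polynomial.coeff p (Suc j):]" for j
    using arg_cong[OF quot_at_eq[of sq "lift_v p"], of "\<lambda>f. Polynomial.coeff f (Suc j)"]
    by (simp add: Qp_def lift_v_def coeff_map_poly algebra_simps)
  have "Polynomial.coeff Qp (Suc n) = 0" using degree_Qp by (intro coeff_eq_0) simp
  then show "Polynomial.coeff Qp n = 1" using c[of n] by (simp add: coeff_p pCons_one)
  show "Polynomial.coeff Qp (n - Suc i) = sq * Polynomial.coeff Qp (n - i) - [:A i:]" if "i < n"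
    using c[of "n - Suc i"] coeff_p(1)[of i] that by (simp add: Suc_diff_Suc)
  show "[:poly p 0:] - sq * Polynomial.coeff Qp 0 = poly (lift_v p) sq"
    using arg_cong[OF quot_at_eq[of sq "lift_v p"], of "\<lambda>f. Polynomial.coeff f 0"]
    by (simp add: Qp_def lift_v_def coeff_map_poly poly_0_coeff_0 algebra_simps)
qed

lemma zx_sq: "zx sq = Zx.pt \<xi> var_x"
  unfolding sq_def zx.ev_mult zx.ev_const zx.ev_var by (simp add: Zpt)

lemma phi_eq: "i \<le> n \<Longrightarrow> phi \<iota> A \<xi> i = zx (Polynomial.coeff Qp (n - i))"
proof (induction i)
  case 0
  show ?case by (simp add: coeff_Qp(1) zx.ev.hom_one)
next
  case (Suc i)
  then show ?case
    using coeff_Qp(2)[of i] by (simp add: zx.ev.hom_diff zx.ev_mult zx_sq zx.ev_const)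
qed

abbreviation xx :: "'z poly" where "xx \<equiv> [:0, 1:]\<^sup>2 - 1"

lemma xx_k: "xx = map_poly \<iota> ([:0, 1:]\<^sup>2 - 1)"
  by (simp add: power2_eq_square one_pCons map_poly_pCons \<iota>_simps del: pCons_one)
    (metis \<iota>_simps(1) \<iota>_0 \<iota>_simps(3) add.right_inverse minus_unique)

text \<open>\<open>x^2 - 1\<close> divided by \<open>x - x^-1\<close> is x, so this factor clears
  the denominator in the constant term and also the \<open>x^-1\<close> before the last
  \<phi>.\<close>

lemma K_sol_closed: "K_sol \<iota> q p n A \<xi> \<in> carrier M"
  and K_sol_scaled: "mx xx \<otimes>\<^bsub>M\<^esub> K_sol \<iota> q p n A \<xi> = mK sol"
proof -
  let ?\<phi> = "\<lambda>i. Polynomial.coeff Qp (n - i)"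
  define \<kappa> where "\<kappa> = (Zx.pt (inverse \<xi> * poly p 0) 1 \<ominus>\<^bsub>Z\<^esub> Zx.pt 1 (inverse var_x) \<otimes>\<^bsub>Z\<^esub> phi \<iota> A \<xi> n)
         \<otimes>\<^bsub>Z\<^esub> Zx.pt 1 (inverse (var_x - inverse var_x))"
  have phi_cl: "i \<le> n \<Longrightarrow> phi \<iota> A \<xi> i \<in> carrier Z" for i by (simp add: phi_eq)
  have \<kappa>_cl: "\<kappa> \<in> carrier Z" by (simp add: \<kappa>_def Zpt phi_cl)
  have vx: "var_x \<noteq> (0 :: 'k poly fract)" by (simp add: var_x_def Zero_fract_def eq_fract)
  have vxx: "var_x - inverse var_x \<noteq> (0 :: 'k poly fract)"
  proof
    assume "var_x - inverse var_x = (0 :: 'k poly fract)"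
    then have "var_x * var_x = (1 :: 'k poly fract)" using vx by (simp add: field_simps)
    then show False by (simp add: var_x_def One_fract_def eq_fract one_pCons)
  qed
  have xx: "zx xx = Zx.pt 1 (var_x * var_x - 1)"
  proof -
    have "Fract ([:0, 1:]\<^sup>2 - 1) 1 = var_x * var_x - (1 :: 'k poly fract)"
      by (simp add: var_x_def power2_eq_square One_fract_def)
    then show ?thesis unfolding xx_k zx_k by simp
  qed
  have prod: "(var_x * var_x - 1) * inverse (var_x - inverse var_x) = (var_x :: 'k poly fract)"
    using vx vxx by (simp add: field_simps)
  have "zx xx \<otimes>\<^bsub>Z\<^esub> \<kappa> = Zx.pt 1 var_x \<otimes>\<^bsub>Z\<^esub>
      (Zx.pt (inverse \<xi> * poly p 0) 1 \<ominus>\<^bsub>Z\<^esub> Zx.pt 1 (inverse var_x) \<otimes>\<^bsub>Z\<^esub> phi \<iota> A \<xi> n)"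
  proof -
    let ?s = "Zx.pt (inverse \<xi> * poly p 0) 1 \<ominus>\<^bsub>Z\<^esub> Zx.pt 1 (inverse var_x) \<otimes>\<^bsub>Z\<^esub> phi \<iota> A \<xi> n"
    have s: "?s \<in> carrier Z" by (simp add: Zpt(1) phi_cl)
    have "zx xx \<otimes>\<^bsub>Z\<^esub> \<kappa> = Zx.pt 1 (var_x * var_x - 1) \<otimes>\<^bsub>Z\<^esub>
        (Zx.pt 1 (inverse (var_x - inverse var_x)) \<otimes>\<^bsub>Z\<^esub> ?s)"
      unfolding xx \<kappa>_def by (simp only: Z_central[OF s])
    also have "\<dots> = Zx.pt 1 var_x \<otimes>\<^bsub>Z\<^esub> ?s"
      using s by (simp add: Z.m_assoc[symmetric] Zpt prod)
    finally show ?thesis .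
  qed
  also have "\<dots> = zx ([:0, 1:] * [:inverse \<xi> * poly p 0:] - ?\<phi> n)"
  proof -
    have "Zx.pt 1 var_x \<otimes>\<^bsub>Z\<^esub> (Zx.pt 1 (inverse var_x) \<otimes>\<^bsub>Z\<^esub> zx (?\<phi> n)) = zx (?\<phi> n)"
      using vx Z.l_one[of "zx (?\<phi> n)"] z0.hom_one
      by (simp add: Z.m_assoc[symmetric] Zpt)
    then show ?thesis
      unfolding zx.ev.hom_diff zx.ev_mult zx.ev_var zx.ev_const phi_eq[OF order_refl]
      by (simp add: Z.minus_eq Z.r_distr Z.r_minus Zpt(1))
  qed
  finally have \<kappa>: "zx xx \<otimes>\<^bsub>Z\<^esub> \<kappa> = zx ([:0, 1:] * [:inverse \<xi> * poly p 0:] - ?\<phi> n)" .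
  \<comment> \<open>By \<open>coeff_Qp(3)\<close> the term with p(\<xi> x) supplies
    \<open>- x^2\<close> times the last \<phi>, which reduces \<open>x^2 - 1\<close> to -1.\<close>
  have const: "[:0, 1:] * [:inverse \<xi> * poly p 0:] - ?\<phi> n
      = xx * ?\<phi> n + [:inverse \<xi>:] * [:0, 1:] * poly (lift_v p) sq"
  proof -
    have i: "[:inverse \<xi>:] * [:\<xi>:] = 1" using \<xi> by (simp add: pCons_one)
    have "[:inverse \<xi>:] * [:0, 1:] * (sq * ?\<phi> n) = ([:inverse \<xi>:] * [:\<xi>:]) * ([:0, 1:] * [:0, 1:]) * ?\<phi> n"
      unfolding sq_def by (simp only: ac_simps)
    moreover have "[:inverse \<xi> * poly p 0:] = [:inverse \<xi>:] * [:poly p 0:]" by simp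
    ultimately show ?thesis
      unfolding coeff_Qp(3)[symmetric] right_diff_distrib i
      by (simp only: diff_self_eq_0 left_diff_distrib power2_eq_square mult_1 ac_simps) (simp add: algebra_simps)
  qed
  have sol: "sol = (\<Sum>i<n. Polynomial.monom (xx * ?\<phi> i) (n - i)) + [:[:0, 1:] * [:inverse \<xi> * poly p 0:] - ?\<phi> n:]"
  proof -
    have "Qp = (\<Sum>i\<le>n. Polynomial.monom (Polynomial.coeff Qp i) i)"
      using poly_as_sum_of_monoms'[OF degree_Qp] by simp
    also have "\<dots> = (\<Sum>i\<le>n. Polynomial.monom (?\<phi> i) (n - i))"
      by (rule sum.reindex_bij_witness[of _ "\<lambda>i. n - i" "\<lambda>i. n - i"]) auto
    also have "\<dots> = (\<Sum>i<n. Polynomial.monom (?\<phi> i) (n - i)) + [:?\<phi> n:]"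
      by (simp add: lessThan_Suc_atMost[symmetric] monom_0)
    finally have Q: "Qp = (\<Sum>i<n. Polynomial.monom (?\<phi> i) (n - i)) + [:?\<phi> n:]" .
    have s: "smult c (\<Sum>i\<in>I. f i) = (\<Sum>i\<in>I. smult c (f i))" for c :: "'z poly" and f and I :: "nat set"
      by (induction I rule: infinite_finite_induct) (simp_all add: smult_add_right)
    have "smult xx Qp = (\<Sum>i<n. Polynomial.monom (xx * ?\<phi> i) (n - i)) + [:xx * ?\<phi> n:]"
      by (subst Q) (simp only: smult_add_right s smult_monom smult_pCons smult_0_right)
    then show ?thesis
      unfolding sol_def sol_poly_def Qp_def[symmetric] const by simp
  qed
  have summand: "mx xx \<otimes>\<^bsub>M\<^esub> (scal (phi \<iota> A \<xi> i) \<otimes>\<^bsub>M\<^esub> const_x \<iota> q p (c_K [^]\<^bsub>Kp\<^esub> (n - i)))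
      = mK (Polynomial.monom (xx * ?\<phi> i) (n - i))" if "i \<in> {..<n}" for i
  proof -
    have "Polynomial.monom (xx * ?\<phi> i) (n - i) = smult (xx * ?\<phi> i) (lift_v (Polynomial.monom 1 (n - i)))"
      by (rule poly_eqI) (simp add: lift_v_def coeff_map_poly pCons_one)
    then show ?thesis
      using that by (simp add: phi_eq scal_zx const_pow mK.ev_smult mx.ev_mult M.m_assoc)
  qed
  have cl: "scal (phi \<iota> A \<xi> i) \<otimes>\<^bsub>M\<^esub> const_x \<iota> q p (c_K [^]\<^bsub>Kp\<^esub> (n - i)) \<in> carrier M" if "i \<in> {..<n}" for i
    using that by (simp add: phi_eq scal_zx const_pow)
  have "K_sol \<iota> q p n A \<xi> = (\<Oplus>\<^bsub>M\<^esub>i\<in>{..<n}. scal (phi \<iota> A \<xi> i) \<otimes>\<^bsub>M\<^esub>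
        const_x \<iota> q p (c_K [^]\<^bsub>Kp\<^esub> (n - i))) \<oplus>\<^bsub>M\<^esub> scal \<kappa>"
    unfolding K_sol_def Let_def \<kappa>_def ..
  note K_sol_eq = this
  show "K_sol \<iota> q p n A \<xi> \<in> carrier M"
    unfolding K_sol_eq using cl \<kappa>_cl by (simp add: M.finsum_closed Pi_def)
  from K_sol_eq have "mx xx \<otimes>\<^bsub>M\<^esub> K_sol \<iota> q p n A \<xi> =
      (\<Oplus>\<^bsub>M\<^esub>i\<in>{..<n}. mx xx \<otimes>\<^bsub>M\<^esub> (scal (phi \<iota> A \<xi> i) \<otimes>\<^bsub>M\<^esub>
        const_x \<iota> q p (c_K [^]\<^bsub>Kp\<^esub> (n - i)))) \<oplus>\<^bsub>M\<^esub> scal (zx xx \<otimes>\<^bsub>Z\<^esub> \<kappa>)"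
    using cl \<kappa>_cl
    by (simp add: M.r_distr M.finsum_closed M.finsum_rdistr Pi_def scal_zx)
  also have "\<dots> = (\<Oplus>\<^bsub>M\<^esub>i\<in>{..<n}. mK (Polynomial.monom (xx * ?\<phi> i) (n - i)))
      \<oplus>\<^bsub>M\<^esub> mx ([:0, 1:] * [:inverse \<xi> * poly p 0:] - ?\<phi> n)"
    unfolding \<kappa> scal_zx by (rule arg_cong2[where f = "add M"], rule M.finsum_cong') (auto simp: summand)
  also have "\<dots> = mK sol"
    unfolding sol mK.ev_add mK.ev.hom_sum[OF finite_lessThan] mK.ev_const ..
  finally show "mx xx \<otimes>\<^bsub>M\<^esub> K_sol \<iota> q p n A \<xi> = mK sol" .
qed

lemma xx_M: "mx xx = Kx.pt \<one>\<^bsub>Hp\<^esub> (Fract ([:0, 1:]\<^sup>2 - 1) 1)"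
  unfolding xx_k mx_k ..

text \<open>The moment of index 1 is \<open>(x^2 - 1) * \<xi> * x\<close>; the added constant
  contributes nothing because \<open>t 1 = 0\<close>.\<close>

lemma sol_principal:
  assumes "moment_seq p n t"
  shows "mom (shift (moment_seq.tc t) 1) sol \<noteq> 0"
proof -
  interpret t: moment_seq p n t by fact
  have "Polynomial.coeff (lift_v p) (Suc n) = - 1"
    by (simp add: lift_v_def coeff_map_poly coeff_p one_pCons)
  then have "t.mm 1 Qp = sq ^ 1" unfolding Qp_def using n by (intro t.mom_quot) auto
  moreover have "t.mm 1 [:c:] = 0" for c using n by (simp add: mom_pCons shift_def t.tc_def t.t_less)
  ultimately have "t.mm 1 sol = xx * sq"
    unfolding sol_def sol_poly_def Qp_def[symmetric] mom_add mom_smult by simp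
  moreover have "sq \<noteq> 0" using \<xi> by (simp add: sq_def)
  ultimately show ?thesis using xx_nonzero by (simp only: mult_eq_0_iff) simp
qed

lemma kK_p: "kK p = \<zero>\<^bsub>Hp\<^esub>"
  using H_K_p by (simp add: poly_ev_def)

lemma ev_lift_p: "hr.ev (lift_v (lift_v p)) = \<zero>\<^bsub>S\<^esub>"
proof -
  have "mK (lift_v p) = \<zero>\<^bsub>M\<^esub>"
    unfolding mK_lift kK_p using Kx.pt_zero_left[of 1] unfolding M_tensor by simp
  then have "hr.ev (lift_v (lift_v p)) = tm_x \<zero>\<^bsub>M\<^esub>" unfolding tm_mK[symmetric] by simp
  moreover have "tm_x \<zero>\<^bsub>M\<^esub> = \<zero>\<^bsub>S\<^esub>"
    using tx.tm.hom_zero unfolding M_tensor S_tensor .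
  ultimately show ?thesis by simp
qed

text \<open>\<open>sol\<close> read at x and at y gives the two arguments in
  \<open>refl_poly_sol\<close>, whose conclusion dies under \<open>sandwich\<close> because p(K) =
  0. The factor \<open>a\<close> comes out as the scalar a(x) a(y).\<close>

lemma sandwich_sol:
  "hr.sandwich (refl_poly var_u var_v (lift_v (smult a sol)) (map_poly lift_v (smult a sol))) = \<zero>\<^bsub>S\<^esub>"
proof -
  let ?P = "lift_v (lift_v p)"
  let ?\<zeta> = "[:[:inverse \<xi>:]:]" and ?\<Xi> = "[:[:\<xi>:]:]"
  have P: "map_poly lift_v (lift_v p) = ?P"
    by (rule poly_eqI) (simp add: coeff_map_poly coeff_lift_v lift_v_const)
  have x: "lift_v sol = sol_poly ?P ?\<zeta> var_u (?\<Xi> * var_u)"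
    unfolding sol_def lift_v_def[where ?'a = "'z poly"]
    by (subst sol_poly_hom) (simp_all add: sq_def)
  have y: "map_poly lift_v sol = sol_poly ?P ?\<zeta> var_v (?\<Xi> * var_v)"
    unfolding sol_def P[symmetric]
    by (subst sol_poly_hom)
      (simp_all add: sq_def lift_v_add lift_v_mult lift_v_const lift_v_pCons pCons_one lift_v_minus)
  have "?\<zeta> * ?\<Xi> = 1" using \<xi> by (simp add: pCons_one)
  from refl_poly_sol[OF this, of var_u var_v ?P] obtain m k
    where "refl_poly var_u var_v (lift_v sol) (map_poly lift_v sol) = [:?P:] * m + lift_v ?P * k"
    unfolding x y by blast
  then have "hr.sandwich (refl_poly var_u var_v (lift_v sol) (map_poly lift_v sol)) = \<zero>\<^bsub>S\<^esub>"
    using hr.sandwich_ideal[OF ev_lift_p] by simp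
  moreover have "lift_v (smult a sol) = smult [:a:] (lift_v sol)" by (rule lift_v_smult)
  moreover have "map_poly lift_v (smult a sol) = smult (lift_v a) (map_poly lift_v sol)"
    by (rule poly_eqI) (simp add: coeff_map_poly lift_v_mult)
  ultimately show ?thesis
    by (simp only: refl_poly_smult hr.sandwich_scalar S.r_null sxy.ev.closed)
qed

lemma solution_family:
  assumes om: "om \<noteq> 0" and f: "f \<in> carrier Z" "f \<noteq> \<zero>\<^bsub>Z\<^esub>"
  defines "U \<equiv> scal f \<otimes>\<^bsub>M\<^esub> K_sol \<iota> q p n A \<xi>"
  shows "U \<in> carrier M" "is_principal \<iota> q p n A U" "reflection_eq \<iota> q p U"
proof -
  let ?e = "[:0, 1:]\<^sup>2 - 1 :: 'k poly"
  let ?u = "\<lambda>b. Kx.pt \<one>\<^bsub>Hp\<^esub> b"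
  have ucl [simp]: "?u b \<in> carrier M" for b by (simp add: Mpt)
  have umult: "?u b \<otimes>\<^bsub>M\<^esub> ?u b' = ?u (b * b')" for b b' by (simp add: Mpt)
  have fcl [simp]: "scal f \<in> carrier M" using f(1) by (rule scal.hom_closed)
  show U: "U \<in> carrier M" unfolding U_def using K_sol_closed by simp
  obtain d a where d: "d \<noteq> 0" "Zx.pt 1 (Fract d 1) \<otimes>\<^bsub>Z\<^esub> f = zx a" using denom[OF f(1)] by blast
  have "?u (Fract d 1) \<otimes>\<^bsub>M\<^esub> scal f = mx a"
    using arg_cong[OF d(2), of scal] f(1) by (simp add: scal_zx scal_pt Zpt HK.hom_one)
  then have "?u (Fract d 1) \<otimes>\<^bsub>M\<^esub> U = mx a \<otimes>\<^bsub>M\<^esub> K_sol \<iota> q p n A \<xi>"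
    unfolding U_def using K_sol_closed by (simp add: M.m_assoc[symmetric])
  then have "?u (Fract ?e 1) \<otimes>\<^bsub>M\<^esub> (?u (Fract d 1) \<otimes>\<^bsub>M\<^esub> U) = mx xx \<otimes>\<^bsub>M\<^esub> (mx a \<otimes>\<^bsub>M\<^esub> K_sol \<iota> q p n A \<xi>)"
    unfolding xx_M by simp
  also have "\<dots> = mx a \<otimes>\<^bsub>M\<^esub> mK sol"
    unfolding K_sol_scaled[symmetric] using K_sol_closed
    by (simp add: M.m_assoc[symmetric] mx.ev.hom_comm[of xx a])
  also have "\<dots> = mK (smult a sol)" by (simp add: mK.ev_smult)
  finally have F: "?u (Fract (?e * d) 1) \<otimes>\<^bsub>M\<^esub> U = mK (smult a sol)"
    using U umult[of "Fract ?e 1" "Fract d 1"] by (simp add: M.m_assoc[symmetric])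
  have "?e * d \<noteq> 0" using d(1) xx_nonzero by (simp only: mult_eq_0_iff) simp
  from reflection_eq_iff[OF om this U F] sandwich_sol show "reflection_eq \<iota> q p U" by simp

  obtain t where t: "moment_seq p n t" using exists_moment_seq[OF n degree_p] by blast
  obtain g where g: "sol = basis_sum g" using basis_sum_surj[OF degree_sol] by blast
  have g1: "g (n - 1) \<noteq> 0" using sol_principal[OF t] mm_basis_sum[OF t, of g] g by simp
  have e: "Fract ?e 1 \<noteq> 0" using xx_nonzero by (simp add: Zero_fract_def eq_fract)
  \<comment> \<open>\<open>x^2 - 1\<close> has coefficients in \<open>k\<close> and is a unit of
    z(x). Dividing \<open>f\<close> by it lets \<open>U\<close> be expanded through the polynomial
    \<open>sol\<close> in place of \<open>K_sol\<close>.\<close>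
  define h where "h = Zx.pt 1 (inverse (Fract ?e 1)) \<otimes>\<^bsub>Z\<^esub> f"
  have h: "h \<in> carrier Z" unfolding h_def using f(1) by (simp add: Zpt)
  have fh: "f = Zx.pt 1 (Fract ?e 1) \<otimes>\<^bsub>Z\<^esub> h"
  proof -
    have "Zx.pt 1 (Fract ?e 1 * inverse (Fract ?e 1)) = \<one>\<^bsub>Z\<^esub>"
      using e z0.hom_one by (simp del: inverse_fract)
    then have "Zx.pt 1 (Fract ?e 1) \<otimes>\<^bsub>Z\<^esub> Zx.pt 1 (inverse (Fract ?e 1)) = \<one>\<^bsub>Z\<^esub>"
      by (simp add: Zpt(2) del: inverse_fract mult_fract)
    then show ?thesis unfolding h_def using f(1) by (simp add: Z.m_assoc[symmetric] Zpt(1) del: inverse_fract)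
  qed
  have h0: "h \<noteq> \<zero>\<^bsub>Z\<^esub>" using fh f(2) by (auto simp: Zpt)
  have hcl [simp]: "scal h \<in> carrier M" using h by (rule scal.hom_closed)
  have "U = scal h \<otimes>\<^bsub>M\<^esub> (mx xx \<otimes>\<^bsub>M\<^esub> K_sol \<iota> q p n A \<xi>)"
  proof -
    have "scal f = ?u (Fract ?e 1) \<otimes>\<^bsub>M\<^esub> scal h"
      using arg_cong[OF fh, of scal] h by (simp add: scal_pt Zpt HK.hom_one)
    then have "scal f = scal h \<otimes>\<^bsub>M\<^esub> mx xx" unfolding xx_M using M_central[OF hcl] by simp
    then show ?thesis unfolding U_def using K_sol_closed by (simp add: M.m_assoc)
  qed
  also have "\<dots> = scal h \<otimes>\<^bsub>M\<^esub> mK (basis_sum g)" unfolding K_sol_scaled g ..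
  also have "\<dots> = (\<Oplus>\<^bsub>M\<^esub>i\<in>{..<n}. scal (h \<otimes>\<^bsub>Z\<^esub> zx (g i)) \<otimes>\<^bsub>M\<^esub> const_x \<iota> q p (c_K [^]\<^bsub>Kp\<^esub> i))
    \<oplus>\<^bsub>M\<^esub> scal (h \<otimes>\<^bsub>Z\<^esub> zx (g n)) \<otimes>\<^bsub>M\<^esub> const_x \<iota> q p (K_tilde \<iota> q p n A)"
    unfolding mK_basis_sum const_pow const_tilde using h
    by (simp add: M.r_distr M.finsum_closed M.finsum_rdistr Pi_def scal_zx M.m_assoc)
  finally have "U = \<dots>" .
  moreover have "h \<otimes>\<^bsub>Z\<^esub> zx (g i) \<in> carrier Z" for i using h by simp
  ultimately show "is_principal \<iota> q p n A U"
    unfolding is_principal_def Let_def using zx_mult_nonzero[OF h h0 g1]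
    by (intro exI[of _ "\<lambda>i. h \<otimes>\<^bsub>Z\<^esub> zx (g i)"]) blast
qed

end

section \<open>Every principal solution lies in the family\<close>

lemma solution_is_in_family:
  assumes om: "om \<noteq> 0" and U: "U \<in> carrier M"
    and principal: "is_principal \<iota> q p n A U" and refl: "reflection_eq \<iota> q p U"
  shows "\<exists>f \<xi>. U = scal f \<otimes>\<^bsub>M\<^esub> K_sol \<iota> q p n A \<xi> \<and> f \<in> carrier Z \<and> f \<noteq> \<zero>\<^bsub>Z\<^esub> \<and> \<xi> \<noteq> 0"
proof -
  let ?e = "[:0, 1:]\<^sup>2 - 1 :: 'k poly"
  let ?u = "\<lambda>b. Kx.pt \<one>\<^bsub>Hp\<^esub> b"
  have ucl [simp]: "?u b \<in> carrier M" for b by (simp add: Mpt)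
  have umult: "?u b \<otimes>\<^bsub>M\<^esub> ?u b' = ?u (b * b')" for b b' by (simp add: Mpt)
  from principal obtain c where c: "\<forall>i\<le>n. c i \<in> carrier Z"
    and Uc: "U = (\<Oplus>\<^bsub>M\<^esub>i\<in>{..<n}. scal (c i) \<otimes>\<^bsub>M\<^esub> const_x \<iota> q p (c_K [^]\<^bsub>Kp\<^esub> i))
           \<oplus>\<^bsub>M\<^esub> scal (c n) \<otimes>\<^bsub>M\<^esub> const_x \<iota> q p (K_tilde \<iota> q p n A)"
    and c1: "c (n - 1) \<noteq> \<zero>\<^bsub>Z\<^esub>"
    unfolding is_principal_def Let_def by blast
  obtain d a where d: "d \<noteq> 0" and a: "\<forall>i\<le>n. Zx.pt 1 (Fract d 1) \<otimes>\<^bsub>Z\<^esub> c i = zx (a i)"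
    using denoms[OF c] by blast
  have sc [simp]: "scal (c i) \<in> carrier M" if "i \<le> n" for i using c that by (intro scal.hom_closed) simp
  have ua: "?u (Fract d 1) \<otimes>\<^bsub>M\<^esub> scal (c i) = mx (a i)" if "i \<le> n" for i
    using arg_cong[of _ _ scal, OF a[rule_format, OF that]] c that
    by (simp add: scal_zx scal_pt Zpt HK.hom_one)
  have F: "?u (Fract d 1) \<otimes>\<^bsub>M\<^esub> U = mK (basis_sum a)"
  proof -
    have "?u (Fract d 1) \<otimes>\<^bsub>M\<^esub> U
      = (\<Oplus>\<^bsub>M\<^esub>i\<in>{..<n}. ?u (Fract d 1) \<otimes>\<^bsub>M\<^esub> (scal (c i) \<otimes>\<^bsub>M\<^esub> const_x \<iota> q p (c_K [^]\<^bsub>Kp\<^esub> i)))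
        \<oplus>\<^bsub>M\<^esub> ?u (Fract d 1) \<otimes>\<^bsub>M\<^esub> (scal (c n) \<otimes>\<^bsub>M\<^esub> const_x \<iota> q p (K_tilde \<iota> q p n A))"
      unfolding Uc const_pow const_tilde
      by (simp add: M.r_distr M.finsum_closed M.finsum_rdistr Pi_def)
    also have "\<dots> = mK (basis_sum a)"
      unfolding mK_basis_sum const_pow const_tilde
      by (intro arg_cong2[where f = "add M"] M.finsum_cong')
        (auto simp: M.m_assoc[symmetric] ua)
    finally show ?thesis .
  qed
  obtain t where t: "moment_seq p n t" using exists_moment_seq[OF n degree_p] by blast
  interpret t: moment_seq p n t by (rule t)
  have "hr.sandwich (refl_poly var_u var_v (lift_v (basis_sum a)) (map_poly lift_v (basis_sum a))) = \<zero>\<^bsub>S\<^esub>"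
    using reflection_eq_iff[OF om d U F] refl by simp
  note moments = sandwich_eq_0_imp_moments[OF t this]
  have "a (n - 1) \<noteq> 0"
    by (rule denom_nonzero[OF _ c1 d]) (use a c in simp_all)
  then have "t.mm 1 (basis_sum a) \<noteq> 0" unfolding mm_basis_sum[OF t] .
  from t.moments_determine[OF degree_basis_sum coeff_p(2) moments this] obtain \<xi> where \<xi>: "\<xi> \<noteq> 0"
    and an: "Polynomial.coeff (basis_sum a) n \<noteq> 0"
    and eq: "smult ([:0, 1:]\<^sup>2 - 1) (basis_sum a) = smult (Polynomial.coeff (basis_sum a) n)
       (sol_poly (lift_v p) [:inverse \<xi>:] [:0, 1:] ([:\<xi>:] * [:0, 1:]))"
    by blast
  have eq': "smult ([:0, 1:]\<^sup>2 - 1) (basis_sum a) = smult (a n) (sol \<xi>)"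
    using eq unfolding coeff_basis_sum sol_def[OF \<xi>] sq_def[OF \<xi>] .
  \<comment> \<open>\<open>eq'\<close> says that \<open>x^2 - 1\<close> times the numerator of
    \<open>U\<close> is \<open>a n\<close> times \<open>sol\<close>; dividing by the common
    denominator \<open>d\<close> gives the factor from z(x).\<close>
  define f where "f = Zx.pt 1 (inverse (Fract d 1)) \<otimes>\<^bsub>Z\<^esub> zx (a n)"
  have f: "f \<in> carrier Z" by (simp add: f_def Zpt)
  have d': "Fract d 1 \<noteq> 0" using d by (simp add: Zero_fract_def eq_fract)
  have df: "Zx.pt 1 (Fract d 1) \<otimes>\<^bsub>Z\<^esub> f = zx (a n)"
  proof -
    have "Zx.pt 1 (Fract d 1 * inverse (Fract d 1)) = \<one>\<^bsub>Z\<^esub>"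
      using d' z0.hom_one by (simp del: inverse_fract)
    then have "Zx.pt 1 (Fract d 1) \<otimes>\<^bsub>Z\<^esub> Zx.pt 1 (inverse (Fract d 1)) = \<one>\<^bsub>Z\<^esub>"
      by (simp add: Zpt(2) del: inverse_fract mult_fract)
    then show ?thesis unfolding f_def by (simp add: Z.m_assoc[symmetric] Zpt(1) del: inverse_fract)
  qed
  have f0: "f \<noteq> \<zero>\<^bsub>Z\<^esub>"
    using df an zx_eq_0[of "a n"] by (auto simp: coeff_basis_sum Zpt)
  have fcl [simp]: "scal f \<in> carrier M" using f by (rule scal.hom_closed)
  have Kcl [simp]: "K_sol \<iota> q p n A \<xi> \<in> carrier M" by (rule K_sol_closed[OF \<xi>])
  \<comment> \<open>The equation is checked after multiplication by \<open>(x^2 - 1) d\<close>, a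
    unit since it lies in k(x).\<close>
  have "U = scal f \<otimes>\<^bsub>M\<^esub> K_sol \<iota> q p n A \<xi>"
  proof (rule M_cancel[OF _ U])
    show "Fract ?e 1 * Fract d 1 \<noteq> 0"
      using d' xx_nonzero[where ?'a = 'k] by (simp add: Zero_fract_def eq_fract)
    have l: "?u (Fract ?e 1 * Fract d 1) \<otimes>\<^bsub>M\<^esub> W = mx xx \<otimes>\<^bsub>M\<^esub> (?u (Fract d 1) \<otimes>\<^bsub>M\<^esub> W)"
      if "W \<in> carrier M" for W
      unfolding xx_M[OF \<xi>] umult[symmetric] using that by (simp add: M.m_assoc)
    have "?u (Fract ?e 1 * Fract d 1) \<otimes>\<^bsub>M\<^esub> U = mK (smult ([:0, 1:]\<^sup>2 - 1) (basis_sum a))"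
      unfolding l[OF U] F mK.ev_smult ..
    also have "\<dots> = mx (a n) \<otimes>\<^bsub>M\<^esub> (mx xx \<otimes>\<^bsub>M\<^esub> K_sol \<iota> q p n A \<xi>)"
      unfolding eq' mK.ev_smult K_sol_scaled[OF \<xi>] ..
    also have "\<dots> = mx xx \<otimes>\<^bsub>M\<^esub> (mx (a n) \<otimes>\<^bsub>M\<^esub> K_sol \<iota> q p n A \<xi>)"
      by (simp add: M.m_assoc[symmetric] mx.ev.hom_comm[of "a n"])
    also have "mx (a n) = ?u (Fract d 1) \<otimes>\<^bsub>M\<^esub> scal f"
      using arg_cong[OF df, of scal] f by (simp add: scal_zx scal_pt Zpt HK.hom_one)
    finally show "?u (Fract ?e 1 * Fract d 1) \<otimes>\<^bsub>M\<^esub> U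
        = ?u (Fract ?e 1 * Fract d 1) \<otimes>\<^bsub>M\<^esub> (scal f \<otimes>\<^bsub>M\<^esub> K_sol \<iota> q p n A \<xi>)"
      by (simp add: l M.m_assoc del: mult_fract)
  qed simp
  with f f0 \<xi> show ?thesis by blast
qed

end

end

theorem corollary4p6:
  fixes \<iota> :: "'k::field_char_0 \<Rightarrow> 'z::field"
    and q :: 'k and n :: nat and A :: "nat \<Rightarrow> 'z" and p :: "'z poly"
  assumes "\<iota> \<in> ring_hom ring_of_type_algebra ring_of_type_algebra"
    and "q \<noteq> 0" and "q \<noteq> 1" and "q \<noteq> -1"
    and "n \<ge> 2"
    and "p = - Polynomial.monom 1 (n + 1) + (\<Sum>i\<le>n. Polynomial.monom (A i) (n - i))"
    and "poly p 0 \<noteq> 0"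
  shows "{U \<in> carrier (K_p_of_x \<iota> q p). is_principal \<iota> q p n A U \<and> reflection_eq \<iota> q p U}
    = {scalar_x \<iota> q p f \<otimes>\<^bsub>K_p_of_x \<iota> q p\<^esub> K_sol \<iota> q p n A \<xi> | f \<xi>.
         f \<in> carrier (z_of_x \<iota>) \<and> f \<noteq> \<zero>\<^bsub>z_of_x \<iota>\<^esub> \<and> \<xi> \<noteq> 0}"
proof -
  have c: "cyclotomic \<iota>" using assms(1) by (rule cyclotomic.intro)
  \<comment> \<open>\<omega> times \<open>q\<close> is \<open>q * q - 1\<close>, so this is what
    makes \<omega> non-zero.\<close>
  have "q * q \<noteq> 1" using assms(3,4) by (simp add: square_eq_1_iff)
  then have om: "cyclotomic.om q \<noteq> 0"
    using assms(2) by (auto simp: cyclotomic.om_def[OF c] field_simps)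
  show ?thesis (is "?L = ?R")
  proof (intro equalityI subsetI)
    fix U assume "U \<in> ?L"
    then have "U \<in> carrier (K_p_of_x \<iota> q p)" "is_principal \<iota> q p n A U" "reflection_eq \<iota> q p U"
      by simp_all
    from cyclotomic.solution_is_in_family[OF c assms(5,6) om this] show "U \<in> ?R" by blast
  next
    fix U assume "U \<in> ?R"
    then obtain f \<xi> where U: "U = scalar_x \<iota> q p f \<otimes>\<^bsub>K_p_of_x \<iota> q p\<^esub> K_sol \<iota> q p n A \<xi>"
      and f: "f \<in> carrier (z_of_x \<iota>)" "f \<noteq> \<zero>\<^bsub>z_of_x \<iota>\<^esub>" and \<xi>: "\<xi> \<noteq> 0" by blast
    from cyclotomic.solution_family[OF c assms(5,6) \<xi> om f] show "U \<in> ?L"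
      unfolding U by simp
  qed
qed

end
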